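(* Let $N\ge2$, $R>0$, and let $f:[0,\infty)\to[0,\infty)$ satisfy $(f_1)$, $(f_2)$, $(f_3)$ (listed in the context). Suppose $f$ is sub-exponential, i.e. there is $\beta>0$ with $\sup_{t\ge0}f(t)e^{-\beta t}<\infty$. Then any solution $u$ of $(P_R^* )$ that is a solution of $(P_{0,R})$ is regular in $B_R$, that is, $u\in C^{1,\vartheta}_{\rm loc}(B_R)$ for some $\vartheta\in(0,1)$ (after modification on a null set).
   Context: $B_R\subset\mathbb R^N$ is the open ball of radius $R$ centred at $0$; $\Delta_N u=\operatorname{div}(|\nabla u|^{N-2}\nabla u)$. $L^\infty_{\rm loc}(\overline B_R\setminus\{0\})$ denotes functions essentially bounded on compact subsets of $\overline B_R\setminus\{0\}$. Standing assumptions on $f$: $(f_1)$ $f$ is locally Hölder continuous on $[0,\infty)$ with some exponent $\theta\in(0,1)$; $(f_2)$ $\liminf_{t\to\infty}f(t)t^{1-N}>0$; $(f_3)$ there is $\kappa>0$ such that $t\mapsto f(t)+\kappa t^{N-1}$ is non-decreasing on $[0,\infty)$. A solution of $(P_R^* )$ is a radial function $u\ge0$ on $B_R\setminus\{0\}$, $u\in L^\infty_{\rm loc}(\overline B_R\setminus\{0\})$, weakly differentiable with $|\nabla u|\in L^{N-1}_{\rm loc}(B_R\setminus\{0\})$, with $-\Delta_N u=f(u)$ in $\mathcal D'(B_R\setminus\{0\})$, i.e. $\int|\nabla u|^{N-2}\nabla u\cdot\nabla\phi\,dx=\int f(u)\phi\,dx$ for all $\phi\in C_0^\infty(B_R\setminus\{0\})$.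 $u\ge0$ is a solution of $(P_{0,R})$ if $u\in L^1_{\rm loc}(B_R)$, $|\nabla u|\in L^{N-1}_{\rm loc}(B_R)$, $f(u)\in L^\infty_{\rm loc}(\overline B_R\setminus\{0\})\cap L^1(B_R)$ and $-\Delta_N u=f(u)$ in $\mathcal D'(B_R)$, i.e. $\int_{B_R}|\nabla u|^{N-2}\nabla u\cdot\nabla\phi\,dx=\int_{B_R}f(u)\phi\,dx$ for all $\phi\in C_0^\infty(B_R)$. (It is known, by Brezis–Lions for $N=2$ and Véron for $N>2$, that every solution of $(P^*_R)$ lies in $W^{1,p}(B_R)$ for all $1\le p<N$.) *)

theory Defs
  imports "HOL-Analysis.Analysis"
begin

text \<open>
  \<open>\<real>\<^sup>N\<close> is rendered as \<open>real ^ 'n\<close> with \<open>N = CARD('n)\<close>.  Functions on a subset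
  of \<open>\<real>\<^sup>N\<close> are total functions whose values elsewhere are irrelevant, and
  ``almost everywhere'' refers to Lebesgue measure.
\<close>

definition locally_bounded_ae :: "'a::euclidean_space set \<Rightarrow> ('a \<Rightarrow> real) \<Rightarrow> bool" where
  "locally_bounded_ae S u \<longleftrightarrow>
     set_borel_measurable lebesgue S u \<and>
     (\<forall>K. compact K \<and> K \<subseteq> S \<longrightarrow> (\<exists>C. AE x in lebesgue. x \<in> K \<longrightarrow> \<bar>u x\<bar> \<le> C))"

definition locally_Lp ::
    "nat \<Rightarrow> 'a::euclidean_space set \<Rightarrow> ('a \<Rightarrow> 'b::euclidean_space) \<Rightarrow> bool" where
  "locally_Lp p S g \<longleftrightarrow>
     set_borel_measurable lebesgue S g \<and>
     (\<forall>K. compact K \<and> K \<subseteq> S \<longrightarrow> set_integrable lebesgue K (\<lambda>x. norm (g x) ^ p))"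

definition locally_Hoelder ::
    "real \<Rightarrow> 'a::metric_space set \<Rightarrow> ('a \<Rightarrow> 'b::metric_space) \<Rightarrow> bool" where
  "locally_Hoelder \<theta> S g \<longleftrightarrow>
     (\<forall>K. compact K \<and> K \<subseteq> S \<longrightarrow>
       (\<exists>C. \<forall>x\<in>K. \<forall>y\<in>K. dist (g x) (g y) \<le> C * dist x y powr \<theta>))"

text \<open>The space \<open>C\<^sup>1\<^sup>,\<^sup>\<theta>\<close>, locally in the open set \<open>S\<close>; for \<open>\<theta> > 0\<close> continuity of the
  gradient follows from its local Hoelder continuity.\<close>

definition locally_C1_Hoelder ::
    "real \<Rightarrow> 'a::euclidean_space set \<Rightarrow> ('a \<Rightarrow> real) \<Rightarrow> bool" where
  "locally_C1_Hoelder \<theta> S v \<longleftrightarrow>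
     (\<exists>G. (\<forall>x\<in>S. GDERIV v x :> G x) \<and> locally_Hoelder \<theta> S G)"

definition partial_deriv :: "'n::finite \<Rightarrow> (real ^ 'n \<Rightarrow> real) \<Rightarrow> real ^ 'n \<Rightarrow> real" where
  "partial_deriv i \<phi> x = frechet_derivative \<phi> (at x) (axis i 1)"

definition gradient :: "(real ^ 'n::finite \<Rightarrow> real) \<Rightarrow> real ^ 'n \<Rightarrow> real ^ 'n" where
  "gradient \<phi> x = (\<chi> i. partial_deriv i \<phi> x)"

primrec Ck :: "nat \<Rightarrow> (real ^ 'n::finite \<Rightarrow> real) \<Rightarrow> bool" where
  "Ck 0 \<phi> \<longleftrightarrow> continuous_on UNIV \<phi>"
| "Ck (Suc k) \<phi> \<longleftrightarrow> (\<forall>x. \<phi> differentiable (at x)) \<and> (\<forall>i. Ck k (partial_deriv i \<phi>))"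

text \<open>\<open>C\<^sub>0\<^sup>\<infinity>(S)\<close> for open \<open>S\<close>; its elements are extended by zero to the whole space.\<close>

definition test_functions :: "(real ^ 'n::finite) set \<Rightarrow> (real ^ 'n \<Rightarrow> real) set" where
  "test_functions S =
     {\<phi>. (\<forall>k. Ck k \<phi>) \<and> compact (closure {x. \<phi> x \<noteq> 0}) \<and> closure {x. \<phi> x \<noteq> 0} \<subseteq> S}"

definition has_weak_gradient ::
    "(real ^ 'n::finite \<Rightarrow> real) \<Rightarrow> (real ^ 'n \<Rightarrow> real ^ 'n) \<Rightarrow> (real ^ 'n) set \<Rightarrow> bool" where
  "has_weak_gradient u g S \<longleftrightarrow>
     locally_Lp 1 S u \<and> locally_Lp 1 S g \<and>
     (\<forall>\<phi>\<in>test_functions S. \<forall>i.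
        (LINT x:S|lebesgue. u x * partial_deriv i \<phi> x) = - (LINT x:S|lebesgue. g x $ i * \<phi> x))"

text \<open>\<open>-\<Delta>\<^sub>N u = h\<close> in \<open>\<D>'(S)\<close>, in terms of the weak gradient \<open>g\<close> of \<open>u\<close>.\<close>

definition N_Laplace_eq ::
    "(real ^ 'n::finite) set \<Rightarrow> (real ^ 'n \<Rightarrow> real ^ 'n) \<Rightarrow> (real ^ 'n \<Rightarrow> real) \<Rightarrow> bool" where
  "N_Laplace_eq S g h \<longleftrightarrow>
     (\<forall>\<phi>\<in>test_functions S.
        (LINT x:S|lebesgue. (norm (g x) ^ (CARD('n) - 2) *\<^sub>R g x) \<bullet> gradient \<phi> x) =
        (LINT x:S|lebesgue. h x * \<phi> x))"

text \<open>Solutions are identified when they agree almost everywhere, so radial symmetry and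
  nonnegativity are required almost everywhere.\<close>

definition solution_punctured ::
    "real \<Rightarrow> (real \<Rightarrow> real) \<Rightarrow> (real ^ 'n::finite \<Rightarrow> real) \<Rightarrow> bool" where
  "solution_punctured R f u \<longleftrightarrow>
     (\<exists>w. AE x in lebesgue. x \<in> ball 0 R - {0} \<longrightarrow> u x = w (norm x)) \<and>
     (AE x in lebesgue. x \<in> ball 0 R - {0} \<longrightarrow> 0 \<le> u x) \<and>
     locally_bounded_ae (cball 0 R - {0}) u \<and>
     (\<exists>g. has_weak_gradient u g (ball 0 R - {0}) \<and>
          locally_Lp (CARD('n) - 1) (ball 0 R - {0}) g \<and>
          N_Laplace_eq (ball 0 R - {0}) g (\<lambda>x. f (u x)))"

definition solution_ball ::
    "real \<Rightarrow> (real \<Rightarrow> real) \<Rightarrow> (real ^ 'n::finite \<Rightarrow> real) \<Rightarrow> bool" where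
  "solution_ball R f u \<longleftrightarrow>
     (AE x in lebesgue. x \<in> ball 0 R \<longrightarrow> 0 \<le> u x) \<and>
     locally_Lp 1 (ball 0 R) u \<and>
     locally_bounded_ae (cball 0 R - {0}) (\<lambda>x. f (u x)) \<and>
     set_integrable lebesgue (ball 0 R) (\<lambda>x. f (u x)) \<and>
     (\<exists>g. has_weak_gradient u g (ball 0 R) \<and>
          locally_Lp (CARD('n) - 1) (ball 0 R) g \<and>
          N_Laplace_eq (ball 0 R) g (\<lambda>x. f (u x)))"

end

theory Submission
  imports Defs
begin

text \<open>
  Write \<open>h = f(u)\<close>, let \<open>H(r)\<close> be the integral of \<open>h\<close> over the ball of radius \<open>r\<close>, and let
  \<open>\<omega>\<close> be the volume of the unit ball.  Mollifying \<open>\<nabla>u\<close> with a radial kernel produces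
  exactly equivariant fields, so \<open>\<nabla>u(x) = \<gamma>(|x|) x/|x|\<close> almost everywhere.  Testing the
  equation on the whole ball, origin included, with radial functions then gives
  \<open>N \<omega> r\<^sup>N\<^sup>-\<^sup>1 |\<gamma>|\<^sup>N\<^sup>-\<^sup>2 \<gamma> = - H(r)\<close>, that is,
  \<open>u'(r) = - (H(r) / (N \<omega> r\<^sup>N\<^sup>-\<^sup>1)) powr (1/(N-1))\<close>.  Since \<open>H(r) \<rightarrow> 0\<close> we get \<open>r u'(r) \<rightarrow> 0\<close>, so
  \<open>u\<close> is eventually smaller than every multiple of \<open>ln (1/r)\<close>; with \<open>f\<close> sub-exponential, \<open>h\<close>
  is then \<open>O(r powr (-1/2))\<close>, whence \<open>u'\<close>, \<open>u\<close> and finally \<open>h\<close> are bounded.  For bounded \<open>h\<close>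
  the quotient \<open>H(r) / r\<^sup>N\<^sup>-\<^sup>1\<close> is Lipschitz and \<open>O(r)\<close>, so its root of order \<open>N-1\<close> is Hoelder
  continuous with exponent \<open>1/(N-1)\<close>; the exponent \<open>1/N\<close> serves also for \<open>N = 2\<close>.
\<close>

subsection \<open>Smooth functions of one and several variables\<close>

definition flat :: "nat \<Rightarrow> real \<Rightarrow> real" where
  "flat j t = (if t > 0 then exp (- 1 / t) / t ^ j else 0)"

lemma flat_nonneg: "0 \<le> flat j t"
  by (simp add: flat_def)

lemma flat_pos_iff: "0 < flat j t \<longleftrightarrow> 0 < t"
  by (simp add: flat_def)

lemma flat_tendsto_0: "((\<lambda>t. exp (- 1 / t) / t ^ j) \<longlongrightarrow> 0) (at_right (0::real))"
proof -
  have "((\<lambda>s::real. s ^ j / exp s) \<longlongrightarrow> 0) at_top"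
    by (rule tendsto_power_div_exp_0)
  then have "((\<lambda>t::real. inverse t ^ j / exp (inverse t)) \<longlongrightarrow> 0) (at_right 0)"
    by (rule filterlim_compose[OF _ filterlim_inverse_at_top_right])
  then show ?thesis
    by (simp add: exp_minus field_simps)
qed

lemma flat_has_derivative:
  "(flat j has_real_derivative flat (j + 2) t - real j * flat (Suc j) t) (at t)"
proof -
  consider "t > 0" | "t < 0" | "t = 0" by linarith
  then show ?thesis
  proof cases
    case 1
    have pow: "real j * (t * t ^ (j - Suc 0)) = real j * t ^ j"
      by (cases j) auto
    have "((\<lambda>t. exp (- 1 / t) * inverse t ^ j) has_real_derivative
        exp (- 1 / t) * inverse t ^ (j + 2) - real j * (exp (- 1 / t) * inverse t ^ (Suc j))) (at t)"
      using 1 pow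
      by (auto intro!: derivative_eq_intros simp: field_simps power2_eq_square)
         (simp add: algebra_simps)?
    then have "((\<lambda>t. exp (- 1 / t) / t ^ j) has_real_derivative flat (j + 2) t - real j * flat (Suc j) t) (at t)"
      using 1 by (simp add: flat_def field_simps)
    then show ?thesis
      by (rule DERIV_cong_ev[OF refl _ refl, THEN iffD1, rotated])
        (use 1 in \<open>auto simp: flat_def eventually_nhds intro!: exI[of _ "{0<..}"]\<close>)
  next
    case 2
    have "((\<lambda>t. 0) has_real_derivative 0) (at t)" by simp
    then have "(flat j has_real_derivative 0) (at t)"
      by (rule DERIV_cong_ev[OF refl _ refl, THEN iffD1, rotated])
        (use 2 in \<open>auto simp: flat_def eventually_nhds intro!: exI[of _ "{..<0}"]\<close>)
    then show ?thesis using 2 by (simp add: flat_def)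
  next
    case 3
    have "((\<lambda>h. flat j h / h) \<longlongrightarrow> 0) (at_right 0)"
      by (rule Lim_transform_eventually[OF flat_tendsto_0[of "Suc j"]])
        (auto simp: eventually_at_filter flat_def field_simps)
    moreover have "((\<lambda>h. flat j h / h) \<longlongrightarrow> 0) (at_left 0)"
      by (rule Lim_transform_eventually[OF tendsto_const])
        (auto simp: eventually_at_filter flat_def)
    ultimately have "((\<lambda>h. flat j h / h) \<longlongrightarrow> 0) (at 0)"
      by (simp add: filterlim_split_at)
    then show ?thesis using 3 by (simp add: DERIV_def) (simp add: flat_def)
  qed
qed

primrec C_real :: "nat \<Rightarrow> (real \<Rightarrow> real) \<Rightarrow> bool" where
  "C_real 0 s \<longleftrightarrow> continuous_on UNIV s"
| "C_real (Suc k) s \<longleftrightarrow> (\<exists>s'. (\<forall>t. (s has_real_derivative s' t) (at t)) \<and> C_real k s')"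

lemma C_real_SucI:
  "(\<And>t. (s has_real_derivative s' t) (at t)) \<Longrightarrow> C_real k s' \<Longrightarrow> C_real (Suc k) s"
  by auto

lemma C_real_SucE:
  assumes "C_real (Suc k) s"
  obtains s' where "\<And>t. (s has_real_derivative s' t) (at t)" "C_real k s'"
  using assms by auto

lemma C_real_decr: "C_real (Suc k) s \<Longrightarrow> C_real k s"
proof (induction k arbitrary: s)
  case 0
  then show ?case
    by (auto simp: continuous_on_eq_continuous_at intro: DERIV_isCont)
next
  case (Suc k)
  obtain s' where
    "\<And>t. (s has_real_derivative s' t) (at t)" "C_real (Suc k) s'"
    by (rule C_real_SucE[OF Suc.prems]) (rule that)
  with Suc.IH show ?case by (intro C_real_SucI)
qed

lemma C_real_const [intro, simp]: "C_real k (\<lambda>t. c)"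
  by (induction k arbitrary: c) (simp, intro C_real_SucI[of _ "\<lambda>_. 0"], auto)

lemma C_real_id [intro, simp]: "C_real k (\<lambda>t. t)"
  by (cases k) (simp, simp del: C_real.simps, intro C_real_SucI[of _ "\<lambda>_. 1"], auto)

lemma C_real_add: "C_real k s \<Longrightarrow> C_real k r \<Longrightarrow> C_real k (\<lambda>t. s t + r t)"
proof (induction k arbitrary: s r)
  case (Suc k)
  from Suc.prems obtain s' r' where
    "\<forall>t. (s has_real_derivative s' t) (at t)" "\<forall>t. (r has_real_derivative r' t) (at t)"
    "C_real k s'" "C_real k r'"
    by auto
  then have "\<forall>t. ((\<lambda>t. s t + r t) has_real_derivative s' t + r' t) (at t)"
    "C_real k (\<lambda>t. s' t + r' t)"
    using DERIV_add Suc.IH by blast+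
  then show ?case by (intro C_real_SucI) auto
qed (auto intro!: continuous_intros)

lemma C_real_mult: "C_real k s \<Longrightarrow> C_real k r \<Longrightarrow> C_real k (\<lambda>t. s t * r t)"
proof (induction k arbitrary: s r)
  case (Suc k)
  from Suc.prems obtain s' r' where *:
    "\<And>t. (s has_real_derivative s' t) (at t)" "\<And>t. (r has_real_derivative r' t) (at t)"
    "C_real k s'" "C_real k r'"
    by auto
  have "((\<lambda>t. s t * r t) has_real_derivative s' t * r t + r' t * s t) (at t)" for t
    using * by (auto intro!: derivative_eq_intros)
  moreover have "C_real k (\<lambda>t. s' t * r t + r' t * s t)"
    using Suc.prems C_real_decr * by (intro C_real_add Suc.IH) auto
  ultimately show ?case by (rule C_real_SucI)
qed (auto intro!: continuous_intros)

lemma C_real_comp: "C_real k s \<Longrightarrow> C_real k q \<Longrightarrow> C_real k (\<lambda>t. s (q t))"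
proof (induction k arbitrary: s q)
  case 0
  then show ?case by (auto intro: continuous_on_compose2)
next
  case (Suc k)
  from Suc.prems obtain s' q' where *:
    "\<And>t. (s has_real_derivative s' t) (at t)" "\<And>t. (q has_real_derivative q' t) (at t)"
    "C_real k s'" "C_real k q'"
    by auto
  have "((\<lambda>t. s (q t)) has_real_derivative s' (q t) * q' t) (at t)" for t
    by (rule DERIV_chain2[OF *(1,2)])
  moreover have "C_real k (\<lambda>t. s' (q t) * q' t)"
    by (intro C_real_mult Suc.IH[OF *(3)] C_real_decr[OF Suc.prems(2)] *(4))
  ultimately show ?case by (rule C_real_SucI)
qed

lemma C_real_flat: "C_real k (flat j)"
proof (induction k arbitrary: j)
  case 0
  show ?case
    using flat_has_derivative by (auto simp: continuous_on_eq_continuous_at intro: DERIV_isCont)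
next
  case (Suc k)
  have "C_real k (\<lambda>t. flat (j + 2) t + (- real j) * flat (Suc j) t)"
    by (intro C_real_add C_real_mult Suc.IH C_real_const)
  then show ?case
    by (intro C_real_SucI[OF flat_has_derivative]) simp
qed

lemma continuous_on_flat [continuous_intros]:
  "continuous_on S q \<Longrightarrow> continuous_on S (\<lambda>x. flat j (q x))"
  using C_real_flat[of 0 j] by (auto intro: continuous_on_compose2)

lemma borel_measurable_flat [measurable]: "flat j \<in> borel_measurable borel"
  by (intro borel_measurable_continuous_onI continuous_intros)

lemma partial_deriv_eqI:
  "(\<phi> has_derivative D) (at x) \<Longrightarrow> partial_deriv i \<phi> x = D (axis i 1)"
  by (simp add: partial_deriv_def frechet_derivative_at[symmetric])

lemma Ck_decr: "Ck (Suc k) \<phi> \<Longrightarrow> Ck k \<phi>"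
proof (induction k arbitrary: \<phi>)
  case 0
  then show ?case
    by (auto simp: continuous_on_eq_continuous_at differentiable_imp_continuous_within)
next
  case (Suc k)
  then show ?case by (metis Ck.simps(2))
qed

lemma Ck_const [intro, simp]: "Ck k (\<lambda>x::real^'n::finite. c)"
proof (induction k arbitrary: c)
  case (Suc k)
  have "partial_deriv i (\<lambda>x::real^'n. c) = (\<lambda>x. 0)" for i
    by (rule ext) (auto simp: partial_deriv_eqI[OF has_derivative_const])
  then show ?case using Suc by simp
qed simp

lemma Ck_add: "Ck k \<phi> \<Longrightarrow> Ck k \<psi> \<Longrightarrow> Ck k (\<lambda>x. \<phi> x + \<psi> x)"
proof (induction k arbitrary: \<phi> \<psi>)
  case (Suc k)
  have "partial_deriv i (\<lambda>x. \<phi> x + \<psi> x) = (\<lambda>x. partial_deriv i \<phi> x + partial_deriv i \<psi> x)" for i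
  proof
    fix x
    have "(\<phi> has_derivative frechet_derivative \<phi> (at x)) (at x)"
      "(\<psi> has_derivative frechet_derivative \<psi> (at x)) (at x)"
      using Suc.prems by (auto simp: frechet_derivative_works[symmetric])
    from partial_deriv_eqI[OF has_derivative_add[OF this]]
    show "partial_deriv i (\<lambda>x. \<phi> x + \<psi> x) x = partial_deriv i \<phi> x + partial_deriv i \<psi> x"
      by (simp add: partial_deriv_def)
  qed
  with Suc show ?case by auto
qed (auto intro!: continuous_intros)

lemma Ck_mult: "Ck k \<phi> \<Longrightarrow> Ck k \<psi> \<Longrightarrow> Ck k (\<lambda>x. \<phi> x * \<psi> x)"
proof (induction k arbitrary: \<phi> \<psi>)
  case (Suc k)
  have "partial_deriv i (\<lambda>x. \<phi> x * \<psi> x) = (\<lambda>x. \<phi> x * partial_deriv i \<psi> x + partial_deriv i \<phi> x * \<psi> x)" for i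
  proof
    fix x
    have "(\<phi> has_derivative frechet_derivative \<phi> (at x)) (at x)"
      "(\<psi> has_derivative frechet_derivative \<psi> (at x)) (at x)"
      using Suc.prems by (auto simp: frechet_derivative_works[symmetric])
    from partial_deriv_eqI[OF has_derivative_mult[OF this]]
    show "partial_deriv i (\<lambda>x. \<phi> x * \<psi> x) x = \<phi> x * partial_deriv i \<psi> x + partial_deriv i \<phi> x * \<psi> x"
      by (simp add: partial_deriv_def)
  qed
  moreover have "Ck k (\<lambda>x. \<phi> x * partial_deriv i \<psi> x + partial_deriv i \<phi> x * \<psi> x)" for i
    using Suc.prems Ck_decr by (intro Ck_add Suc.IH) auto
  ultimately show ?case using Suc.prems by auto
qed (auto intro!: continuous_intros)

lemma partial_deriv_comp:
  assumes "(s has_real_derivative s') (at (q x))" "(q has_derivative D) (at x)"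
  shows "partial_deriv i (\<lambda>x. s (q x)) x = s' * D (axis i 1)"
proof -
  have "((\<lambda>x. s (q x)) has_derivative (\<lambda>h. s' * D h)) (at x)"
    using has_derivative_compose[OF assms(2)] assms(1) unfolding has_field_derivative_def by blast
  then show ?thesis by (rule partial_deriv_eqI)
qed

lemma Ck_comp: "C_real k s \<Longrightarrow> Ck k q \<Longrightarrow> Ck k (\<lambda>x. s (q x))"
proof (induction k arbitrary: s q)
  case 0
  then show ?case by (auto intro: continuous_on_compose2)
next
  case (Suc k)
  from Suc.prems obtain s' where s':
    "\<And>t. (s has_real_derivative s' t) (at t)" "C_real k s'"
    by auto
  have q: "(q has_derivative frechet_derivative q (at x)) (at x)" for x
    using Suc.prems by (auto simp: frechet_derivative_works[symmetric])
  have "partial_deriv i (\<lambda>x. s (q x)) = (\<lambda>x. s' (q x) * partial_deriv i q x)" for i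
    by (rule ext, subst partial_deriv_comp[OF s'(1) q]) (simp add: partial_deriv_def)
  moreover have "Ck k (\<lambda>x. s' (q x) * partial_deriv i q x)" for i
    using Suc.prems by (intro Ck_mult Suc.IH[OF s'(2)] Ck_decr[OF Suc.prems(2)]) auto
  moreover have "(\<lambda>x. s (q x)) differentiable (at x)" for x
    using has_derivative_compose[OF q] s'(1) unfolding has_field_derivative_def differentiable_def by blast
  ultimately show ?case by auto
qed

lemma norm_square_has_derivative:
  "((\<lambda>y. (norm (x - y))\<^sup>2) has_derivative (\<lambda>h. - 2 * ((x - y) \<bullet> h))) (at (y::'a::real_inner))"
  unfolding power2_norm_eq_inner
  by (auto intro!: derivative_eq_intros simp: inner_diff inner_commute algebra_simps)

lemma Ck_norm_square: "Ck k (\<lambda>y::real^'n::finite. (norm (x - y))\<^sup>2)"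
proof -
  have lin: "Ck k (\<lambda>y::real^'n. c + d * y $ i)" for k c d i
  proof (cases k)
    case 0
    then show ?thesis by (auto intro!: continuous_intros)
  next
    case (Suc m)
    have *: "((\<lambda>y::real^'n. c + d * y $ i) has_derivative (\<lambda>h. d * h $ i)) (at y)" for y
      by (rule has_derivative_eq_rhs, rule has_derivative_add[OF has_derivative_const])
        (auto intro!: bounded_linear_imp_has_derivative
          bounded_linear_compose[OF bounded_linear_mult_right bounded_linear_vec_nth])
    have "partial_deriv j (\<lambda>y::real^'n. c + d * y $ i) = (\<lambda>y. d * axis j 1 $ i)" for j
      by (rule ext) (rule partial_deriv_eqI[OF *])
    then show ?thesis using Suc * by (auto simp: differentiable_def)
  qed
  show ?thesis
  proof (cases k)
    case 0
    then show ?thesis by (auto intro!: continuous_intros)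
  next
    case (Suc m)
    have "partial_deriv i (\<lambda>y. (norm (x - y))\<^sup>2) = (\<lambda>y. - 2 * x $ i + 2 * y $ i)" for i
      by (rule ext, subst partial_deriv_eqI[OF norm_square_has_derivative]) (simp add: inner_axis)
    moreover have "(\<lambda>y. (norm (x - y))\<^sup>2) differentiable (at y)" for y :: "real^'n"
      using norm_square_has_derivative by (rule differentiableI)
    moreover have "Ck m (\<lambda>y::real^'n. - 2 * x $ i + 2 * y $ i)" for i
      by (rule lin)
    ultimately show ?thesis using Suc by (simp only: Ck.simps) blast
  qed
qed

definition kern :: "real \<Rightarrow> 'a::euclidean_space \<Rightarrow> real" where
  "kern \<epsilon> z = flat 0 (\<epsilon>\<^sup>2 - (norm z)\<^sup>2)"

lemma kern_nonneg: "0 \<le> kern \<epsilon> z"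
  by (simp add: kern_def flat_nonneg)

lemma kern_pos_iff: "0 < \<epsilon> \<Longrightarrow> 0 < kern \<epsilon> z \<longleftrightarrow> norm z < \<epsilon>"
  unfolding kern_def flat_pos_iff diff_gt_0_iff_gt
  by (metis less_imp_le norm_ge_zero power2_less_imp_less power_strict_mono zero_less_numeral)

lemma kern_eq_0: "0 < \<epsilon> \<Longrightarrow> \<epsilon> \<le> norm z \<Longrightarrow> kern \<epsilon> z = 0"
  using kern_pos_iff[of \<epsilon> z] kern_nonneg[of \<epsilon> z] by linarith

lemma kern_le_1: "kern \<epsilon> z \<le> 1"
  by (auto simp: kern_def flat_def)

lemma continuous_on_kern [continuous_intros]:
  "continuous_on S q \<Longrightarrow> continuous_on S (\<lambda>x. kern \<epsilon> (q x))"
  unfolding kern_def by (intro continuous_intros)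

lemma borel_measurable_kern [measurable]: "kern \<epsilon> \<in> borel_measurable borel"
  by (intro borel_measurable_continuous_onI continuous_intros)

lemma kern_has_derivative:
  "((\<lambda>y. kern \<epsilon> (x - y)) has_derivative
     (\<lambda>h. 2 * flat 2 (\<epsilon>\<^sup>2 - (norm (x - y))\<^sup>2) * ((x - y) \<bullet> h))) (at y)"
proof -
  have 1: "((\<lambda>y. \<epsilon>\<^sup>2 - (norm (x - y))\<^sup>2) has_derivative (\<lambda>h. 2 * ((x - y) \<bullet> h))) (at y)"
    using has_derivative_diff[OF has_derivative_const norm_square_has_derivative] by (simp add: algebra_simps)
  show ?thesis
    using has_derivative_compose[OF 1
        flat_has_derivative[of 0, unfolded has_field_derivative_def]]
    by (simp add: kern_def mult_ac numeral_2_eq_2)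
qed

lemma partial_deriv_kern:
  "partial_deriv i (\<lambda>y. kern \<epsilon> (x - y)) y = 2 * flat 2 (\<epsilon>\<^sup>2 - (norm (x - y))\<^sup>2) * (x - y) $ i"
  by (simp add: partial_deriv_eqI[OF kern_has_derivative] inner_axis)

lemma kern_test_function:
  assumes "0 < \<epsilon>" "cball x \<epsilon> \<subseteq> S"
  shows "(\<lambda>y. kern \<epsilon> (x - y)) \<in> test_functions S"
proof -
  have "{y. kern \<epsilon> (x - y) \<noteq> 0} \<subseteq> cball x \<epsilon>"
  proof
    fix y assume "y \<in> {y. kern \<epsilon> (x - y) \<noteq> 0}"
    then have "\<not> \<epsilon> \<le> norm (x - y)" using kern_eq_0[OF assms(1)] by blast
    then show "y \<in> cball x \<epsilon>" by (simp add: dist_norm)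
  qed
  then have *: "closure {y. kern \<epsilon> (x - y) \<noteq> 0} \<subseteq> cball x \<epsilon>"
    by (simp add: closure_minimal)
  have "C_real k (\<lambda>t. flat 0 (\<epsilon>\<^sup>2 + (- 1) * t))" for k
    by (intro C_real_comp[OF C_real_flat] C_real_add C_real_mult C_real_const C_real_id)
  from Ck_comp[OF this Ck_norm_square] have "Ck k (\<lambda>y. kern \<epsilon> (x - y))" for k
    by (simp add: kern_def)
  moreover have "compact (closure {y. kern \<epsilon> (x - y) \<noteq> 0})"
    using * by (meson bounded_cball bounded_subset compact_eq_bounded_closed closed_closure)
  ultimately show ?thesis
    using * assms(2) by (auto simp: test_functions_def)
qed

subsection \<open>Mollification in \<open>L\<^sup>1\<close>\<close>

lemma unit_ball_vol_neq_0: "unit_ball_vol (real DIM('a::euclidean_space)) \<noteq> 0"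
  by (metis less_irrefl of_nat_0_le_iff unit_ball_vol_pos)

lemma lborel_distr_reflect: "distr lborel borel (\<lambda>x. a - x) = (lborel :: 'a::euclidean_space measure)"
  by (subst (2) lborel_affine[of "-1" a]) (simp_all add: density_1)

lemma nn_integral_lborel_reflect:
  assumes [measurable]: "F \<in> borel_measurable borel"
  shows "(\<integral>\<^sup>+x. F (a - x) \<partial>lborel) = (\<integral>\<^sup>+x. F x \<partial>(lborel :: 'a::euclidean_space measure))"
  by (subst (2) lborel_distr_reflect[of a, symmetric]) (simp add: nn_integral_distr)

lemma integral_lborel_reflect:
  fixes F :: "'a::euclidean_space \<Rightarrow> 'b::{banach, second_countable_topology}"
  assumes [measurable]: "F \<in> borel_measurable borel"
  shows "(LBINT x. F (a - x)) = (LBINT x. F x)"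
  by (subst (2) lborel_distr_reflect[of a, symmetric]) (simp add: integral_distr)

lemma integrable_kern:
  assumes "0 < \<epsilon>" shows "integrable lborel (kern \<epsilon> :: 'a::euclidean_space \<Rightarrow> real)"
proof (rule Bochner_Integration.integrable_bound)
  show "integrable lborel (indicator (cball 0 \<epsilon> :: 'a set) :: _ \<Rightarrow> real)"
    using emeasure_lborel_cball_finite[of "0::'a" \<epsilon>] by (simp add: integrable_indicator_iff)
  show "AE x :: 'a in lborel. norm (kern \<epsilon> x) \<le> norm (indicator (cball 0 \<epsilon>) x :: real)"
  proof (intro AE_I2)
    fix x :: 'a
    show "norm (kern \<epsilon> x) \<le> norm (indicator (cball 0 \<epsilon>) x :: real)"
      using kern_eq_0[OF assms, of x] kern_nonneg[of \<epsilon> x] kern_le_1[of \<epsilon> x]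
      by (cases "norm x \<le> \<epsilon>") (auto simp: indicator_def)
  qed
qed simp

definition nkern :: "real \<Rightarrow> 'a::euclidean_space \<Rightarrow> real" where
  "nkern \<epsilon> z = kern \<epsilon> z / (LBINT y. kern \<epsilon> (y::'a))"

lemma kern_mass_pos:
  assumes "0 < \<epsilon>" shows "0 < (LBINT y. kern \<epsilon> (y::'a::euclidean_space))"
proof -
  have "(LBINT y. kern \<epsilon> (y::'a)) \<noteq> 0"
  proof
    assume "(LBINT y. kern \<epsilon> (y::'a)) = 0"
    then have "AE y::'a in lborel. kern \<epsilon> y = 0"
      using integral_nonneg_eq_0_iff_AE[OF integrable_kern[OF assms, where 'a='a]] by (simp add: kern_nonneg)
    then have "AE y in lborel. y \<notin> ball (0::'a) \<epsilon>"
      by eventually_elim (use kern_pos_iff[OF assms] in \<open>force simp: dist_norm\<close>)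
    then have "emeasure lborel (ball (0::'a) \<epsilon>) = 0"
      by (subst (asm) AE_iff_measurable[of "ball 0 \<epsilon>"]) (auto simp: space_lborel)
    moreover have "0 < emeasure lborel (ball (0::'a) \<epsilon>)"
      using assms by (subst emeasure_ball) (auto intro!: mult_pos_pos)
    ultimately show False by simp
  qed
  moreover have "0 \<le> (LBINT y. kern \<epsilon> (y::'a))"
    by (simp add: kern_nonneg integral_nonneg_AE)
  ultimately show ?thesis by linarith
qed

lemma borel_measurable_nkern [measurable]: "nkern \<epsilon> \<in> borel_measurable borel"
  unfolding nkern_def by measurable

lemma nkern_nonneg: "0 < \<epsilon> \<Longrightarrow> 0 \<le> nkern \<epsilon> z"
  unfolding nkern_def by (intro divide_nonneg_pos kern_nonneg kern_mass_pos)

lemma nkern_eq_0: "0 < \<epsilon> \<Longrightarrow> \<epsilon> \<le> norm z \<Longrightarrow> nkern \<epsilon> z = 0"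
  by (simp add: nkern_def kern_eq_0)

lemma nkern_le: "0 < \<epsilon> \<Longrightarrow> nkern \<epsilon> (z::'a::euclidean_space) \<le> 1 / (LBINT y. kern \<epsilon> (y::'a))"
  unfolding nkern_def using kern_mass_pos[of \<epsilon>, where 'a='a] kern_le_1 by (intro divide_right_mono) auto

lemma integrable_nkern: "0 < \<epsilon> \<Longrightarrow> integrable lborel (nkern \<epsilon> :: 'a::euclidean_space \<Rightarrow> real)"
  unfolding nkern_def using integrable_kern by auto

lemma integral_nkern: "0 < \<epsilon> \<Longrightarrow> (LBINT z. nkern \<epsilon> (z::'a::euclidean_space)) = 1"
  unfolding nkern_def using kern_mass_pos[of \<epsilon>, where 'a='a] by simp

lemma integrable_nkern_shift: "0 < \<epsilon> \<Longrightarrow> integrable lborel (\<lambda>y. nkern \<epsilon> (x - y :: 'a::euclidean_space))"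
  using integrable_distr_eq[of "\<lambda>y. x - y" lborel borel "nkern \<epsilon>"] integrable_nkern[of \<epsilon>, where 'a='a]
  by (simp add: lborel_distr_reflect)

lemma integral_nkern_shift: "0 < \<epsilon> \<Longrightarrow> (LBINT y. nkern \<epsilon> (x - y :: 'a::euclidean_space)) = 1"
  using integral_lborel_reflect[of "nkern \<epsilon>" x] integral_nkern[of \<epsilon>, where 'a='a] by simp

lemma nn_integral_nkern_shift:
  assumes "0 < \<epsilon>"
  shows "(\<integral>\<^sup>+x. ennreal (nkern \<epsilon> (x - y :: 'a::euclidean_space)) \<partial>lborel) = 1"
proof -
  have "(\<integral>\<^sup>+x. ennreal (nkern \<epsilon> (x - y)) \<partial>lborel) = (\<integral>\<^sup>+x. ennreal (nkern \<epsilon> (y - x)) \<partial>lborel)"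
    by (simp add: nkern_def kern_def norm_minus_commute)
  also have "\<dots> = ennreal (LBINT x. nkern \<epsilon> (y - x))"
    using assms by (intro nn_integral_eq_integral integrable_nkern_shift) (auto simp: nkern_nonneg)
  finally show ?thesis using integral_nkern_shift[OF assms] by simp
qed

definition moll :: "real \<Rightarrow> ('a::euclidean_space \<Rightarrow> 'b::{banach, second_countable_topology}) \<Rightarrow> 'a \<Rightarrow> 'b" where
  "moll \<epsilon> K x = (LBINT y. nkern \<epsilon> (x - y) *\<^sub>R K y)"

lemma integrable_nkern_scaleR:
  fixes K :: "'a::euclidean_space \<Rightarrow> 'b::{banach, second_countable_topology}"
  assumes "0 < \<epsilon>" "integrable lborel K"
  shows "integrable lborel (\<lambda>y. nkern \<epsilon> (x - y) *\<^sub>R K y)"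
proof (rule Bochner_Integration.integrable_bound)
  let ?m = "1 / (LBINT y. kern \<epsilon> (y::'a))"
  show "integrable lborel (\<lambda>y. ?m *\<^sub>R norm (K y))"
    using assms by (intro integrable_scaleR_right integrable_norm)
  show "AE y in lborel. norm (nkern \<epsilon> (x - y) *\<^sub>R K y) \<le> norm (?m *\<^sub>R norm (K y))"
  proof (intro AE_I2)
    fix y
    have "norm (nkern \<epsilon> (x - y) *\<^sub>R K y) \<le> ?m * norm (K y)"
      using nkern_le[OF assms(1), of "x - y"] nkern_nonneg[OF assms(1), of "x - y"]
      by (simp only: norm_scaleR abs_of_nonneg) (intro mult_right_mono, auto)
    then show "norm (nkern \<epsilon> (x - y) *\<^sub>R K y) \<le> norm (?m *\<^sub>R norm (K y))"
      by (metis abs_ge_self order_trans real_norm_def real_scaleR_def)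
  qed
  show "(\<lambda>y. nkern \<epsilon> (x - y) *\<^sub>R K y) \<in> borel_measurable lborel"
    using borel_measurable_integrable[OF assms(2)] by measurable
qed

lemma moll_diff:
  assumes "0 < \<epsilon>" "integrable lborel K" "integrable lborel L"
  shows "moll \<epsilon> (\<lambda>y. K y - L y) x = moll \<epsilon> K x - moll \<epsilon> L x"
  unfolding moll_def
  by (simp add: scaleR_diff_right Bochner_Integration.integral_diff integrable_nkern_scaleR assms)

lemma borel_measurable_moll [measurable]:
  assumes [measurable]: "K \<in> borel_measurable borel"
  shows "moll \<epsilon> K \<in> borel_measurable borel"
  unfolding moll_def by measurable

lemma moll_near_AE:
  fixes K :: "'a::euclidean_space \<Rightarrow> 'b::{banach, second_countable_topology}"
  assumes "0 < \<epsilon>" "integrable lborel K" "AE y in lborel. norm (x - y) < \<epsilon> \<longrightarrow> norm (K y - a) \<le> \<delta>"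
  shows "norm (moll \<epsilon> K x - a) \<le> \<delta>"
proof -
  have "a = (LBINT y. nkern \<epsilon> (x - y) *\<^sub>R a)"
    using integrable_nkern_shift[OF assms(1), of x] integral_nkern_shift[OF assms(1), of x] by simp
  then have "moll \<epsilon> K x - a = (LBINT y. nkern \<epsilon> (x - y) *\<^sub>R K y - nkern \<epsilon> (x - y) *\<^sub>R a)"
    unfolding moll_def using assms integrable_nkern_shift[OF assms(1), of x]
    by (subst Bochner_Integration.integral_diff) (auto intro!: integrable_nkern_scaleR integrable_scaleR_left)
  then have "norm (moll \<epsilon> K x - a) \<le> (LBINT y. norm (nkern \<epsilon> (x - y) *\<^sub>R K y - nkern \<epsilon> (x - y) *\<^sub>R a))"
    by (metis integral_norm_bound)
  also have "\<dots> \<le> (LBINT y. nkern \<epsilon> (x - y) * \<delta>)"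
  proof (rule integral_mono_AE)
    show "integrable lborel (\<lambda>y. norm (nkern \<epsilon> (x - y) *\<^sub>R K y - nkern \<epsilon> (x - y) *\<^sub>R a))"
      using assms integrable_nkern_shift[OF assms(1), of x]
      by (intro integrable_norm Bochner_Integration.integrable_diff integrable_nkern_scaleR integrable_scaleR_left) auto
    show "integrable lborel (\<lambda>y. nkern \<epsilon> (x - y) * \<delta>)"
      using integrable_nkern_shift[OF assms(1), of x] by simp
    show "AE y in lborel. norm (nkern \<epsilon> (x - y) *\<^sub>R K y - nkern \<epsilon> (x - y) *\<^sub>R a) \<le> nkern \<epsilon> (x - y) * \<delta>"
      using assms(3)
    proof eventually_elim
      case (elim y)
      show ?case
      proof (cases "norm (x - y) < \<epsilon>")
        case True
        then show ?thesis
          using nkern_nonneg[OF assms(1), of "x - y"] elim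
          by (simp add: scaleR_diff_right[symmetric] mult_left_mono)
      next
        case False
        then show ?thesis using nkern_eq_0[OF assms(1), of "x - y"] by simp
      qed
    qed
  qed
  also have "\<dots> = \<delta>"
    using integral_nkern_shift[OF assms(1), of x] by simp
  finally show ?thesis .
qed

lemma moll_near:
  fixes K :: "'a::euclidean_space \<Rightarrow> 'b::{banach, second_countable_topology}"
  assumes "0 < \<epsilon>" "integrable lborel K" "\<And>y. norm (x - y) < \<epsilon> \<Longrightarrow> norm (K y - a) \<le> \<delta>"
  shows "norm (moll \<epsilon> K x - a) \<le> \<delta>"
  using assms by (intro moll_near_AE AE_I2) auto

lemma nn_integral_moll_le:
  fixes K :: "'a::euclidean_space \<Rightarrow> 'b::{banach, second_countable_topology}"
  assumes "0 < \<epsilon>" and K: "integrable lborel K"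
  shows "(\<integral>\<^sup>+x. ennreal (norm (moll \<epsilon> K x)) \<partial>lborel) \<le> (\<integral>\<^sup>+x. ennreal (norm (K x)) \<partial>lborel)"
proof -
  have [measurable]: "K \<in> borel_measurable borel"
    using borel_measurable_integrable[OF K] by simp
  have "(\<integral>\<^sup>+x. ennreal (norm (moll \<epsilon> K x)) \<partial>lborel)
      \<le> (\<integral>\<^sup>+x. (\<integral>\<^sup>+y. ennreal (nkern \<epsilon> (x - y)) * ennreal (norm (K y)) \<partial>lborel) \<partial>lborel)"
  proof (rule nn_integral_mono)
    fix x
    have "ennreal (norm (moll \<epsilon> K x)) \<le> (\<integral>\<^sup>+y. ennreal (norm (nkern \<epsilon> (x - y) *\<^sub>R K y)) \<partial>lborel)"
      unfolding moll_def
      by (rule integral_norm_bound_ennreal[OF integrable_nkern_scaleR[OF assms]])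
    then show "ennreal (norm (moll \<epsilon> K x)) \<le> (\<integral>\<^sup>+y. ennreal (nkern \<epsilon> (x - y)) * ennreal (norm (K y)) \<partial>lborel)"
      using nkern_nonneg[OF assms(1), where 'a='a] by (simp add: ennreal_mult abs_of_nonneg)
  qed
  also have "\<dots> = (\<integral>\<^sup>+y. (\<integral>\<^sup>+x. ennreal (nkern \<epsilon> (x - y)) * ennreal (norm (K y)) \<partial>lborel) \<partial>lborel)"
    by (rule lborel_pair.Fubini'[symmetric]) measurable
  also have "\<dots> = (\<integral>\<^sup>+y. ennreal (norm (K y)) \<partial>lborel)"
    by (simp add: nn_integral_multc nn_integral_nkern_shift[OF assms(1)])
  finally show ?thesis .
qed

lemma integrable_moll:
  assumes "0 < \<epsilon>" and K: "integrable lborel K"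
  shows "integrable lborel (moll \<epsilon> K)"
proof -
  have [measurable]: "K \<in> borel_measurable borel"
    using borel_measurable_integrable[OF K] by simp
  show ?thesis
    using nn_integral_moll_le[OF assms] K unfolding integrable_iff_bounded by auto
qed

lemma integral_norm_moll_le:
  assumes "0 < \<epsilon>" and K: "integrable lborel K"
  shows "(LBINT x. norm (moll \<epsilon> K x)) \<le> (LBINT x. norm (K x))"
proof -
  have "ennreal (LBINT x. norm (moll \<epsilon> K x)) \<le> ennreal (LBINT x. norm (K x))"
    using nn_integral_moll_le[OF assms] integrable_moll[OF assms] K
    by (simp add: nn_integral_eq_integral)
  then show ?thesis by simp
qed

lemma approximate_L1_continuous:
  fixes K :: "'a::euclidean_space \<Rightarrow> real"
  assumes K: "integrable lborel K" and "0 < e"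
  obtains c r B where "continuous_on UNIV c" "\<And>x. r \<le> norm x \<Longrightarrow> c x = 0"
    "\<And>x. \<bar>c x\<bar> \<le> B" "integrable lborel c" "(LBINT x. \<bar>K x - c x\<bar>) < e"
proof -
  have [measurable]: "K \<in> borel_measurable borel"
    using borel_measurable_integrable[OF K] by simp
  define L where "L m x = indicator (ball 0 (real m)) x * max (- real m) (min (real m) (K x))" for m :: nat and x
  have L_meas [measurable]: "L m \<in> borel_measurable borel" for m
    unfolding L_def
    by (intro borel_measurable_times borel_measurable_indicator borel_measurable_max borel_measurable_min) auto
  have "(\<lambda>m. \<integral>x. \<bar>K x - L m x\<bar> \<partial>lborel) \<longlonglongrightarrow> (\<integral>x. 0 \<partial>(lborel::'a measure))"
  proof (rule integral_dominated_convergence[where w = "\<lambda>x. \<bar>K x\<bar>"])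
    show "AE x in lborel. (\<lambda>m. \<bar>K x - L m x\<bar>) \<longlonglongrightarrow> 0"
    proof (intro AE_I2)
      fix x
      obtain m0 where m0: "norm x + \<bar>K x\<bar> < real m0" using reals_Archimedean2 by blast
      have "\<bar>K x - L m x\<bar> = 0" if "m \<ge> m0" for m
      proof -
        have "norm x + \<bar>K x\<bar> < real m" using m0 that by linarith
        then have "norm x < real m" "\<bar>K x\<bar> < real m" using norm_ge_zero[of x] abs_ge_zero[of "K x"] by linarith+
        then show ?thesis by (auto simp: L_def)
      qed
      then show "(\<lambda>m. \<bar>K x - L m x\<bar>) \<longlonglongrightarrow> 0"
        by (intro tendsto_eventually) (auto simp: eventually_sequentially)
    qed
    show "AE x in lborel. norm \<bar>K x - L m x\<bar> \<le> \<bar>K x\<bar>" for m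
      by (intro AE_I2) (auto simp: L_def indicator_def max_def min_def abs_if)
  qed (use K in auto)
  then have "eventually (\<lambda>m. (LBINT x. \<bar>K x - L m x\<bar>) < e / 2) sequentially"
    by (rule order_tendstoD) (use \<open>0 < e\<close> in simp)
  then have "\<exists>m. (LBINT x. \<bar>K x - L m x\<bar>) < e / 2"
    by (rule eventually_happens'[OF sequentially_bot])
  then obtain m where m: "(LBINT x. \<bar>K x - L m x\<bar>) < e / 2" ..
  have "L m \<in> borel_measurable (lebesgue_on UNIV)"
    unfolding lebesgue_on_UNIV_eq by (rule measurable_completion) simp
  then have "L m measurable_on UNIV"
    by (subst measurable_on_iff_borel_measurable) auto
  then have "\<exists>N g. negligible N \<and> (\<forall>n. continuous_on UNIV (g n)) \<and> (\<forall>x. x \<notin> N \<longrightarrow> (\<lambda>n. g n x) \<longlonglongrightarrow> L m x)"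
    by (simp add: measurable_on_def)
  then obtain N g where N: "negligible N" and g: "\<And>n. continuous_on UNIV (g n)"
    and lim: "\<And>x. x \<notin> N \<Longrightarrow> (\<lambda>n. g n x) \<longlonglongrightarrow> L m x"
    by metis
  let ?\<chi> = "\<lambda>x. max 0 (min 1 (real m + 1 - norm x))"
  define c where "c n x = ?\<chi> x * max (- real m) (min (real m) (g n x))" for n x
  have c_cont: "continuous_on UNIV (c n)" for n
    unfolding c_def by (intro continuous_intros g)
  then have c_meas [measurable]: "c n \<in> borel_measurable borel" for n
    by (rule borel_measurable_continuous_onI)
  have c_bd: "\<bar>c n x\<bar> \<le> real m" for n x
  proof -
    have "\<bar>c n x\<bar> = ?\<chi> x * \<bar>max (- real m) (min (real m) (g n x))\<bar>"
      by (simp add: c_def abs_mult)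
    also have "\<dots> \<le> 1 * real m" by (intro mult_mono) auto
    finally show ?thesis by simp
  qed
  have c_0: "c n x = 0" if "real m + 1 \<le> norm x" for n x
    using that by (simp add: c_def)
  have int_ball: "integrable lborel (\<lambda>x::'a. C * indicator (ball 0 (real m + 1)) x :: real)" for C
    using emeasure_lborel_ball_finite[of "0::'a" "real m + 1"]
    by (intro integrable_mult_right) (simp add: integrable_indicator_iff)
  have c_int: "integrable lborel (c n)" for n
  proof (rule Bochner_Integration.integrable_bound[OF int_ball])
    show "AE x in lborel. norm (c n x) \<le> norm (real m * indicator (ball 0 (real m + 1)) x :: real)"
      using c_bd[of n] c_0[of _ n] by (intro AE_I2) (auto simp: indicator_def)
  qed simp
  have L_bd: "\<bar>L m x\<bar> \<le> real m * indicator (ball 0 (real m)) x" for x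
    by (auto simp: L_def indicator_def)
  have L_int: "integrable lborel (L m)"
  proof (rule Bochner_Integration.integrable_bound[OF int_ball])
    show "AE x in lborel. norm (L m x) \<le> norm (real m * indicator (ball 0 (real m + 1)) x :: real)"
    proof (intro AE_I2)
      fix x :: 'a
      have "real m * indicator (ball 0 (real m)) x \<le> real m * indicator (ball 0 (real m + 1)) x"
        by (intro mult_left_mono) (auto simp: indicator_def)
      then show "norm (L m x) \<le> norm (real m * indicator (ball 0 (real m + 1)) x :: real)"
        using order_trans[OF L_bd[of x]] by (simp add: abs_mult)
    qed
  qed simp
  have "(\<lambda>n. \<integral>x. \<bar>L m x - c n x\<bar> \<partial>lborel) \<longlonglongrightarrow> (\<integral>x. 0 \<partial>(lborel::'a measure))"
  proof (rule integral_dominated_convergence[where w = "\<lambda>x. 2 * real m * indicator (ball 0 (real m + 1)) x"])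
    have "AE x in lebesgue. x \<notin> N"
      using N by (simp add: negligible_iff_null_sets AE_not_in)
    then have "AE x in lborel. x \<notin> N"
      by (simp add: AE_completion_iff)
    then show "AE x in lborel. (\<lambda>n. \<bar>L m x - c n x\<bar>) \<longlonglongrightarrow> 0"
    proof eventually_elim
      fix x assume "x \<notin> N"
      have *: "?\<chi> x * max (- real m) (min (real m) (L m x)) = L m x"
        using L_bd[of x] by (cases "norm x < real m") (auto simp: indicator_def max_def min_def abs_if split: if_splits)
      have "(\<lambda>n. c n x) \<longlonglongrightarrow> ?\<chi> x * max (- real m) (min (real m) (L m x))"
        unfolding c_def by (intro tendsto_intros lim \<open>x \<notin> N\<close>)
      then have "(\<lambda>n. \<bar>L m x - c n x\<bar>) \<longlonglongrightarrow> \<bar>L m x - L m x\<bar>"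
        unfolding * by (intro tendsto_intros)
      then show "(\<lambda>n. \<bar>L m x - c n x\<bar>) \<longlonglongrightarrow> 0" by simp
    qed
    show "AE x in lborel. norm \<bar>L m x - c n x\<bar> \<le> 2 * real m * indicator (ball 0 (real m + 1)) x" for n
    proof (intro AE_I2)
      fix x
      show "norm \<bar>L m x - c n x\<bar> \<le> 2 * real m * indicator (ball 0 (real m + 1)) x"
      proof (cases "norm x < real m + 1")
        case True
        have "\<bar>L m x\<bar> \<le> real m" using L_bd[of x] by (cases "norm x < real m") auto
        with True c_bd[of n x] show ?thesis by (simp add: indicator_def)
      next
        case False
        then show ?thesis using c_0[of x n] L_bd[of x] by (simp add: indicator_def)
      qed
    qed
  qed (use int_ball in auto)
  then have "eventually (\<lambda>n. (LBINT x. \<bar>L m x - c n x\<bar>) < e / 2) sequentially"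
    by (rule order_tendstoD) (use \<open>0 < e\<close> in simp)
  then have "\<exists>n. (LBINT x. \<bar>L m x - c n x\<bar>) < e / 2"
    by (rule eventually_happens'[OF sequentially_bot])
  then obtain n where n: "(LBINT x. \<bar>L m x - c n x\<bar>) < e / 2" ..
  have "(LBINT x. \<bar>K x - c n x\<bar>) \<le> (LBINT x. \<bar>K x - L m x\<bar> + \<bar>L m x - c n x\<bar>)"
    by (rule integral_mono)
      (auto intro!: K L_int c_int Bochner_Integration.integrable_add Bochner_Integration.integrable_diff integrable_abs)
  also have "\<dots> = (LBINT x. \<bar>K x - L m x\<bar>) + (LBINT x. \<bar>L m x - c n x\<bar>)"
    by (rule Bochner_Integration.integral_add)
      (auto intro!: K L_int c_int Bochner_Integration.integrable_diff integrable_abs)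
  also have "\<dots> < e" using m n by simp
  finally show ?thesis using that[OF c_cont c_0 c_bd c_int] by blast
qed

definition eps :: "nat \<Rightarrow> real" where "eps n = inverse (real (Suc n))"

lemma eps_pos [simp]: "0 < eps n" by (simp add: eps_def)

lemma eps_tendsto: "eps \<longlonglongrightarrow> 0"
  unfolding eps_def by (rule LIMSEQ_inverse_real_of_nat)

lemma eps_le_1: "eps n \<le> 1" by (simp add: eps_def inverse_eq_divide)

lemma moll_tendsto_continuous:
  assumes "integrable lborel K" "isCont K x"
  shows "(\<lambda>n. moll (eps n) K x) \<longlonglongrightarrow> K x"
proof (rule metric_LIMSEQ_I)
  fix e :: real assume "0 < e"
  with assms(2) obtain d where d: "0 < d" "\<And>y. norm (y - x) < d \<Longrightarrow> norm (K y - K x) < e / 2"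
    unfolding continuous_at_eps_delta dist_norm by (metis half_gt_zero)
  from order_tendstoD(2)[OF eps_tendsto d(1)] obtain n0 where n0: "\<And>n. n \<ge> n0 \<Longrightarrow> eps n < d"
    by (auto simp: eventually_sequentially)
  have "norm (moll (eps n) K x - K x) \<le> e / 2" if "n \<ge> n0" for n
    using n0[OF that] d(2) by (intro moll_near assms) (auto simp: norm_minus_commute less_imp_le)
  with \<open>0 < e\<close> show "\<exists>n0. \<forall>n\<ge>n0. dist (moll (eps n) K x) (K x) < e"
    by (intro exI[of _ n0]) (force simp: dist_norm)
qed

lemma moll_tendsto_L1_real:
  fixes K :: "'a::euclidean_space \<Rightarrow> real"
  assumes K: "integrable lborel K"
  shows "(\<lambda>n. \<integral>x. \<bar>moll (eps n) K x - K x\<bar> \<partial>lborel) \<longlonglongrightarrow> 0"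
proof (rule LIMSEQ_I)
  fix e :: real assume "0 < e"
  then have "0 < e / 3" by simp
  obtain c r B where
    c: "continuous_on UNIV c" "\<And>x. r \<le> norm x \<Longrightarrow> c x = 0" "\<And>x. \<bar>c x\<bar> \<le> B"
      "integrable lborel c" "(LBINT x. \<bar>K x - c x\<bar>) < e / 3"
    by (rule approximate_L1_continuous[OF K \<open>0 < e / 3\<close>]) (rule that)
  have "B \<ge> 0" using c(3)[of 0] abs_ge_zero[of "c 0"] by linarith
  have [measurable]: "c \<in> borel_measurable borel"
    using c(1) by (rule borel_measurable_continuous_onI)
  have "(\<lambda>n. \<integral>x. \<bar>moll (eps n) c x - c x\<bar> \<partial>lborel) \<longlonglongrightarrow> (\<integral>x. 0 \<partial>(lborel::'a measure))"
  proof (rule integral_dominated_convergence[where w = "\<lambda>x. (2 * B) * indicator (ball 0 (r + 1)) x"])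
    show "integrable lborel (\<lambda>x::'a. 2 * B * indicator (ball 0 (r + 1)) x)"
      using emeasure_lborel_ball_finite[of "0::'a" "r + 1"]
      by (intro integrable_mult_right) (simp add: integrable_indicator_iff)
    show "AE x in lborel. (\<lambda>n. \<bar>moll (eps n) c x - c x\<bar>) \<longlonglongrightarrow> 0"
    proof (intro AE_I2)
      fix x
      have "isCont c x" using c(1) by (simp add: continuous_on_eq_continuous_at)
      from moll_tendsto_continuous[OF c(4) this]
      show "(\<lambda>n. \<bar>moll (eps n) c x - c x\<bar>) \<longlonglongrightarrow> 0"
        by (intro tendsto_rabs_zero) (simp add: LIM_zero_iff)
    qed
    show "AE x in lborel. norm \<bar>moll (eps n) c x - c x\<bar> \<le> 2 * B * indicator (ball 0 (r + 1)) x" for n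
    proof (intro AE_I2)
      fix x
      show "norm \<bar>moll (eps n) c x - c x\<bar> \<le> 2 * B * indicator (ball 0 (r + 1)) x"
      proof (cases "norm x < r + 1")
        case True
        have "norm (moll (eps n) c x - c x) \<le> 2 * B"
          by (rule moll_near[OF eps_pos c(4)]) (use c(3) in \<open>smt (verit) real_norm_def\<close>)
        then show ?thesis using True by simp
      next
        case False
        have "norm (moll (eps n) c x - c x) \<le> 0"
        proof (rule moll_near[OF eps_pos c(4)])
          fix y assume "norm (x - y) < eps n"
          then have "norm (x - y) < 1" using eps_le_1[of n] by linarith
          then have "r \<le> norm y" using False norm_triangle_sub[of x y] by linarith
          then show "norm (c y - c x) \<le> 0" using c(2)[of y] c(2)[of x] False by simp
        qed
        then show ?thesis using \<open>0 \<le> B\<close> by simp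
      qed
    qed
  qed auto
  then have "eventually (\<lambda>n. (LBINT x. \<bar>moll (eps n) c x - c x\<bar>) < e / 3) sequentially"
    by (rule order_tendstoD) (use \<open>0 < e\<close> in simp)
  then obtain n0 where n0: "\<And>n. n \<ge> n0 \<Longrightarrow> (LBINT x. \<bar>moll (eps n) c x - c x\<bar>) < e / 3"
    by (auto simp: eventually_sequentially)
  have "norm ((LBINT x. \<bar>moll (eps n) K x - K x\<bar>) - 0) < e" if "n \<ge> n0" for n
  proof -
    let ?e = "moll (eps n) (\<lambda>y. K y - c y)"
    note I = integrable_moll[OF eps_pos[of n] K] integrable_moll[OF eps_pos[of n] c(4)]
      integrable_moll[OF eps_pos[of n] Bochner_Integration.integrable_diff[OF K c(4)]]
    have "(LBINT x. \<bar>moll (eps n) K x - K x\<bar>) \<le>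
        (LBINT x. \<bar>?e x\<bar> + (\<bar>moll (eps n) c x - c x\<bar> + \<bar>K x - c x\<bar>))"
      using I K c(4)
      by (intro integral_mono) (auto simp: moll_diff)
    also have "\<dots> = (LBINT x. \<bar>?e x\<bar>) +
        ((LBINT x. \<bar>moll (eps n) c x - c x\<bar>) + (LBINT x. \<bar>K x - c x\<bar>))"
      using I K c(4) by (subst Bochner_Integration.integral_add; (subst Bochner_Integration.integral_add)?) auto
    also have "(LBINT x. \<bar>?e x\<bar>) \<le> (LBINT x. \<bar>K x - c x\<bar>)"
      using integral_norm_moll_le[OF eps_pos[of n] Bochner_Integration.integrable_diff[OF K c(4)]] by simp
    also have "(LBINT x. \<bar>K x - c x\<bar>) + ((LBINT x. \<bar>moll (eps n) c x - c x\<bar>) + (LBINT x. \<bar>K x - c x\<bar>)) < e"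
      using n0[OF that] c(5) by linarith
    finally show ?thesis by simp
  qed
  then show "\<exists>n0. \<forall>n\<ge>n0. norm ((LBINT x. \<bar>moll (eps n) K x - K x\<bar>) - 0) < e" by blast
qed

lemma moll_inner:
  fixes K :: "'a::euclidean_space \<Rightarrow> 'b::euclidean_space"
  assumes "0 < \<epsilon>" "integrable lborel K"
  shows "moll \<epsilon> K x \<bullet> b = moll \<epsilon> (\<lambda>y. K y \<bullet> b) x"
  unfolding moll_def
  by (subst integral_inner_left[symmetric]) (auto intro: integrable_nkern_scaleR assms)

lemma moll_AE_subseq:
  fixes K :: "'a::euclidean_space \<Rightarrow> 'b::euclidean_space"
  assumes K: "integrable lborel K"
  obtains r where "strict_mono r" "AE x in lborel. (\<lambda>n. moll (eps (r n)) K x) \<longlonglongrightarrow> K x"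
proof -
  let ?d = "\<lambda>n b x. moll (eps n) (\<lambda>y. K y \<bullet> b) x - K x \<bullet> b"
  have int: "integrable lborel (\<lambda>x. moll (eps n) K x - K x)" for n
    using integrable_moll[OF eps_pos K] K by auto
  have "(\<lambda>n. \<integral>x. norm (moll (eps n) K x - K x) \<partial>lborel) \<longlonglongrightarrow> 0"
  proof (rule tendsto_sandwich[OF _ _ tendsto_const])
    have Kb: "integrable lborel (\<lambda>x. K x \<bullet> b)" for b using K by simp
    show "(\<lambda>n. \<Sum>b\<in>Basis. \<integral>x. \<bar>?d n b x\<bar> \<partial>lborel) \<longlonglongrightarrow> 0"
      by (rule tendsto_null_sum) (rule moll_tendsto_L1_real[OF Kb])
    have "(LBINT x. norm (moll (eps n) K x - K x)) \<le>
       (\<Sum>b\<in>Basis. \<integral>x. \<bar>?d n b x\<bar> \<partial>lborel)" for n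
    proof -
      have "(LBINT x. norm (moll (eps n) K x - K x)) \<le>
         (LBINT x. (\<Sum>b\<in>Basis. \<bar>?d n b x\<bar>))"
      proof (rule integral_mono)
        show "norm (moll (eps n) K x - K x) \<le> (\<Sum>b\<in>Basis. \<bar>?d n b x\<bar>)" for x
          using norm_le_l1[of "moll (eps n) K x - K x"] by (simp add: inner_diff_left moll_inner[OF eps_pos K])
      qed (use int integrable_moll[OF eps_pos Kb] Kb in auto)
      also have "\<dots> = (\<Sum>b\<in>Basis. \<integral>x. \<bar>?d n b x\<bar> \<partial>lborel)"
        by (rule Bochner_Integration.integral_sum) (use integrable_moll[OF eps_pos Kb] Kb in auto)
      finally show ?thesis .
    qed
    then show "\<forall>\<^sub>F n in sequentially. (LBINT x. norm (moll (eps n) K x - K x)) \<le>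
       (\<Sum>b\<in>Basis. \<integral>x. \<bar>?d n b x\<bar> \<partial>lborel)" by simp
  qed (simp add: integral_nonneg_AE)
  from tendsto_L1_AE_subseq[OF int this] obtain r where
    "strict_mono r" "AE x in lborel. (\<lambda>n. moll (eps (r n)) K x - K x) \<longlonglongrightarrow> 0"
    by (elim exE conjE)
  then show ?thesis by (intro that[of r]) (simp_all add: LIM_zero_iff)
qed

subsection \<open>Weak gradients of radial functions\<close>

lemma borel_measurable_orthogonal:
  "orthogonal_transformation Q \<Longrightarrow> Q \<in> borel_measurable borel" for Q :: "'a::euclidean_space \<Rightarrow> 'a"
  by (intro borel_measurable_continuous_onI linear_continuous_on)
    (simp add: linear_conv_bounded_linear[symmetric] orthogonal_transformation_linear)

lemma nn_integral_lborel_translate: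
  assumes [measurable]: "F \<in> borel_measurable borel"
  shows "(\<integral>\<^sup>+x. F (x - a) \<partial>lborel) = (\<integral>\<^sup>+x. F x \<partial>(lborel :: 'a::euclidean_space measure))"
proof -
  have "(\<integral>\<^sup>+x. F (- (a - x)) \<partial>lborel) = (\<integral>\<^sup>+x. F (- x) \<partial>lborel)"
    by (rule nn_integral_lborel_reflect) simp
  also have "\<dots> = (\<integral>\<^sup>+x. F x \<partial>lborel)"
    using nn_integral_lborel_reflect[of F 0] by simp
  finally show ?thesis by simp
qed

text \<open>For a Borel set \<open>A\<close> and a ball \<open>B\<close>, evaluating
  \<open>\<integral>\<integral> 1\<^sub>A(Qz) 1\<^sub>B(y - Qz) dy dz\<close> in both orders yields
  \<open>\<bar>Q\<inverse>A\<bar> \<bar>B\<bar> = \<bar>Q\<inverse>B\<bar> \<bar>A\<bar>\<close>, and \<open>Q\<inverse>B = B\<close>.  The orthogonal invariance in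
  \<^theory>\<open>HOL-Analysis.Change_Of_Vars\<close> requires a wellordered index type.\<close>

lemma lborel_distr_orthogonal:
  fixes Q :: "'a::euclidean_space \<Rightarrow> 'a"
  assumes Q: "orthogonal_transformation Q"
  shows "distr lborel borel Q = lborel"
proof (rule measure_eqI)
  have [measurable]: "Q \<in> borel_measurable borel" using Q by (rule borel_measurable_orthogonal)
  fix A assume "A \<in> sets (distr lborel borel Q)"
  then have [measurable]: "A \<in> sets borel" by simp
  define B where "B = ball (0::'a) 1"
  have [measurable]: "B \<in> sets borel" by (simp add: B_def)
  define iA iB :: "'a \<Rightarrow> ennreal" where "iA = indicator A" and "iB = indicator B"
  have [measurable]: "iA \<in> borel_measurable borel" "iB \<in> borel_measurable borel"
    by (simp_all add: iA_def iB_def)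
  have iBQ: "iB (Q z) = iB z" for z
    using orthogonal_transformation_norm[OF Q] by (simp add: iB_def B_def indicator_def)
  have "emeasure (distr lborel borel Q) A = (\<integral>\<^sup>+z. iA (Q z) \<partial>lborel)"
    using nn_integral_distr[of Q lborel borel iA] by (simp add: iA_def)
  moreover have "emeasure lborel B = (\<integral>\<^sup>+y. iB (y - Q z) \<partial>lborel)" for z
    using nn_integral_lborel_translate[of iB] by (simp add: iB_def)
  ultimately have "emeasure (distr lborel borel Q) A * emeasure lborel B =
      (\<integral>\<^sup>+z. (\<integral>\<^sup>+y. iA (Q z) * iB (y - Q z) \<partial>lborel) \<partial>lborel)"
    by (simp add: nn_integral_cmult flip: nn_integral_multc)
  also have "\<dots> = (\<integral>\<^sup>+y. (\<integral>\<^sup>+z. iA (Q z) * iB (y - Q z) \<partial>lborel) \<partial>lborel)"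
    by (rule lborel_pair.Fubini') measurable
  also have "\<dots> = (\<integral>\<^sup>+y. (\<integral>\<^sup>+z. iA (y - Q z) * iB (Q z) \<partial>lborel) \<partial>lborel)"
  proof (rule nn_integral_cong)
    fix y
    obtain y' where y': "y = Q y'" using orthogonal_transformation_surj[OF Q] by (metis surjD)
    have "(\<integral>\<^sup>+z. iA (Q (y' - z)) * iB (y - Q (y' - z)) \<partial>lborel) = (\<integral>\<^sup>+z. iA (Q z) * iB (y - Q z) \<partial>lborel)"
      by (rule nn_integral_lborel_reflect) measurable
    then show "(\<integral>\<^sup>+z. iA (Q z) * iB (y - Q z) \<partial>lborel) = (\<integral>\<^sup>+z. iA (y - Q z) * iB (Q z) \<partial>lborel)"
      by (simp add: y' linear_diff[OF orthogonal_transformation_linear[OF Q]])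
  qed
  also have "\<dots> = (\<integral>\<^sup>+z. (\<integral>\<^sup>+y. iA (y - Q z) * iB (Q z) \<partial>lborel) \<partial>lborel)"
    by (rule lborel_pair.Fubini') measurable
  also have "\<dots> = emeasure lborel A * emeasure lborel B"
    by (simp add: nn_integral_multc nn_integral_cmult nn_integral_lborel_translate iBQ)
      (simp add: iA_def iB_def)
  finally have "emeasure lborel B * emeasure (distr lborel borel Q) A = emeasure lborel B * emeasure lborel A"
    by (simp add: mult.commute)
  moreover have "emeasure lborel B \<noteq> 0" "emeasure lborel B \<noteq> \<infinity>"
    using emeasure_lborel_ball_finite[of "0::'a" 1]
    by (auto simp: B_def emeasure_ball unit_ball_vol_neq_0)
  ultimately show "emeasure (distr lborel borel Q) A = emeasure lborel A"
    by (simp add: ennreal_mult_cancel_left)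
qed simp

lemma integral_lborel_orthogonal:
  fixes F :: "'a::euclidean_space \<Rightarrow> 'b::{banach, second_countable_topology}" and Q :: "'a \<Rightarrow> 'a"
  assumes "orthogonal_transformation Q" "F \<in> borel_measurable borel"
  shows "(LBINT x. F (Q x)) = (LBINT x. F x)"
  using integral_distr[of Q lborel borel F] assms borel_measurable_orthogonal[of Q]
  by (simp add: lborel_distr_orthogonal)

lemma AE_lborel_orthogonal:
  fixes Q :: "'a::euclidean_space \<Rightarrow> 'a"
  assumes Q: "orthogonal_transformation Q" and P: "AE x in lborel. P x"
  shows "AE x in lborel. P (Q x)"
proof (rule AE_distrD[of Q lborel borel])
  show "Q \<in> measurable lborel borel" using borel_measurable_orthogonal[OF Q] by simp
  show "AE x in distr lborel borel Q. P x"
    unfolding lborel_distr_orthogonal[OF Q] by (rule P)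
qed

lemma orthogonal_transformation_norm_diff:
  "orthogonal_transformation Q \<Longrightarrow> norm (Q x - Q y) = norm (x - y)"
  by (metis orthogonal_transformation_linear orthogonal_transformation_norm linear_diff)

lemma AE_radial_invariant:
  fixes Q :: "real ^ 'n::finite \<Rightarrow> real ^ 'n"
  assumes Q: "orthogonal_transformation Q" and rad: "AE y in lborel. K y = w (norm y)"
  shows "AE y in lborel. K (Q y) = K y"
  using AE_lborel_orthogonal[OF Q rad] rad
  by eventually_elim (simp add: orthogonal_transformation_norm[OF Q])

lemma moll_radial:
  fixes K :: "real ^ 'n::finite \<Rightarrow> real"
  assumes Q: "orthogonal_transformation Q" and rad: "AE y in lborel. K y = w (norm y)"
    and [measurable]: "K \<in> borel_measurable borel"
  shows "moll \<epsilon> K (Q x) = moll \<epsilon> K x"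
proof -
  have [measurable]: "Q \<in> borel_measurable borel" using Q by (rule borel_measurable_orthogonal)
  have "moll \<epsilon> K (Q x) = (LBINT y. nkern \<epsilon> (Q x - Q y) *\<^sub>R K (Q y))"
    unfolding moll_def by (rule integral_lborel_orthogonal[OF Q, symmetric]) simp
  also have "\<dots> = moll \<epsilon> K x"
    unfolding moll_def
  proof (rule integral_cong_AE)
    show "AE y in lborel. nkern \<epsilon> (Q x - Q y) *\<^sub>R K (Q y) = nkern \<epsilon> (x - y) *\<^sub>R K y"
      using AE_radial_invariant[OF Q rad]
      by eventually_elim (simp add: nkern_def kern_def orthogonal_transformation_norm_diff[OF Q])
  qed auto
  finally show ?thesis .
qed

definition dkern :: "real \<Rightarrow> 'a::euclidean_space \<Rightarrow> 'a" where
  "dkern \<epsilon> z = (2 * flat 2 (\<epsilon>\<^sup>2 - (norm z)\<^sup>2)) *\<^sub>R z"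

lemma continuous_on_dkern: "continuous_on S (dkern \<epsilon>)"
  unfolding dkern_def by (intro continuous_intros)

lemma borel_measurable_dkern [measurable]: "dkern \<epsilon> \<in> borel_measurable borel"
  by (intro borel_measurable_continuous_onI continuous_on_dkern)

lemma dkern_bounded:
  assumes "0 < \<epsilon>"
  obtains B where "0 \<le> B" "\<And>z::'a::euclidean_space. norm (dkern \<epsilon> z) \<le> B"
proof -
  have "compact (dkern \<epsilon> ` cball (0::'a) \<epsilon>)"
    by (intro compact_continuous_image continuous_on_dkern compact_cball)
  then obtain B where B: "\<And>z::'a. z \<in> cball 0 \<epsilon> \<Longrightarrow> norm (dkern \<epsilon> z) \<le> B"
    by (metis compact_imp_bounded bounded_iff imageI)
  have "norm (dkern \<epsilon> z) \<le> \<bar>B\<bar>" for z :: 'a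
  proof (cases "norm z \<le> \<epsilon>")
    case True
    then show ?thesis using B[of z] by simp
  next
    case False
    then have "\<epsilon>\<^sup>2 \<le> (norm z)\<^sup>2" using assms by (intro power_mono) auto
    then show ?thesis by (simp add: dkern_def flat_def)
  qed
  then show ?thesis using that[of "\<bar>B\<bar>"] by simp
qed

lemma dkern_orthogonal:
  "orthogonal_transformation Q \<Longrightarrow> dkern \<epsilon> (Q x - Q y) = Q (dkern \<epsilon> (x - y))"
  by (simp add: dkern_def orthogonal_transformation_norm_diff)
    (metis linear_diff linear_scale orthogonal_transformation_linear)

lemma integrable_dkern:
  fixes K :: "'a::euclidean_space \<Rightarrow> real"
  assumes "0 < \<epsilon>" "integrable lborel K"
  shows "integrable lborel (\<lambda>y. K y *\<^sub>R dkern \<epsilon> (x - y))"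
proof -
  have [measurable]: "K \<in> borel_measurable borel"
    using borel_measurable_integrable[OF assms(2)] by simp
  obtain B where B: "0 \<le> B" "\<And>z::'a. norm (dkern \<epsilon> z) \<le> B"
    by (rule dkern_bounded[OF assms(1)]) (rule that)
  show ?thesis
  proof (rule Bochner_Integration.integrable_bound)
    show "integrable lborel (\<lambda>y. B * K y)" using assms(2) by simp
    show "AE y in lborel. norm (K y *\<^sub>R dkern \<epsilon> (x - y)) \<le> norm (B * K y)"
      using B by (intro AE_I2) (simp add: abs_mult, metis abs_ge_zero mult.commute mult_right_mono)
  qed simp
qed

lemma moll_gradient_equivariant:
  fixes K :: "real ^ 'n::finite \<Rightarrow> real" and g :: "real ^ 'n \<Rightarrow> real ^ 'n"
  assumes Q: "orthogonal_transformation Q" and rad: "AE y in lborel. K y = w (norm y)"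
    and K: "integrable lborel K" and "0 < \<epsilon>"
    and W: "\<And>x. norm x + \<epsilon> < r \<Longrightarrow>
      (LBINT y. kern \<epsilon> (x - y) *\<^sub>R g y) = - (LBINT y. K y *\<^sub>R dkern \<epsilon> (x - y))"
    and x: "norm x + \<epsilon> < r"
  shows "moll \<epsilon> g (Q x) = Q (moll \<epsilon> g x)"
proof -
  have [measurable]: "Q \<in> borel_measurable borel" using Q by (rule borel_measurable_orthogonal)
  have [measurable]: "K \<in> borel_measurable borel"
    using borel_measurable_integrable[OF K] by simp
  have bl: "bounded_linear Q"
    using Q by (simp add: linear_conv_bounded_linear[symmetric] orthogonal_transformation_linear)
  define m where "m = (LBINT y. kern \<epsilon> (y::real^'n))"
  have eq: "moll \<epsilon> g z = (- 1 / m) *\<^sub>R (LBINT y. K y *\<^sub>R dkern \<epsilon> (z - y))" if "norm z + \<epsilon> < r" for z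
  proof -
    have "moll \<epsilon> g z = (LBINT y. (1 / m) *\<^sub>R (kern \<epsilon> (z - y) *\<^sub>R g y))"
      by (simp add: moll_def nkern_def m_def)
    also have "\<dots> = (1 / m) *\<^sub>R (LBINT y. kern \<epsilon> (z - y) *\<^sub>R g y)"
      by (rule integral_scaleR_right)
    finally show ?thesis using W[OF that] by simp
  qed
  have "(LBINT y. K y *\<^sub>R dkern \<epsilon> (Q x - y)) = (LBINT y. K (Q y) *\<^sub>R dkern \<epsilon> (Q x - Q y))"
    by (rule integral_lborel_orthogonal[OF Q, symmetric]) simp
  also have "\<dots> = (LBINT y. Q (K y *\<^sub>R dkern \<epsilon> (x - y)))"
  proof (rule integral_cong_AE)
    show "AE y in lborel. K (Q y) *\<^sub>R dkern \<epsilon> (Q x - Q y) = Q (K y *\<^sub>R dkern \<epsilon> (x - y))"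
      using AE_radial_invariant[OF Q rad]
      by eventually_elim (simp add: dkern_orthogonal[OF Q] linear_scale[OF orthogonal_transformation_linear[OF Q]])
  qed auto
  also have "\<dots> = Q (LBINT y. K y *\<^sub>R dkern \<epsilon> (x - y))"
    using integral_bounded_linear[OF bl integrable_dkern[OF \<open>0 < \<epsilon>\<close> K]] by simp
  finally have "moll \<epsilon> g (Q x) = (- 1 / m) *\<^sub>R Q (LBINT y. K y *\<^sub>R dkern \<epsilon> (x - y))"
    using x by (subst eq) (simp_all add: orthogonal_transformation_norm[OF Q])
  also have "\<dots> = Q (moll \<epsilon> g x)"
    unfolding eq[OF x] by (rule linear_scale[OF orthogonal_transformation_linear[OF Q], symmetric])
  finally show ?thesis .
qed

lemma axial_reflection:
  fixes x :: "'a::real_inner"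
  assumes "x \<noteq> 0"
  shows "orthogonal_transformation (\<lambda>v. (2 * (x \<bullet> v) / (x \<bullet> x)) *\<^sub>R x - v)"
  unfolding orthogonal_transformation
proof (intro conjI allI)
  show "linear (\<lambda>v. (2 * (x \<bullet> v) / (x \<bullet> x)) *\<^sub>R x - v)"
    by (rule linearI) (simp_all add: inner_add_right algebra_simps add_divide_distrib)
  fix v
  have "((2 * (x \<bullet> v) / (x \<bullet> x)) *\<^sub>R x - v) \<bullet> ((2 * (x \<bullet> v) / (x \<bullet> x)) *\<^sub>R x - v) = v \<bullet> v"
    using assms by (simp add: inner_diff inner_commute field_simps)
  then show "norm ((2 * (x \<bullet> v) / (x \<bullet> x)) *\<^sub>R x - v) = norm v"
    by (simp add: norm_eq_sqrt_inner)
qed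

lemma equivariant_field:
  fixes U :: "real ^ 'n::finite \<Rightarrow> real ^ 'n"
  assumes eq: "\<And>Q x. orthogonal_transformation Q \<Longrightarrow> norm x < r \<Longrightarrow> U (Q x) = Q (U x)"
    and e: "norm e = 1" and x: "x \<noteq> 0" "norm x < r"
  shows "U x = ((U (norm x *\<^sub>R e) \<bullet> e) / norm x) *\<^sub>R x"
proof -
  let ?P = "\<lambda>v. (2 * (x \<bullet> v) / (x \<bullet> x)) *\<^sub>R x - v"
  have "?P x = x" using x(1) by (simp add: algebra_simps flip: scaleR_2)
  then have "U x = ?P (U x)" using eq[OF axial_reflection[OF x(1)] x(2)] by simp
  then have "2 *\<^sub>R U x = 2 *\<^sub>R (((x \<bullet> U x) / (x \<bullet> x)) *\<^sub>R x)" by (simp add: algebra_simps scaleR_2)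
  then have 1: "U x = ((x \<bullet> U x) / (x \<bullet> x)) *\<^sub>R x" by (simp only: scaleR_cancel_left)  simp
  have "norm x = norm (norm x *\<^sub>R e)" using e by simp
  then obtain Q where Q: "orthogonal_transformation Q" "Q x = norm x *\<^sub>R e"
    using orthogonal_transformation_exists by blast
  have "(norm x *\<^sub>R e) \<bullet> U (norm x *\<^sub>R e) = x \<bullet> U x"
    using eq[OF Q(1) x(2)] Q unfolding orthogonal_transformation_def by metis
  then have "x \<bullet> U x = norm x * (U (norm x *\<^sub>R e) \<bullet> e)" by (simp add: inner_commute)
  then show ?thesis
    using x(1) by (subst 1) (simp add: power2_norm_eq_inner[symmetric] power2_eq_square)
qed

lemma radial_weak_gradient:
  fixes K :: "real ^ 'n::finite \<Rightarrow> real" and g :: "real ^ 'n \<Rightarrow> real ^ 'n"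
  assumes rad: "AE y in lborel. K y = w (norm y)"
    and K: "integrable lborel K" and g: "integrable lborel g"
    and W: "\<And>x \<epsilon>. 0 < \<epsilon> \<Longrightarrow> norm x + \<epsilon> < r \<Longrightarrow>
      (LBINT y. kern \<epsilon> (x - y) *\<^sub>R g y) = - (LBINT y. K y *\<^sub>R dkern \<epsilon> (x - y))"
  obtains \<gamma> where "\<gamma> \<in> borel_measurable borel"
    "AE x in lborel. norm x < r \<longrightarrow> g x = (\<gamma> (norm x) / norm x) *\<^sub>R x"
proof -
  have [measurable]: "g \<in> borel_measurable borel"
    using borel_measurable_integrable[OF g] by simp
  obtain s where s: "strict_mono s" "AE x in lborel. (\<lambda>n. moll (eps (s n)) g x) \<longlonglongrightarrow> g x"
    by (rule moll_AE_subseq[OF g]) (rule that)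
  define e :: "real ^ 'n" where "e = axis undefined 1"
  have e: "norm e = 1" by (simp add: e_def)
  define \<gamma>n where "\<gamma>n n t = moll (eps (s n)) g (t *\<^sub>R e) \<bullet> e" for n t
  have [measurable]: "\<gamma>n n \<in> borel_measurable borel" for n
    unfolding \<gamma>n_def by measurable
  define \<gamma> where "\<gamma> t = lim (\<lambda>n. \<gamma>n n t)" for t
  have "\<gamma> \<in> borel_measurable borel"
    unfolding \<gamma>_def by measurable
  moreover have "AE x in lborel. norm x < r \<longrightarrow> g x = (\<gamma> (norm x) / norm x) *\<^sub>R x"
    using s(2) AE_lborel_singleton[of 0]
  proof eventually_elim
    fix x :: "real ^ 'n" assume lim: "(\<lambda>n. moll (eps (s n)) g x) \<longlonglongrightarrow> g x" and "x \<noteq> 0"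
    show "norm x < r \<longrightarrow> g x = (\<gamma> (norm x) / norm x) *\<^sub>R x"
    proof
      assume xr: "norm x < r"
      have "(\<lambda>n. eps (s n)) \<longlonglongrightarrow> 0"
        using LIMSEQ_subseq_LIMSEQ[OF eps_tendsto s(1)] by (simp add: o_def)
      then have "eventually (\<lambda>n. eps (s n) < r - norm x) sequentially"
        by (rule order_tendstoD) (use xr in simp)
      then have ev: "eventually (\<lambda>n. moll (eps (s n)) g x = (\<gamma>n n (norm x) / norm x) *\<^sub>R x) sequentially"
      proof eventually_elim
        case (elim n)
        have *: "moll (eps (s n)) g (Q z) = Q (moll (eps (s n)) g z)"
          if "orthogonal_transformation Q" "norm z < r - eps (s n)" for Q z
          by (rule moll_gradient_equivariant[OF that(1) rad K eps_pos W[OF eps_pos]]) (use that(2) in auto)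
        show ?case
          unfolding \<gamma>n_def using elim \<open>x \<noteq> 0\<close>
          by (intro equivariant_field[where r = "r - eps (s n)"] * e) auto
      qed
      have "eventually (\<lambda>n. \<gamma>n n (norm x) = moll (eps (s n)) g x \<bullet> x / norm x) sequentially"
        using ev
        by eventually_elim (use \<open>x \<noteq> 0\<close> in \<open>simp add: power2_norm_eq_inner[symmetric] power2_eq_square\<close>)
      then have "(\<lambda>n. \<gamma>n n (norm x)) \<longlonglongrightarrow> g x \<bullet> x / norm x"
        by (subst tendsto_cong) (use \<open>x \<noteq> 0\<close> in \<open>auto intro!: tendsto_intros lim\<close>)
      moreover from this have "\<gamma> (norm x) = g x \<bullet> x / norm x"
        unfolding \<gamma>_def by (rule limI)
      ultimately have "(\<lambda>n. (\<gamma>n n (norm x) / norm x) *\<^sub>R x) \<longlonglongrightarrow> (\<gamma> (norm x) / norm x) *\<^sub>R x"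
        using \<open>x \<noteq> 0\<close> by (intro tendsto_intros) auto
      then have "(\<lambda>n. moll (eps (s n)) g x) \<longlonglongrightarrow> (\<gamma> (norm x) / norm x) *\<^sub>R x"
        by (subst tendsto_cong[OF ev])
      with lim show "g x = (\<gamma> (norm x) / norm x) *\<^sub>R x"
        by (rule LIMSEQ_unique)
    qed
  qed
  ultimately show ?thesis by (rule that)
qed

subsection \<open>Integration of radial functions\<close>

definition sq_weight :: "nat \<Rightarrow> real \<Rightarrow> real" where
  "sq_weight n \<tau> = (if 0 < \<tau> then unit_ball_vol n * n / 2 * \<tau> powr (n / 2 - 1) else 0)"

lemma sq_weight_nonneg: "0 \<le> sq_weight n \<tau>"
  by (simp add: sq_weight_def)

lemma borel_measurable_sq_weight [measurable]: "sq_weight n \<in> borel_measurable borel"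
  unfolding sq_weight_def by measurable

lemma sq_weight_square:
  assumes "1 \<le> n" "0 < t"
  shows "2 * sq_weight n (t\<^sup>2) * t = n * unit_ball_vol n * t ^ (n - 1)"
proof -
  have "(t\<^sup>2) powr (real n / 2 - 1) * t = (t powr 2) powr (real n / 2 - 1) * t powr 1"
    using assms by simp
  also have "\<dots> = t powr (real n - 1)"
    unfolding powr_powr powr_add[symmetric] by (simp add: algebra_simps)
  also have "\<dots> = t ^ (n - 1)"
    using assms by (simp flip: powr_realpow add: of_nat_diff)
  finally show ?thesis using assms by (simp add: sq_weight_def)
qed

lemma distr_norm_square:
  "distr lborel borel (\<lambda>x::'a::euclidean_space. (norm x)\<^sup>2) = density lborel (\<lambda>\<tau>. ennreal (sq_weight DIM('a) \<tau>))"
proof (rule measure_eqI_generator_eq)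
  let ?E = "range (\<lambda>a::real. {..a})"
  show "Int_stable ?E" by (auto simp: Int_stable_def)
  show "?E \<subseteq> Pow UNIV" by simp
  show "sets (distr lborel borel (\<lambda>x::'a. (norm x)\<^sup>2)) = sigma_sets UNIV ?E"
    "sets (density lborel (\<lambda>\<tau>. ennreal (sq_weight DIM('a) \<tau>))) = sigma_sets UNIV ?E"
    by (simp_all add: borel_eq_atMost)
  define A where "A i = {..real i}" for i
  show "range A \<subseteq> ?E" by (auto simp: A_def)
  show "(\<Union>i. A i) = UNIV" using real_arch_simple by (auto simp: A_def)
  have eq: "emeasure (distr lborel borel (\<lambda>x::'a. (norm x)\<^sup>2)) {..a} =
    (if a < 0 then 0 else ennreal (unit_ball_vol DIM('a) * sqrt a ^ DIM('a)))" for a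
  proof -
    have "emeasure (distr lborel borel (\<lambda>x::'a. (norm x)\<^sup>2)) {..a} = emeasure lborel {x::'a. (norm x)\<^sup>2 \<le> a}"
      by (simp add: emeasure_distr vimage_def)
    also have "{x::'a. (norm x)\<^sup>2 \<le> a} = (if a < 0 then {} else cball 0 (sqrt a))"
    proof (cases "a < 0")
      case True
      then have "\<not> (norm x)\<^sup>2 \<le> a" for x :: 'a using zero_le_power2[of "norm x"] by linarith
      with True show ?thesis by auto
    next
      case False
      have "(norm x)\<^sup>2 \<le> a \<longleftrightarrow> norm x \<le> sqrt a" for x :: 'a
        using real_sqrt_le_iff[of "(norm x)\<^sup>2" a] by (simp only: real_sqrt_abs abs_norm_cancel)
      then have "{x::'a. (norm x)\<^sup>2 \<le> a} = {x. norm x \<le> sqrt a}" by (simp only:)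
      with False show ?thesis by (simp add: cball_def)
    qed
    finally show ?thesis by (simp add: emeasure_cball)
  qed
  then show "emeasure (distr lborel borel (\<lambda>x::'a. (norm x)\<^sup>2)) (A i) \<noteq> \<infinity>" for i
    by (simp add: A_def)
  fix X assume "X \<in> ?E"
  then obtain a where X: "X = {..a}" by auto
  show "emeasure (distr lborel borel (\<lambda>x::'a. (norm x)\<^sup>2)) X = emeasure (density lborel (\<lambda>\<tau>. ennreal (sq_weight DIM('a) \<tau>))) X"
  proof (cases "a < 0")
    case True
    have "emeasure (density lborel (\<lambda>\<tau>. ennreal (sq_weight DIM('a) \<tau>))) {..a} =
       (\<integral>\<^sup>+\<tau>. ennreal (sq_weight DIM('a) \<tau>) * indicator {..a} \<tau> \<partial>lborel)"
      by (rule emeasure_density) auto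
    also have "\<dots> = (\<integral>\<^sup>+\<tau>. 0 \<partial>(lborel :: real measure))"
      using True by (intro nn_integral_cong) (auto simp: sq_weight_def indicator_def)
    finally show ?thesis using True eq by (simp add: X)
  next
    case False
    let ?n = "DIM('a)" and ?c = "unit_ball_vol DIM('a) * DIM('a) / 2"
    have p: "0 < real ?n / 2" by simp
    have "((\<lambda>\<tau>. ?c * \<tau> powr (?n / 2 - 1)) has_integral ?c * (a powr (?n / 2 - 1 + 1) / (?n / 2 - 1 + 1))) {0..a}"
      using False p by (intro has_integral_mult_right has_integral_powr_from_0) linarith+
    then have I: "((\<lambda>\<tau>. ?c * \<tau> powr (?n / 2 - 1)) has_integral unit_ball_vol ?n * a powr (?n / 2)) {0..a}"
      by (simp add: field_simps)
    have "emeasure (density lborel (\<lambda>\<tau>. ennreal (sq_weight ?n \<tau>))) {..a} =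
       (\<integral>\<^sup>+\<tau>. ennreal (sq_weight ?n \<tau>) * indicator {..a} \<tau> \<partial>lborel)"
      by (rule emeasure_density) auto
    also have "\<dots> = (\<integral>\<^sup>+\<tau>. ennreal (?c * \<tau> powr (?n / 2 - 1)) * indicator {0..a} \<tau> \<partial>lborel)"
      by (intro nn_integral_cong) (auto simp: sq_weight_def indicator_def)
    also have "\<dots> = ennreal (unit_ball_vol ?n * a powr (?n / 2))"
      by (rule nn_integral_has_integral_lebesgue'[OF _ I]) simp
    also have "a powr (?n / 2) = sqrt a ^ ?n"
    proof (cases "a = 0")
      case False
      with \<open>\<not> a < 0\<close> show ?thesis
        by (simp add: powr_half_sqrt[symmetric] powr_powr flip: powr_realpow)
    qed (simp add: power_0_left)
    finally show ?thesis using False eq by (simp add: X)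
  qed
qed

lemma integral_norm_square:
  fixes F :: "real \<Rightarrow> real"
  assumes [measurable]: "F \<in> borel_measurable borel"
  shows "(LBINT x. F ((norm (x::'a::euclidean_space))\<^sup>2)) = (\<integral>\<tau>. sq_weight DIM('a) \<tau> * F \<tau> \<partial>lborel)"
    and "integrable lborel (\<lambda>x::'a. F ((norm x)\<^sup>2)) \<longleftrightarrow> integrable lborel (\<lambda>\<tau>. sq_weight DIM('a) \<tau> * F \<tau>)"
proof -
  have "(LBINT x. F ((norm (x::'a))\<^sup>2)) = integral\<^sup>L (distr lborel borel (\<lambda>x::'a. (norm x)\<^sup>2)) F"
    by (rule integral_distr[symmetric]) auto
  then show "(LBINT x. F ((norm (x::'a))\<^sup>2)) = (\<integral>\<tau>. sq_weight DIM('a) \<tau> * F \<tau> \<partial>lborel)"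
    unfolding distr_norm_square by (subst (asm) integral_density) (auto simp: sq_weight_nonneg)
  have "integrable lborel (\<lambda>x::'a. F ((norm x)\<^sup>2)) \<longleftrightarrow> integrable (distr lborel borel (\<lambda>x::'a. (norm x)\<^sup>2)) F"
    by (rule integrable_distr_eq[symmetric]) auto
  then show "integrable lborel (\<lambda>x::'a. F ((norm x)\<^sup>2)) \<longleftrightarrow> integrable lborel (\<lambda>\<tau>. sq_weight DIM('a) \<tau> * F \<tau>)"
    unfolding distr_norm_square by (subst (asm) integrable_density) (auto simp: sq_weight_nonneg)
qed

lemma AE_norm_square:
  assumes "AE \<tau> in lborel. 0 < \<tau> \<longrightarrow> P \<tau>"
  shows "AE x::'a::euclidean_space in lborel. P ((norm x)\<^sup>2)"
proof (rule AE_distrD[of "\<lambda>x::'a. (norm x)\<^sup>2" lborel borel])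
  have "AE \<tau> in density lborel (\<lambda>\<tau>. ennreal (sq_weight DIM('a) \<tau>)). P \<tau>"
    using assms by (subst AE_density) (auto simp: sq_weight_def elim!: eventually_mono split: if_splits)
  then show "AE x in distr lborel borel (\<lambda>x::'a. (norm x)\<^sup>2). P x"
    unfolding distr_norm_square .
qed simp

definition tail_kern :: "real \<Rightarrow> real \<Rightarrow> real \<Rightarrow> real" where
  "tail_kern \<epsilon> a t = (LBINT s. indicator {t..} s * kern \<epsilon> (s - a))"

lemma integrable_kern_shift: "0 < \<epsilon> \<Longrightarrow> integrable lborel (\<lambda>s. kern \<epsilon> (s - a :: 'a::euclidean_space))"
proof -
  assume "0 < \<epsilon>"
  then have "integrable lborel (\<lambda>s. kern \<epsilon> (a - s))"
    using integrable_distr_eq[of "\<lambda>s. a - s" lborel borel "kern \<epsilon>"] integrable_kern[of \<epsilon>, where 'a='a]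
    by (simp add: lborel_distr_reflect)
  then show ?thesis by (simp add: kern_def norm_minus_commute)
qed

lemma tail_kern_has_derivative:
  assumes "0 < \<epsilon>"
  shows "(tail_kern \<epsilon> a has_real_derivative - kern \<epsilon> (t - a)) (at t)"
proof -
  have cont: "continuous_on S (\<lambda>s. kern \<epsilon> (s - a))" for S :: "real set"
    by (intro continuous_intros)
  have "((\<lambda>x. integral {x..t + 1} (\<lambda>s. kern \<epsilon> (s - a)) + tail_kern \<epsilon> a (t + 1)) has_real_derivative - kern \<epsilon> (t - a) + 0)
      (at t within {t - 1..t + 1})"
    by (intro DERIV_add integral_has_real_derivative' cont DERIV_const) auto
  then have "((\<lambda>x. integral {x..t + 1} (\<lambda>s. kern \<epsilon> (s - a)) + tail_kern \<epsilon> a (t + 1)) has_real_derivative - kern \<epsilon> (t - a))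
      (at t)"
    by (simp add: at_within_Icc_at)
  then show ?thesis
  proof (rule DERIV_cong_ev[OF refl _ refl, THEN iffD1, rotated])
    have "integral {x..t + 1} (\<lambda>s. kern \<epsilon> (s - a)) + tail_kern \<epsilon> a (t + 1) = tail_kern \<epsilon> a x" if "x < t + 1" for x
    proof -
      have si: "set_integrable lborel {x..t + 1} (\<lambda>s. kern \<epsilon> (s - a))"
        by (rule borel_integrable_atLeastAtMost') (rule cont)
      have si2: "integrable lborel (\<lambda>s. indicator {t + 1<..} s * kern \<epsilon> (s - a))"
        using integrable_mult_indicator[OF _ integrable_kern_shift[OF assms, of a], of "{t + 1<..}"]
        by (simp only: real_scaleR_def sets_lborel borel_open open_greaterThan)
      have tl: "tail_kern \<epsilon> a (t + 1) = (LBINT s. indicator {t + 1<..} s * kern \<epsilon> (s - a))"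
        unfolding tail_kern_def
      proof (rule integral_cong_AE)
        show "AE s in lborel. indicator {t + 1..} s * kern \<epsilon> (s - a) = indicator {t + 1<..} s * kern \<epsilon> (s - a)"
          using AE_lborel_singleton[of "t + 1"] by eventually_elim (simp add: indicator_def)
      qed simp_all
      have "integral {x..t + 1} (\<lambda>s. kern \<epsilon> (s - a)) = (LBINT s. indicator {x..t + 1} s * kern \<epsilon> (s - a))"
        using set_borel_integral_eq_integral(2)[OF si] by (simp add: set_lebesgue_integral_def)
      then have "integral {x..t + 1} (\<lambda>s. kern \<epsilon> (s - a)) + tail_kern \<epsilon> a (t + 1) =
         (LBINT s. indicator {x..t + 1} s * kern \<epsilon> (s - a) + indicator {t + 1<..} s * kern \<epsilon> (s - a))"
        using si si2 unfolding tl set_integrable_def by simp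
      also have "\<dots> = tail_kern \<epsilon> a x"
        unfolding tail_kern_def using that by (intro Bochner_Integration.integral_cong) (auto simp: indicator_def)
      finally show ?thesis .
    qed
    then show "\<forall>\<^sub>F x in nhds t. integral {x..t + 1} (\<lambda>s. kern \<epsilon> (s - a)) + tail_kern \<epsilon> a (t + 1) = tail_kern \<epsilon> a x"
      unfolding eventually_nhds by (intro exI[of _ "{..<t + 1}"]) auto
  qed
qed

lemma tail_kern_eq_0:
  assumes "0 < \<epsilon>" "a + \<epsilon> \<le> t"
  shows "tail_kern \<epsilon> a t = 0"
proof -
  have "indicator {t..} s * kern \<epsilon> (s - a) = 0" for s
  proof (cases "t \<le> s")
    case True
    with assms have "\<epsilon> \<le> norm (s - a)" by simp
    then show ?thesis by (simp add: kern_eq_0[OF assms(1)])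
  qed simp
  then have "(\<lambda>s. indicator {t..} s * kern \<epsilon> (s - a)) = (\<lambda>s. 0)" by (rule ext)
  then show ?thesis by (simp only: tail_kern_def) simp
qed

lemma C_real_kern: "C_real k (\<lambda>t. kern \<epsilon> (t - a :: real))"
proof -
  have "C_real k (\<lambda>t. flat 0 (\<epsilon>\<^sup>2 + (-1) * ((t + (- a)) * (t + (- a)))))"
    by (intro C_real_comp[OF C_real_flat] C_real_add C_real_mult C_real_const C_real_id)
  then show ?thesis by (simp add: kern_def power2_eq_square)
qed

lemma C_real_tail_kern: "0 < \<epsilon> \<Longrightarrow> C_real k (tail_kern \<epsilon> a)"
proof -
  assume e: "0 < \<epsilon>"
  have "C_real (Suc k) (tail_kern \<epsilon> a)"
    using C_real_mult[OF C_real_const[of k "-1"] C_real_kern[of k \<epsilon> a]]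
    by (intro C_real_SucI[OF tail_kern_has_derivative[OF e]]) simp
  then show ?thesis by (rule C_real_decr)
qed

lemma tail_kern_test_function:
  assumes "0 < \<epsilon>" "0 \<le> a" "a + \<epsilon> < r\<^sup>2" "0 < r"
  shows "(\<lambda>x::real^'n::finite. tail_kern \<epsilon> a ((norm x)\<^sup>2)) \<in> test_functions (ball 0 r)"
    and "partial_deriv i (\<lambda>x::real^'n. tail_kern \<epsilon> a ((norm x)\<^sup>2)) x = - 2 * kern \<epsilon> ((norm x)\<^sup>2 - a) * x $ i"
proof -
  let ?\<phi> = "\<lambda>x::real^'n. tail_kern \<epsilon> a ((norm x)\<^sup>2)"
  have nsq: "(\<lambda>x::real^'n. (norm x)\<^sup>2) = (\<lambda>x. (norm (0 - x))\<^sup>2)" by simp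
  have "((\<lambda>x::real^'n. (norm x)\<^sup>2) has_derivative (\<lambda>h. - 2 * ((0 - x) \<bullet> h))) (at x)"
    unfolding nsq by (rule norm_square_has_derivative)
  from partial_deriv_comp[OF tail_kern_has_derivative[OF assms(1)] this]
  show "partial_deriv i ?\<phi> x = - 2 * kern \<epsilon> ((norm x)\<^sup>2 - a) * x $ i"
    by (simp add: inner_axis)
  have sub: "{x. ?\<phi> x \<noteq> 0} \<subseteq> cball 0 (sqrt (a + \<epsilon>))"
  proof
    fix x :: "real^'n" assume "x \<in> {x. ?\<phi> x \<noteq> 0}"
    then have "(norm x)\<^sup>2 < a + \<epsilon>" using tail_kern_eq_0[OF assms(1), of a "(norm x)\<^sup>2"] by force
    then show "x \<in> cball 0 (sqrt (a + \<epsilon>))" by (simp add: real_le_rsqrt)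
  qed
  then have cl: "closure {x. ?\<phi> x \<noteq> 0} \<subseteq> cball 0 (sqrt (a + \<epsilon>))"
    by (simp add: closure_minimal)
  moreover have "sqrt (a + \<epsilon>) < r" using assms by (simp add: real_less_lsqrt)
  ultimately have "closure {x. ?\<phi> x \<noteq> 0} \<subseteq> ball 0 r" by fastforce
  moreover have "compact (closure {x. ?\<phi> x \<noteq> 0})"
    using cl by (meson bounded_cball bounded_subset compact_eq_bounded_closed closed_closure)
  moreover have "Ck k ?\<phi>" for k
    using Ck_comp[OF C_real_tail_kern[OF assms(1)] Ck_norm_square[of k 0]] by simp
  ultimately show "?\<phi> \<in> test_functions (ball 0 r)"
    by (simp add: test_functions_def)
qed

subsection \<open>The flux of a radial field\<close>

definition ball_mass :: "('a::euclidean_space \<Rightarrow> real) \<Rightarrow> real \<Rightarrow> real" where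
  "ball_mass h r = (LBINT x. indicator (cball 0 r) x * h x)"

lemma integral_tail_kern:
  fixes h :: "'a::euclidean_space \<Rightarrow> real"
  assumes h: "integrable lborel h" and "0 < \<epsilon>" and a: "\<epsilon> \<le> a"
  shows "(LBINT x. h x * tail_kern \<epsilon> a ((norm x)\<^sup>2)) =
    (LBINT s. kern \<epsilon> (s - a) * ball_mass h (sqrt s))"
    and "integrable lborel (\<lambda>s. kern \<epsilon> (s - a) * ball_mass h (sqrt s))"
proof -
  have [measurable]: "h \<in> borel_measurable borel"
    using borel_measurable_integrable[OF h] by simp
  define k where "k s x = kern \<epsilon> (s - a) * (indicator {(norm x)\<^sup>2..} s * h x)" for s and x :: 'a
  have k_alt: "k s x = kern \<epsilon> (s - a) * (indicator {p. (norm (snd p))\<^sup>2 \<le> fst p} (s, x) * h x)" for s x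
    by (simp add: k_def indicator_def)
  have k_meas: "(\<lambda>(s, x). k s x) \<in> borel_measurable (lborel \<Otimes>\<^sub>M lborel)"
    unfolding k_alt by measurable
  have int_x: "integrable lborel (\<lambda>x. k s x)" for s
  proof (rule Bochner_Integration.integrable_bound[OF h])
    show "AE x in lborel. norm (k s x) \<le> norm (h x)"
      using kern_nonneg[of \<epsilon> "s - a"] kern_le_1[of \<epsilon> "s - a"]
      by (intro AE_I2) (auto simp: k_def indicator_def abs_mult intro: mult_left_le_one_le)
    show "(\<lambda>x. k s x) \<in> borel_measurable lborel"
      unfolding k_alt by measurable
  qed
  have int: "integrable (lborel \<Otimes>\<^sub>M lborel) (\<lambda>(s, x). k s x)"
  proof (rule lborel_pair.Fubini_integrable[OF k_meas])
    show "AE s in lborel. integrable lborel (\<lambda>x. (\<lambda>(s, x). k s x) (s, x))" using int_x by simp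
    show "integrable lborel (\<lambda>s. \<integral>x. norm ((\<lambda>(s, x). k s x) (s, x)) \<partial>lborel)"
    proof (rule Bochner_Integration.integrable_bound)
      show "integrable lborel (\<lambda>s. kern \<epsilon> (s - a) * (LBINT x. \<bar>h x\<bar>))"
        using integrable_kern_shift[OF \<open>0 < \<epsilon>\<close>, of a] by simp
      show "(\<lambda>s. \<integral>x. norm ((\<lambda>(s, x). k s x) (s, x)) \<partial>lborel) \<in> borel_measurable lborel"
        using k_meas by (intro lborel.borel_measurable_lebesgue_integral) simp
      have "(LBINT x. \<bar>k s x\<bar>) \<le> kern \<epsilon> (s - a) * (LBINT x. \<bar>h x\<bar>)" for s
      proof -
        have "(LBINT x. \<bar>k s x\<bar>) \<le> (LBINT x. kern \<epsilon> (s - a) * \<bar>h x\<bar>)"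
        proof (rule integral_mono)
          show "integrable lborel (\<lambda>x. \<bar>k s x\<bar>)" by (intro integrable_abs int_x)
          show "\<bar>k s x\<bar> \<le> kern \<epsilon> (s - a) * \<bar>h x\<bar>" for x
            using kern_nonneg[of \<epsilon> "s - a"] by (auto simp: k_def indicator_def abs_mult)
        qed (use h in simp)
        then show ?thesis by simp
      qed
      then show "AE s in lborel. norm (LBINT x. norm ((\<lambda>(s, x). k s x) (s, x))) \<le> norm (kern \<epsilon> (s - a) * (LBINT x. \<bar>h x\<bar>))"
        using kern_nonneg[where 'a=real] by (intro AE_I2) (simp add: abs_mult integral_nonneg_AE)
    qed
  qed
  have in_s: "(LBINT s. k s x) = h x * tail_kern \<epsilon> a ((norm x)\<^sup>2)" for x
  proof -
    have "(LBINT s. k s x) = (LBINT s. h x * (indicator {(norm x)\<^sup>2..} s * kern \<epsilon> (s - a)))"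
      by (simp add: k_def mult_ac)
    then show ?thesis by (simp add: tail_kern_def)
  qed
  have in_x: "(LBINT x. k s x) = kern \<epsilon> (s - a) * ball_mass h (sqrt s)" for s
  proof (cases "0 \<le> s")
    case True
    have "(norm x)\<^sup>2 \<le> s \<longleftrightarrow> norm x \<le> sqrt s" for x :: 'a
      using real_sqrt_le_iff[of "(norm x)\<^sup>2" s] by (simp only: real_sqrt_abs abs_norm_cancel)
    then have "k s x = kern \<epsilon> (s - a) * (indicator (cball 0 (sqrt s)) x * h x)" for x
      by (simp add: k_def indicator_def)
    then show ?thesis by (simp add: ball_mass_def)
  next
    case False
    then have "\<epsilon> \<le> norm (s - a)" using a by simp
    then have "kern \<epsilon> (s - a) = 0" by (rule kern_eq_0[OF \<open>0 < \<epsilon>\<close>])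
    then show ?thesis by (simp add: k_def)
  qed
  show "(LBINT x. h x * tail_kern \<epsilon> a ((norm x)\<^sup>2)) =
    (LBINT s. kern \<epsilon> (s - a) * ball_mass h (sqrt s))"
    using lborel_pair.Fubini_integral[OF int] by (simp add: in_s in_x)
  show "integrable lborel (\<lambda>s. kern \<epsilon> (s - a) * ball_mass h (sqrt s))"
    using lborel_pair.integrable_fst'[OF int] by (simp add: in_x)
qed

lemma abs_ball_mass_le:
  assumes "integrable lborel h"
  shows "\<bar>ball_mass h r\<bar> \<le> (LBINT x. \<bar>h x\<bar>)"
proof -
  have "norm (ball_mass h r) \<le> (LBINT x. norm (indicator (cball 0 r) x * h x))"
    unfolding ball_mass_def by (rule integral_norm_bound)
  also have "\<dots> \<le> (LBINT x. \<bar>h x\<bar>)"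
    using assms integrable_mult_indicator[OF _ assms, of "cball 0 r"]
    by (intro integral_mono) (auto simp: indicator_def)
  finally show ?thesis by simp
qed

lemma borel_measurable_ball_mass:
  fixes h :: "'a::euclidean_space \<Rightarrow> real"
  assumes [measurable]: "h \<in> borel_measurable borel"
  shows "ball_mass h \<in> borel_measurable borel"
proof -
  have eq: "ball_mass h r = (LBINT x. indicator {p. norm (snd p) \<le> fst p} (r, x) * h x)" for r
    unfolding ball_mass_def by (intro Bochner_Integration.integral_cong) (auto simp: indicator_def)
  show ?thesis
    unfolding eq[abs_def] by measurable
qed

lemma moll_zero_imp_AE_zero:
  fixes T :: "real \<Rightarrow> real"
  assumes T: "integrable lborel T"
    and zero: "\<And>a \<epsilon>. 0 < \<epsilon> \<Longrightarrow> \<epsilon> \<le> a \<Longrightarrow> a + \<epsilon> < b \<Longrightarrow> (LBINT s. kern \<epsilon> (s - a) * T s) = 0"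
  shows "AE s in lborel. 0 < s \<and> s < b \<longrightarrow> T s = 0"
proof -
  obtain r where r: "strict_mono r" "AE x in lborel. (\<lambda>n. moll (eps (r n)) T x) \<longlonglongrightarrow> T x"
    by (rule moll_AE_subseq[OF T]) (rule that)
  show ?thesis
    using r(2)
  proof eventually_elim
    fix s assume lim: "(\<lambda>n. moll (eps (r n)) T s) \<longlonglongrightarrow> T s"
    show "0 < s \<and> s < b \<longrightarrow> T s = 0"
    proof
      assume s: "0 < s \<and> s < b"
      have "(\<lambda>n. eps (r n)) \<longlonglongrightarrow> 0"
        using LIMSEQ_subseq_LIMSEQ[OF eps_tendsto r(1)] by (simp add: o_def)
      then have "eventually (\<lambda>n. eps (r n) < min s (b - s)) sequentially"
        by (rule order_tendstoD) (use s in simp)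
      then have "eventually (\<lambda>n. moll (eps (r n)) T s = 0) sequentially"
      proof eventually_elim
        case (elim n)
        have "moll (eps (r n)) T s = (LBINT y. kern (eps (r n)) (y - s) * T y) / (LBINT y. kern (eps (r n)) (y::real))"
          by (simp add: moll_def nkern_def kern_def norm_minus_commute power2_commute)
        then show ?case using elim by (simp add: zero)
      qed
      then have "(\<lambda>n. moll (eps (r n)) T s) \<longlonglongrightarrow> 0" by (rule tendsto_eventually)
      with lim show "T s = 0" by (rule LIMSEQ_unique)
    qed
  qed
qed

lemma radial_flux:
  fixes h :: "'a::euclidean_space \<Rightarrow> real"
  assumes h: "integrable lborel h" and [measurable]: "\<sigma> \<in> borel_measurable borel"
    and int: "integrable lborel (\<lambda>x::'a. indicator (ball 0 r) x * (\<sigma> (norm x) * norm x))" and "0 < r"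
    and flux: "\<And>a \<epsilon>. 0 < \<epsilon> \<Longrightarrow> \<epsilon> \<le> a \<Longrightarrow> a + \<epsilon> < r\<^sup>2 \<Longrightarrow>
      (LBINT x. indicator (ball 0 r) (x::'a) * (\<sigma> (norm x) * norm x) * (2 * kern \<epsilon> ((norm x)\<^sup>2 - a))) =
       - (LBINT x. h x * tail_kern \<epsilon> a ((norm x)\<^sup>2))"
  shows "AE x::'a in lborel. x \<noteq> 0 \<and> norm x < r \<longrightarrow>
    DIM('a) * unit_ball_vol DIM('a) * norm x ^ (DIM('a) - 1) * \<sigma> (norm x) = - ball_mass h (norm x)"
proof -
  have [measurable]: "h \<in> borel_measurable borel"
    using borel_measurable_integrable[OF h] by simp
  note [measurable] = borel_measurable_ball_mass[of h]
  define F where "F \<tau> = indicator {0<..<r\<^sup>2} \<tau> * (\<sigma> (sqrt \<tau>) * sqrt \<tau>)" for \<tau>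
  have [measurable]: "F \<in> borel_measurable borel" unfolding F_def by measurable
  have F: "F ((norm x)\<^sup>2) = indicator (ball 0 r) x * (\<sigma> (norm x) * norm x)" for x :: 'a
  proof (cases "x = 0")
    case False
    have "(norm x)\<^sup>2 < r\<^sup>2 \<longleftrightarrow> norm x < r"
      using \<open>0 < r\<close> power2_less_imp_less[of "norm x" r] power_strict_mono[of "norm x" r 2] by auto
    with False show ?thesis by (simp add: F_def indicator_def)
  qed (simp add: F_def)
  let ?w = "sq_weight DIM('a)"
  define T where "T \<tau> = 2 * (?w \<tau> * F \<tau>) + indicator {0<..<r\<^sup>2} \<tau> * ball_mass h (sqrt \<tau>)" for \<tau>
  have I1: "integrable lborel (\<lambda>\<tau>. ?w \<tau> * F \<tau>)"
    using integral_norm_square(2)[of F, where 'a='a] int by (simp add: F)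
  have I2: "integrable lborel (\<lambda>\<tau>. indicator {0<..<r\<^sup>2} \<tau> * ball_mass h (sqrt \<tau>))"
  proof (rule Bochner_Integration.integrable_bound)
    show "integrable lborel (\<lambda>\<tau>. indicator {0<..<r\<^sup>2} \<tau> * (LBINT x. \<bar>h x\<bar>))"
      by (intro integrable_mult_left integrable_real_indicator) auto
    show "AE \<tau> in lborel. norm (indicator {0<..<r\<^sup>2} \<tau> * ball_mass h (sqrt \<tau>)) \<le> norm (indicator {0<..<r\<^sup>2} \<tau> * (LBINT x. \<bar>h x\<bar>))"
      using abs_ball_mass_le[OF h] by (intro AE_I2) (auto simp: indicator_def integral_nonneg_AE)
  qed simp
  have "AE \<tau> in lborel. 0 < \<tau> \<and> \<tau> < r\<^sup>2 \<longrightarrow> T \<tau> = 0"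
  proof (rule moll_zero_imp_AE_zero)
    show "integrable lborel T" unfolding T_def using I1 I2 by auto
    fix a \<epsilon> :: real assume e: "0 < \<epsilon>" "\<epsilon> \<le> a" "a + \<epsilon> < r\<^sup>2"
    have K1: "integrable lborel (\<lambda>s. ?w s * (F s * (2 * kern \<epsilon> (s - a))))"
    proof (rule Bochner_Integration.integrable_bound)
      show "integrable lborel (\<lambda>\<tau>. 2 * (?w \<tau> * F \<tau>))" using I1 by simp
      have *: "\<bar>?w s * F s\<bar> * kern \<epsilon> (s - a) \<le> \<bar>?w s * F s\<bar>" for s
        using kern_nonneg[of \<epsilon> "s - a"] kern_le_1[of \<epsilon> "s - a"] by (intro mult_right_le_one_le) auto
      then show "AE s in lborel. norm (?w s * (F s * (2 * kern \<epsilon> (s - a)))) \<le> norm (2 * (?w s * F s))"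
        using kern_nonneg[where 'a=real] by (intro AE_I2) (simp add: abs_mult mult_ac)
    qed simp
    have "(LBINT s. kern \<epsilon> (s - a) * T s) =
        (LBINT s. ?w s * (F s * (2 * kern \<epsilon> (s - a))) + kern \<epsilon> (s - a) * ball_mass h (sqrt s))"
    proof (rule Bochner_Integration.integral_cong[OF refl])
      fix s
      show "kern \<epsilon> (s - a) * T s = ?w s * (F s * (2 * kern \<epsilon> (s - a))) + kern \<epsilon> (s - a) * ball_mass h (sqrt s)"
      proof (cases "0 < s \<and> s < r\<^sup>2")
        case True
        then show ?thesis by (simp add: T_def algebra_simps)
      next
        case False
        then have "\<epsilon> \<le> norm (s - a)" using e by auto
        then have "kern \<epsilon> (s - a) = 0" by (rule kern_eq_0[OF e(1)])
        then show ?thesis by simp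
      qed
    qed
    also have "\<dots> = (LBINT s. ?w s * (F s * (2 * kern \<epsilon> (s - a)))) + (LBINT s. kern \<epsilon> (s - a) * ball_mass h (sqrt s))"
      using K1 integral_tail_kern(2)[OF h e(1,2)] by (rule Bochner_Integration.integral_add)
    also have "(LBINT s. ?w s * (F s * (2 * kern \<epsilon> (s - a)))) =
        (LBINT x. F ((norm (x::'a))\<^sup>2) * (2 * kern \<epsilon> ((norm x)\<^sup>2 - a)))"
      by (rule integral_norm_square(1)[symmetric]) measurable
    also have "\<dots> = - (LBINT x. h x * tail_kern \<epsilon> a ((norm x)\<^sup>2))"
      unfolding F by (rule flux[OF e])
    also have "(LBINT x. h x * tail_kern \<epsilon> a ((norm x)\<^sup>2)) = (LBINT s. kern \<epsilon> (s - a) * ball_mass h (sqrt s))"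
      by (rule integral_tail_kern(1)[OF h e(1,2)])
    finally show "(LBINT s. kern \<epsilon> (s - a) * T s) = 0" by simp
  qed
  then have "AE \<tau> in lborel. 0 < \<tau> \<longrightarrow> (0 < \<tau> \<and> \<tau> < r\<^sup>2 \<longrightarrow> T \<tau> = 0)"
    by eventually_elim simp
  from AE_norm_square[OF this, where 'a='a]
  show ?thesis
  proof eventually_elim
    fix x :: 'a
    assume T0: "0 < (norm x)\<^sup>2 \<and> (norm x)\<^sup>2 < r\<^sup>2 \<longrightarrow> T ((norm x)\<^sup>2) = 0"
    show "x \<noteq> 0 \<and> norm x < r \<longrightarrow> DIM('a) * unit_ball_vol DIM('a) * norm x ^ (DIM('a) - 1) * \<sigma> (norm x) = - ball_mass h (norm x)"
    proof
      assume x: "x \<noteq> 0 \<and> norm x < r"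
      then have "0 < (norm x)\<^sup>2 \<and> (norm x)\<^sup>2 < r\<^sup>2" by (simp add: power_strict_mono)
      with T0 have "2 * (?w ((norm x)\<^sup>2) * F ((norm x)\<^sup>2)) + ball_mass h (norm x) = 0"
        by (simp add: T_def)
      then have "(2 * ?w ((norm x)\<^sup>2) * norm x) * \<sigma> (norm x) = - ball_mass h (norm x)"
        using x by (simp add: F algebra_simps)
      then show "DIM('a) * unit_ball_vol DIM('a) * norm x ^ (DIM('a) - 1) * \<sigma> (norm x) = - ball_mass h (norm x)"
        using sq_weight_square[of "DIM('a)" "norm x"] x by (simp add: Suc_le_eq)
    qed
  qed
qed

subsection \<open>Recovering a radial function from its gradient\<close>

lemma kern_line_derivative:
  "((\<lambda>s. kern \<epsilon> (s *\<^sub>R e - y)) has_real_derivative - (dkern \<epsilon> (s *\<^sub>R e - y) \<bullet> e)) (at s)"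
proof -
  have "((\<lambda>s. s *\<^sub>R e) has_derivative (\<lambda>h. h *\<^sub>R e)) (at s)"
    by (auto intro!: derivative_eq_intros)
  from has_derivative_compose[OF this kern_has_derivative]
  have "((\<lambda>s. kern \<epsilon> (y - s *\<^sub>R e)) has_derivative
     (\<lambda>h. 2 * flat 2 (\<epsilon>\<^sup>2 - (norm (y - s *\<^sub>R e))\<^sup>2) * ((y - s *\<^sub>R e) \<bullet> (h *\<^sub>R e)))) (at s)" .
  moreover have "kern \<epsilon> (y - s *\<^sub>R e) = kern \<epsilon> (s *\<^sub>R e - y)" for s
    by (simp add: kern_def norm_minus_commute)
  moreover have "2 * flat 2 (\<epsilon>\<^sup>2 - (norm (y - s *\<^sub>R e))\<^sup>2) * ((y - s *\<^sub>R e) \<bullet> (h *\<^sub>R e)) =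
      - (dkern \<epsilon> (s *\<^sub>R e - y) \<bullet> e) * h" for h
    by (simp add: dkern_def norm_minus_commute inner_diff_left algebra_simps)
  ultimately show ?thesis
    unfolding has_field_derivative_def by (auto elim!: has_derivative_eq_rhs)
qed

lemma moll_line_derivative:
  fixes K :: "'a::euclidean_space \<Rightarrow> real"
  assumes "0 < \<epsilon>" and K: "integrable lborel K"
  shows "((\<lambda>s. moll \<epsilon> K (s *\<^sub>R e)) has_real_derivative
    - ((LBINT y. K y *\<^sub>R dkern \<epsilon> (s *\<^sub>R e - y)) \<bullet> e) / (LBINT y. kern \<epsilon> (y::'a))) (at s)"
proof -
  have [measurable]: "K \<in> borel_measurable borel"
    using borel_measurable_integrable[OF K] by simp
  obtain B where B: "0 \<le> B" "\<And>z::'a. norm (dkern \<epsilon> z) \<le> B"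
    by (rule dkern_bounded[OF assms(1)]) (rule that)
  define \<Phi> where "\<Phi> s = (LBINT y. K y * kern \<epsilon> (s *\<^sub>R e - y))" for s
  have int: "integrable lborel (\<lambda>y. K y * kern \<epsilon> (z - y))" for z
  proof (rule Bochner_Integration.integrable_bound[OF K])
    show "AE y in lborel. norm (K y * kern \<epsilon> (z - y)) \<le> norm (K y)"
      using kern_nonneg[of \<epsilon>, where 'a='a] kern_le_1[of \<epsilon>, where 'a='a]
      by (intro AE_I2) (simp add: abs_mult mult_left_le)
  qed simp
  have lip: "\<bar>kern \<epsilon> (a *\<^sub>R e - y) - kern \<epsilon> (b *\<^sub>R e - y)\<bar> \<le> B * norm e * \<bar>a - b\<bar>" for a b y
  proof -
    have "norm (kern \<epsilon> (a *\<^sub>R e - y) - kern \<epsilon> (b *\<^sub>R e - y)) \<le> B * norm e * norm (a - b)"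
    proof (rule field_differentiable_bound[of UNIV])
      show "((\<lambda>s. kern \<epsilon> (s *\<^sub>R e - y)) has_real_derivative - (dkern \<epsilon> (s *\<^sub>R e - y) \<bullet> e)) (at s within UNIV)" for s
        by (rule kern_line_derivative)
      show "norm (- (dkern \<epsilon> (s *\<^sub>R e - y) \<bullet> e)) \<le> B * norm e" for s
        using order_trans[OF Cauchy_Schwarz_ineq2 mult_right_mono[OF B(2)]] by simp
    qed auto
    then show ?thesis by simp
  qed
  have "(\<Phi> has_real_derivative (LBINT y. K y * - (dkern \<epsilon> (s *\<^sub>R e - y) \<bullet> e))) (at s)"
    unfolding DERIV_def tendsto_at_iff_sequentially comp_def
  proof (intro allI impI)
    fix X :: "nat \<Rightarrow> real" assume X: "\<forall>i. X i \<in> UNIV - {0}" "X \<longlonglongrightarrow> 0"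
    let ?q = "\<lambda>n y. (kern \<epsilon> ((s + X n) *\<^sub>R e - y) - kern \<epsilon> (s *\<^sub>R e - y)) / X n"
    have "(\<lambda>n. \<integral>y. K y * ?q n y \<partial>lborel) \<longlonglongrightarrow>
       (LBINT y. K y * - (dkern \<epsilon> (s *\<^sub>R e - y) \<bullet> e))"
    proof (rule integral_dominated_convergence[where w = "\<lambda>y. B * norm e * \<bar>K y\<bar>"])
      show "AE y in lborel. (\<lambda>n. K y * ?q n y) \<longlonglongrightarrow> K y * - (dkern \<epsilon> (s *\<^sub>R e - y) \<bullet> e)"
      proof (intro AE_I2 tendsto_mult tendsto_const)
        fix y
        show "(\<lambda>n. ?q n y) \<longlonglongrightarrow> - (dkern \<epsilon> (s *\<^sub>R e - y) \<bullet> e)"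
          using kern_line_derivative[of \<epsilon> e y s] X
          unfolding DERIV_def tendsto_at_iff_sequentially comp_def by blast
      qed
      show "AE y in lborel. norm (K y * ?q n y) \<le> B * norm e * \<bar>K y\<bar>" for n
      proof (intro AE_I2)
        fix y
        have "\<bar>?q n y\<bar> \<le> B * norm e"
          using lip[of "s + X n" y s] X(1) by (simp add: abs_divide pos_divide_le_eq)
        from mult_left_mono[OF this, of "\<bar>K y\<bar>"]
        show "norm (K y * ?q n y) \<le> B * norm e * \<bar>K y\<bar>"
          by (simp add: abs_mult mult_ac)
      qed
      show "integrable lborel (\<lambda>y. B * norm e * \<bar>K y\<bar>)" using K by simp
    qed measurable
    moreover have "(LBINT y. K y * ?q n y) = (\<Phi> (s + X n) - \<Phi> s) / X n" for n
    proof -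
      have "(LBINT y. K y * ?q n y) =
        (LBINT y. (K y * kern \<epsilon> ((s + X n) *\<^sub>R e - y) - K y * kern \<epsilon> (s *\<^sub>R e - y)) / X n)"
        by (intro Bochner_Integration.integral_cong) (auto simp: right_diff_distrib)
      also have "\<dots> = (\<Phi> (s + X n) - \<Phi> s) / X n"
        unfolding \<Phi>_def using int by (simp add: Bochner_Integration.integral_diff)
      finally show ?thesis .
    qed
    ultimately show "(\<lambda>n. (\<Phi> (s + X n) - \<Phi> s) / X n) \<longlonglongrightarrow> (LBINT y. K y * - (dkern \<epsilon> (s *\<^sub>R e - y) \<bullet> e))"
      by (simp only:)
  qed
  moreover have "(LBINT y. K y * - (dkern \<epsilon> (s *\<^sub>R e - y) \<bullet> e)) = - ((LBINT y. K y *\<^sub>R dkern \<epsilon> (s *\<^sub>R e - y)) \<bullet> e)"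
    using integral_inner_left[of e lborel "\<lambda>y. K y *\<^sub>R dkern \<epsilon> (s *\<^sub>R e - y)"] integrable_dkern[OF assms, of "s *\<^sub>R e"]
    by simp
  ultimately have "(\<Phi> has_real_derivative - ((LBINT y. K y *\<^sub>R dkern \<epsilon> (s *\<^sub>R e - y)) \<bullet> e)) (at s)" by simp
  moreover have "moll \<epsilon> K (s *\<^sub>R e) = \<Phi> s / (LBINT y. kern \<epsilon> (y::'a))" for s
    by (simp add: moll_def nkern_def \<Phi>_def mult.commute)
  ultimately show ?thesis by (simp only: DERIV_cdivide)
qed

lemma radial_primitive:
  fixes K :: "real ^ 'n::finite \<Rightarrow> real" and g :: "real ^ 'n \<Rightarrow> real ^ 'n"
  assumes rad: "AE y in lborel. K y = w (norm y)"
    and K: "integrable lborel K" and g: "integrable lborel g"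
    and W: "\<And>x \<epsilon>. 0 < \<epsilon> \<Longrightarrow> norm x + \<epsilon> < r \<Longrightarrow>
      (LBINT y. kern \<epsilon> (x - y) *\<^sub>R g y) = - (LBINT y. K y *\<^sub>R dkern \<epsilon> (x - y))"
    and gp: "AE x in lborel. x \<noteq> 0 \<and> norm x < r \<longrightarrow> g x = (p (norm x) / norm x) *\<^sub>R x"
    and p: "continuous_on {0<..<r} p"
    and w0: "\<And>s. 0 < s \<Longrightarrow> s < r \<Longrightarrow> (w0 has_real_derivative p s) (at s)"
    and "0 < r"
  shows "\<exists>c. AE x in lborel. x \<noteq> 0 \<and> norm x < r \<longrightarrow> K x = w0 (norm x) + c"
proof -
  have [measurable]: "K \<in> borel_measurable borel"
    using borel_measurable_integrable[OF K] by simp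
  define G where "G x = (p (norm x) / norm x) *\<^sub>R x" for x :: "real ^ 'n"
  define e :: "real ^ 'n" where "e = axis undefined 1"
  have e: "norm e = 1" by (simp add: e_def)
  define \<phi> where "\<phi> n s = moll (eps n) K (s *\<^sub>R e)" for n s
  have \<phi>': "(\<phi> n has_real_derivative moll (eps n) g (s *\<^sub>R e) \<bullet> e) (at s)" if "\<bar>s\<bar> + eps n < r" for n s
  proof -
    define m where "m = (LBINT y. kern (eps n) (y::real^'n))"
    have "moll (eps n) g (s *\<^sub>R e) = (LBINT y. (1 / m) *\<^sub>R (kern (eps n) (s *\<^sub>R e - y) *\<^sub>R g y))"
      by (simp add: moll_def nkern_def m_def)
    also have "\<dots> = (1 / m) *\<^sub>R (LBINT y. kern (eps n) (s *\<^sub>R e - y) *\<^sub>R g y)"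
      by (rule integral_scaleR_right)
    also have "\<dots> = (1 / m) *\<^sub>R - (LBINT y. K y *\<^sub>R dkern (eps n) (s *\<^sub>R e - y))"
      using that e by (subst W[OF eps_pos]) auto
    finally show ?thesis
      using moll_line_derivative[OF eps_pos K, of n e s] unfolding \<phi>_def by (simp add: m_def)
  qed
  have diff: "(\<lambda>n. \<phi> n b - \<phi> n a) \<longlonglongrightarrow> w0 b - w0 a" if ab: "0 < a" "a \<le> b" "b < r" for a b
  proof (rule LIMSEQ_I)
    fix \<eta> :: real assume "0 < \<eta>"
    define \<delta> where "\<delta> = \<eta> / (2 * (b - a + 1))"
    have "0 < \<delta>" using \<open>0 < \<eta>\<close> ab by (simp add: \<delta>_def)
    define A where "A = cball 0 ((b + r) / 2) - ball (0::real^'n) (a / 2)"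
    have "compact A" unfolding A_def by (intro compact_diff compact_cball open_ball)
    moreover have "continuous_on A G"
      unfolding G_def
      using ab by (intro continuous_intros continuous_on_compose2[OF p]) (auto simp: A_def)
    ultimately have "uniformly_continuous_on A G" by (intro compact_uniformly_continuous)
    then obtain d where d: "0 < d" "\<And>x x'. x \<in> A \<Longrightarrow> x' \<in> A \<Longrightarrow> dist x' x < d \<Longrightarrow> dist (G x') (G x) < \<delta>"
      using \<open>0 < \<delta>\<close> unfolding uniformly_continuous_on_def by metis
    have "eventually (\<lambda>n. eps n < min d (min (a / 2) ((r - b) / 2))) sequentially"
      by (rule order_tendstoD[OF eps_tendsto]) (use ab d in simp)
    then obtain n0 where n0: "\<And>n. n \<ge> n0 \<Longrightarrow> eps n < min d (min (a / 2) ((r - b) / 2))"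
      unfolding eventually_sequentially by metis
    have "norm (\<phi> n b - \<phi> n a - (w0 b - w0 a)) < \<eta>" if "n \<ge> n0" for n
    proof -
      have ep: "eps n < d" "eps n < a / 2" "eps n < (r - b) / 2" using n0[OF that] by auto
      have der: "((\<lambda>s. \<phi> n s - w0 s) has_real_derivative moll (eps n) g (s *\<^sub>R e) \<bullet> e - p s) (at s within {a..b})" if "s \<in> {a..b}" for s
        using that ab ep by (intro has_field_derivative_at_within[OF DERIV_diff] \<phi>' w0) auto
      have bd: "norm (moll (eps n) g (s *\<^sub>R e) \<bullet> e - p s) \<le> \<delta>" if s: "s \<in> {a..b}" for s
      proof -
        have Gs: "G (s *\<^sub>R e) = p s *\<^sub>R e" using s ab e by (simp add: G_def)
        have "norm (moll (eps n) g (s *\<^sub>R e) - G (s *\<^sub>R e)) \<le> \<delta>"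
        proof (rule moll_near_AE[OF eps_pos g])
          show "AE y in lborel. norm (s *\<^sub>R e - y) < eps n \<longrightarrow> norm (g y - G (s *\<^sub>R e)) \<le> \<delta>"
            using gp
          proof eventually_elim
            case (elim y)
            show ?case
            proof
              assume y: "norm (s *\<^sub>R e - y) < eps n"
              have "norm (s *\<^sub>R e) = s" using s ab e by simp
              then have "\<bar>s - norm y\<bar> < eps n" using norm_triangle_ineq3[of "s *\<^sub>R e" y] y by simp
              then have ny: "a / 2 < norm y" "norm y < (b + r) / 2" using s ep by (auto simp: abs_if field_simps split: if_splits)
              then have "y \<in> A" "y \<noteq> 0" "norm y < r" using ab by (auto simp: A_def)
              moreover have "s *\<^sub>R e \<in> A" using s ab e by (auto simp: A_def)
              moreover have "dist y (s *\<^sub>R e) < d" using y ep by (simp add: dist_norm norm_minus_commute)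
              ultimately have "dist (G y) (G (s *\<^sub>R e)) < \<delta>" using d(2) by blast
              moreover have "g y = G y" using elim \<open>y \<noteq> 0\<close> \<open>norm y < r\<close> by (simp add: G_def)
              ultimately show "norm (g y - G (s *\<^sub>R e)) \<le> \<delta>" by (simp add: dist_norm)
            qed
          qed
        qed
        moreover have "moll (eps n) g (s *\<^sub>R e) \<bullet> e - p s = (moll (eps n) g (s *\<^sub>R e) - G (s *\<^sub>R e)) \<bullet> e"
          using e by (simp add: Gs inner_diff_left norm_eq_1)
        ultimately show ?thesis
          using Cauchy_Schwarz_ineq2[of "moll (eps n) g (s *\<^sub>R e) - G (s *\<^sub>R e)" e] e by simp
      qed
      have "norm ((\<phi> n b - w0 b) - (\<phi> n a - w0 a)) \<le> \<delta> * norm (b - a)"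
        by (rule field_differentiable_bound[OF _ der bd]) (use ab in auto)
      also have "\<dots> < \<eta>"
        using ab \<open>0 < \<eta>\<close> by (simp add: \<delta>_def field_simps add_strict_increasing)
      finally show ?thesis by (simp add: algebra_simps)
    qed
    then show "\<exists>n0. \<forall>n\<ge>n0. norm (\<phi> n b - \<phi> n a - (w0 b - w0 a)) < \<eta>" by blast
  qed
  have diff': "(\<lambda>n. \<phi> n b - \<phi> n a) \<longlonglongrightarrow> w0 b - w0 a" if ab: "0 < a" "a < r" "0 < b" "b < r" for a b
  proof (cases "a \<le> b")
    case False
    then have "(\<lambda>n. - (\<phi> n a - \<phi> n b)) \<longlonglongrightarrow> - (w0 a - w0 b)" using ab by (intro tendsto_minus diff) auto
    then show ?thesis by simp
  qed (use ab diff in auto)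
  obtain s where s: "strict_mono s" "AE x in lborel. (\<lambda>n. moll (eps (s n)) K x) \<longlonglongrightarrow> K x"
    by (rule moll_AE_subseq[OF K]) (rule that)
  have radial: "moll \<epsilon> K x = moll \<epsilon> K (norm x *\<^sub>R e)" for \<epsilon> x
  proof -
    have "norm x = norm (norm x *\<^sub>R e)" using e by simp
    then obtain Q where "orthogonal_transformation Q" "Q x = norm x *\<^sub>R e"
      using orthogonal_transformation_exists by blast
    then show ?thesis using moll_radial[of Q K w \<epsilon> x] rad by simp
  qed
  have "\<exists>x0. x0 \<noteq> 0 \<and> norm x0 < r \<and> (\<lambda>n. moll (eps (s n)) K x0) \<longlonglongrightarrow> K x0"
  proof (rule ccontr)
    assume "\<not> ?thesis"
    then have "AE x in lborel. x \<notin> ball (0::real^'n) r"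
      using s(2) AE_lborel_singleton[of 0] by (auto elim!: eventually_elim2)
    then have "emeasure lborel (ball (0::real^'n) r) = 0"
      by (subst (asm) AE_iff_measurable[of "ball 0 r"]) auto
    then show False
      using \<open>0 < r\<close> unit_ball_vol_neq_0[where 'a="real^'n"] by (simp add: emeasure_ball)
  qed
  then obtain x0 where x0: "x0 \<noteq> 0" "norm x0 < r" "(\<lambda>n. moll (eps (s n)) K x0) \<longlonglongrightarrow> K x0" by blast
  have "AE x in lborel. x \<noteq> 0 \<and> norm x < r \<longrightarrow> K x = w0 (norm x) + (K x0 - w0 (norm x0))"
    using s(2)
  proof eventually_elim
    fix x assume lim: "(\<lambda>n. moll (eps (s n)) K x) \<longlonglongrightarrow> K x"
    show "x \<noteq> 0 \<and> norm x < r \<longrightarrow> K x = w0 (norm x) + (K x0 - w0 (norm x0))"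
    proof
      assume x: "x \<noteq> 0 \<and> norm x < r"
      have "(\<lambda>n. moll (eps (s n)) K x - moll (eps (s n)) K x0) \<longlonglongrightarrow> K x - K x0"
        by (intro tendsto_intros lim x0)
      moreover have "(\<lambda>n. moll (eps (s n)) K x - moll (eps (s n)) K x0) \<longlonglongrightarrow> w0 (norm x) - w0 (norm x0)"
        using LIMSEQ_subseq_LIMSEQ[OF diff'[of "norm x0" "norm x"] s(1)] x x0
        by (subst (1 2) radial) (simp add: \<phi>_def comp_def)
      ultimately have "K x - K x0 = w0 (norm x) - w0 (norm x0)" by (rule LIMSEQ_unique)
      then show "K x = w0 (norm x) + (K x0 - w0 (norm x0))" by simp
    qed
  qed
  then show ?thesis by blast
qed

subsection \<open>Boundedness of the right-hand side\<close>

definition flux_density :: "('a::euclidean_space \<Rightarrow> real) \<Rightarrow> real \<Rightarrow> real" where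
  "flux_density h r = ball_mass h r / (DIM('a) * unit_ball_vol DIM('a) * r ^ (DIM('a) - 1))"

definition slope :: "('a::euclidean_space \<Rightarrow> real) \<Rightarrow> real \<Rightarrow> real" where
  "slope h r = root (DIM('a) - 1) (flux_density h r)"

lemma sphere_const_pos: "0 < real DIM('a::euclidean_space) * unit_ball_vol (real DIM('a))"
  using unit_ball_vol_pos[of "real DIM('a)"] by (simp del: unit_ball_vol_pos)

context
  fixes h :: "'a::euclidean_space \<Rightarrow> real"
  assumes h: "integrable lborel h" and h_nonneg: "\<And>x. 0 \<le> h x"
begin

lemma integrable_ball_mass: "integrable lborel (\<lambda>x. indicator (cball 0 r) x * h x)"
  using integrable_mult_indicator[OF _ h, of "cball 0 r"] by simp

lemma ball_mass_nonneg: "0 \<le> ball_mass h r"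
  unfolding ball_mass_def using h_nonneg by (intro integral_nonneg_AE AE_I2) auto

lemma ball_mass_mono: "r \<le> s \<Longrightarrow> ball_mass h r \<le> ball_mass h s"
  unfolding ball_mass_def using h_nonneg
  by (intro integral_mono integrable_ball_mass) (auto simp: indicator_def)

lemma ball_mass_small:
  assumes "0 < \<eta>" "0 < b"
  obtains r where "0 < r" "r < b" "ball_mass h r < \<eta>"
proof -
  have "(\<lambda>n. ball_mass h (eps n)) \<longlonglongrightarrow> (\<integral>x. 0 \<partial>(lborel::'a measure))"
    unfolding ball_mass_def
  proof (rule integral_dominated_convergence[where w = "\<lambda>x. \<bar>h x\<bar>"])
    show "AE x in lborel. (\<lambda>n. indicator (cball 0 (eps n)) x * h x) \<longlonglongrightarrow> 0"
      using AE_lborel_singleton[of 0]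
    proof eventually_elim
      fix x :: 'a assume "x \<noteq> 0"
      then have "eventually (\<lambda>n. eps n < norm x) sequentially"
        by (intro order_tendstoD[OF eps_tendsto]) simp
      then have "eventually (\<lambda>n. indicator (cball 0 (eps n)) x * h x = 0) sequentially"
        by eventually_elim simp
      then show "(\<lambda>n. indicator (cball 0 (eps n)) x * h x) \<longlonglongrightarrow> 0" by (rule tendsto_eventually)
    qed
    show "AE x in lborel. norm (indicator (cball 0 (eps n)) x * h x) \<le> \<bar>h x\<bar>" for n
      by (intro AE_I2) (auto simp: indicator_def)
  qed (use h integrable_ball_mass in auto)
  then have "(\<lambda>n. ball_mass h (eps n)) \<longlonglongrightarrow> 0" by simp
  then have "eventually (\<lambda>n. ball_mass h (eps n) < \<eta>) sequentially"
    using assms(1) by (rule order_tendstoD)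
  moreover have "eventually (\<lambda>n. eps n < b) sequentially"
    using assms(2) by (rule order_tendstoD[OF eps_tendsto])
  ultimately have "\<exists>n. ball_mass h (eps n) < \<eta> \<and> eps n < b"
    by (intro eventually_happens'[OF sequentially_bot] eventually_conj)
  then show ?thesis using that eps_pos by blast
qed

lemma flux_density_nonneg: "0 \<le> r \<Longrightarrow> 0 \<le> flux_density h r"
  unfolding flux_density_def
  using ball_mass_nonneg sphere_const_pos[where 'a='a] by (intro divide_nonneg_nonneg) auto

lemma slope_nonneg: "0 \<le> r \<Longrightarrow> 0 \<le> slope h r"
  unfolding slope_def by (rule real_root_ge_zero[OF flux_density_nonneg])

lemma times_slope:
  assumes "2 \<le> DIM('a)" "0 < r"
  shows "r * slope h r = root (DIM('a) - 1) (ball_mass h r / (DIM('a) * unit_ball_vol DIM('a)))"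
proof -
  have n: "0 < DIM('a) - 1" using assms by simp
  have "r * slope h r = root (DIM('a) - 1) (r ^ (DIM('a) - 1) * flux_density h r)"
    using n assms by (simp add: slope_def real_root_mult real_root_power_cancel)
  also have "r ^ (DIM('a) - 1) * flux_density h r = ball_mass h r / (DIM('a) * unit_ball_vol DIM('a))"
    using assms by (simp add: flux_density_def)
  finally show ?thesis .
qed

lemma ball_mass_le_powr:
  assumes D: "2 \<le> DIM('a)" and "0 < r" "0 \<le> M"
    and bd: "AE x in lborel. x \<noteq> 0 \<and> norm x \<le> r \<longrightarrow> h x \<le> M * norm x powr (- (1/2))"
  obtains C where "0 \<le> C" "\<And>s. 0 < s \<Longrightarrow> s \<le> r \<Longrightarrow> ball_mass h s \<le> C * s powr (DIM('a) - 1/2)"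
proof -
  let ?n = "DIM('a)" and ?c = "unit_ball_vol DIM('a) * DIM('a) / 2"
  define C where "C = M * (?c / (?n / 2 - 1/4))"
  have "0 \<le> C" using \<open>0 \<le> M\<close> D by (auto simp: C_def intro!: mult_nonneg_nonneg divide_nonneg_nonneg)
  moreover have "ball_mass h s \<le> C * s powr (?n - 1/2)" if s: "0 < s" "s \<le> r" for s
  proof -
    define F where "F \<tau> = indicator {0<..s\<^sup>2} \<tau> * \<tau> powr (- (1/4))" for \<tau> :: real
    have [measurable]: "F \<in> borel_measurable borel" unfolding F_def by measurable
    have "((\<lambda>\<tau>. ?c * \<tau> powr (?n / 2 - 5/4)) has_integral
        ?c * ((s\<^sup>2) powr (?n / 2 - 5/4 + 1) / (?n / 2 - 5/4 + 1))) {0..s\<^sup>2}"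
      using D by (intro has_integral_mult_right has_integral_powr_from_0) auto
    moreover have "(s\<^sup>2) powr (?n / 2 - 5/4 + 1) = s powr (?n - 1/2)"
    proof -
      have "(s\<^sup>2) powr (?n / 2 - 5/4 + 1) = (s powr 2) powr (?n / 2 - 5/4 + 1)" using s by simp
      also have "\<dots> = s powr (?n - 1/2)" unfolding powr_powr by (simp add: algebra_simps)
      finally show ?thesis .
    qed
    ultimately have I: "((\<lambda>\<tau>. ?c * \<tau> powr (?n / 2 - 5/4)) has_integral
        ?c / (?n / 2 - 1/4) * s powr (?n - 1/2)) {0..s\<^sup>2}"
      by (simp add: algebra_simps)
    have "(\<integral>\<^sup>+\<tau>. ennreal (sq_weight ?n \<tau> * F \<tau>) \<partial>lborel) =
        (\<integral>\<^sup>+\<tau>. ennreal (?c * \<tau> powr (?n / 2 - 5/4)) * indicator {0..s\<^sup>2} \<tau> \<partial>lborel)"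
    proof (rule nn_integral_cong)
      fix \<tau>
      have "\<tau> powr (real ?n / 2 - 1) * \<tau> powr (- (1/4)) = \<tau> powr (?n / 2 - 5/4)"
        unfolding powr_add[symmetric] by (simp add: algebra_simps)
      then show "ennreal (sq_weight ?n \<tau> * F \<tau>) = ennreal (?c * \<tau> powr (?n / 2 - 5/4)) * indicator {0..s\<^sup>2} \<tau>"
        by (cases "\<tau> = 0") (auto simp: sq_weight_def F_def indicator_def mult.assoc)
    qed
    also have "\<dots> = ennreal (?c / (?n / 2 - 1/4) * s powr (?n - 1/2))"
      by (rule nn_integral_has_integral_lebesgue'[OF _ I]) simp
    finally have "has_bochner_integral lborel (\<lambda>\<tau>. sq_weight ?n \<tau> * F \<tau>) (?c / (?n / 2 - 1/4) * s powr (?n - 1/2))"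
      using D by (intro has_bochner_integral_nn_integral) (auto simp: sq_weight_nonneg F_def intro!: mult_nonneg_nonneg divide_nonneg_nonneg)
    then have F: "integrable lborel (\<lambda>x::'a. F ((norm x)\<^sup>2))"
      "(LBINT x. F ((norm (x::'a))\<^sup>2)) = ?c / (?n / 2 - 1/4) * s powr (?n - 1/2)"
      by (simp_all add: integral_norm_square has_bochner_integral_iff)
    have "ball_mass h s \<le> (LBINT x. M * F ((norm (x::'a))\<^sup>2))"
      unfolding ball_mass_def
    proof (rule integral_mono_AE[OF integrable_ball_mass])
      show "integrable lborel (\<lambda>x::'a. M * F ((norm x)\<^sup>2))" using F by simp
      show "AE x in lborel. indicator (cball 0 s) x * h x \<le> M * F ((norm x)\<^sup>2)"
        using bd AE_lborel_singleton[of 0]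
      proof eventually_elim
        fix x :: 'a assume b: "x \<noteq> 0 \<and> norm x \<le> r \<longrightarrow> h x \<le> M * norm x powr (- (1/2))" and "x \<noteq> 0"
        show "indicator (cball 0 s) x * h x \<le> M * F ((norm x)\<^sup>2)"
        proof (cases "norm x \<le> s")
          case True
          have "((norm x)\<^sup>2) powr (- (1/4)) = (norm x powr 2) powr (- (1/4))" using \<open>x \<noteq> 0\<close> by simp
          also have "\<dots> = norm x powr (- (1/2))" unfolding powr_powr by simp
          finally show ?thesis using b True s \<open>x \<noteq> 0\<close> by (simp add: F_def power_mono)
        next
          case False
          then show ?thesis using \<open>0 \<le> M\<close> by (simp add: F_def)
        qed
      qed
    qed
    also have "\<dots> = C * s powr (?n - 1/2)" by (simp add: F C_def)
    finally show ?thesis .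
  qed
  ultimately show ?thesis by (rule that)
qed

text \<open>First \<open>r * slope h r \<rightarrow> 0\<close> makes \<open>u\<close> smaller than every multiple of \<open>ln (1/r)\<close>, so that
  \<open>h \<le> M exp (\<beta> u)\<close> is at most of order \<open>r powr (-1/2)\<close>; this in turn bounds the slope.\<close>

lemma bounded_near_0:
  assumes D: "2 \<le> DIM('a)" and "0 < r" "0 < \<beta>" "0 \<le> M"
    and w: "\<And>s. 0 < s \<Longrightarrow> s < r \<Longrightarrow> (w has_real_derivative - slope h s) (at s)"
    and exp_bd: "AE x in lborel. x \<noteq> 0 \<and> norm x < r \<longrightarrow> h x \<le> M * exp (\<beta> * w (norm x))"
  obtains a C where "0 < a" "a < r" "AE x in lborel. x \<noteq> 0 \<and> norm x \<le> a \<longrightarrow> h x \<le> C"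
proof -
  let ?n = "DIM('a)"
  define k where "k = real ?n * unit_ball_vol ?n"
  have k: "0 < k" using sphere_const_pos[where 'a='a] by (simp add: k_def)
  have n: "0 < ?n - 1" using D by simp
  define \<alpha> where "\<alpha> = 1 / (2 * \<beta>)"
  have "0 < \<alpha>" using \<open>0 < \<beta>\<close> by (simp add: \<alpha>_def)
  obtain a where a: "0 < a" "a < r" "ball_mass h a < k * \<alpha> ^ (?n - 1)"
    by (rule ball_mass_small[of "k * \<alpha> ^ (?n - 1)" r]) (use k \<open>0 < \<alpha>\<close> \<open>0 < r\<close> that in auto)
  have sl: "s * slope h s \<le> \<alpha>" if "0 < s" "s \<le> a" for s
  proof -
    have "ball_mass h s / k \<le> \<alpha> ^ (?n - 1)"
      using ball_mass_mono[OF that(2)] a(3) k by (simp add: field_simps)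
    then have "root (?n - 1) (ball_mass h s / k) \<le> root (?n - 1) (\<alpha> ^ (?n - 1))"
      using n by simp
    then show ?thesis
      using times_slope[OF D that(1)] n \<open>0 < \<alpha>\<close> by (simp add: k_def real_root_power_cancel)
  qed
  have w_log: "w s \<le> w a + \<alpha> * (ln a - ln s)" if s: "0 < s" "s \<le> a" for s
  proof -
    have "w s + \<alpha> * ln s \<le> w a + \<alpha> * ln a"
    proof (rule DERIV_nonneg_imp_nondecreasing[OF s(2)])
      fix t assume t: "s \<le> t" "t \<le> a"
      have "((\<lambda>t. w t + \<alpha> * ln t) has_real_derivative - slope h t + \<alpha> * (1 / t)) (at t)"
        using t s a by (auto intro!: derivative_eq_intros w)
      moreover have "0 \<le> - slope h t + \<alpha> * (1 / t)"
        using sl[of t] t s by (simp add: field_simps)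
      ultimately show "\<exists>y. ((\<lambda>t. w t + \<alpha> * ln t) has_real_derivative y) (at t) \<and> 0 \<le> y" by blast
    qed
    then show ?thesis by (simp add: algebra_simps)
  qed
  define M1 where "M1 = M * exp (\<beta> * w a + ln a / 2)"
  have "0 \<le> M1" using \<open>0 \<le> M\<close> by (simp add: M1_def)
  have "AE x in lborel. x \<noteq> 0 \<and> norm x \<le> a \<longrightarrow> h x \<le> M1 * norm x powr (- (1/2))"
    using exp_bd
  proof eventually_elim
    fix x :: 'a assume hx: "x \<noteq> 0 \<and> norm x < r \<longrightarrow> h x \<le> M * exp (\<beta> * w (norm x))"
    show "x \<noteq> 0 \<and> norm x \<le> a \<longrightarrow> h x \<le> M1 * norm x powr (- (1/2))"
    proof
      assume x: "x \<noteq> 0 \<and> norm x \<le> a"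
      have "\<beta> * w (norm x) \<le> \<beta> * (w a + \<alpha> * (ln a - ln (norm x)))"
        using w_log[of "norm x"] x \<open>0 < \<beta>\<close> by (intro mult_left_mono) auto
      also have "\<dots> = (\<beta> * w a + ln a / 2) + (- (1/2)) * ln (norm x)"
        using \<open>0 < \<beta>\<close> by (simp add: \<alpha>_def field_simps)
      finally have "exp (\<beta> * w (norm x)) \<le> exp (\<beta> * w a + ln a / 2) * norm x powr (- (1/2))"
        using x by (simp add: powr_def exp_add[symmetric])
      then have "M * exp (\<beta> * w (norm x)) \<le> M1 * norm x powr (- (1/2))"
        unfolding M1_def mult.assoc using \<open>0 \<le> M\<close> by (rule mult_left_mono)
      then show "h x \<le> M1 * norm x powr (- (1/2))" using hx x a by simp
    qed
  qed
  from ball_mass_le_powr[OF D a(1) \<open>0 \<le> M1\<close> this] obtain C where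
    C: "0 \<le> C" "\<And>s. 0 < s \<Longrightarrow> s \<le> a \<Longrightarrow> ball_mass h s \<le> C * s powr (?n - 1/2)" by metis
  define B where "B = root (?n - 1) (C / k * a powr (1/2))"
  have slB: "slope h s \<le> B" if s: "0 < s" "s \<le> a" for s
  proof -
    have "s powr (real ?n - 1/2) = s powr (real (?n - 1)) * s powr (1/2)"
      using D unfolding powr_add[symmetric] by (simp add: of_nat_diff)
    also have "\<dots> = s ^ (?n - 1) * s powr (1/2)" by (simp only: powr_realpow[OF s(1)])
    finally have "ball_mass h s \<le> C * (s ^ (?n - 1) * s powr (1/2))" using C(2)[OF s] by simp
    then have "flux_density h s \<le> C * (s ^ (?n - 1) * s powr (1/2)) / (k * s ^ (?n - 1))"
      unfolding flux_density_def k_def[symmetric] using k s by (intro divide_right_mono) auto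
    also have "\<dots> = C / k * s powr (1/2)" using s by simp
    also have "\<dots> \<le> C / k * a powr (1/2)"
      using s C(1) k by (intro mult_left_mono powr_mono2) auto
    finally show ?thesis unfolding slope_def B_def using n by simp
  qed
  have w_bd: "w s \<le> w a + B * a" if s: "0 < s" "s \<le> a" for s
  proof -
    have "w s + B * s \<le> w a + B * a"
    proof (rule DERIV_nonneg_imp_nondecreasing[OF s(2)])
      fix t assume t: "s \<le> t" "t \<le> a"
      have "((\<lambda>t. w t + B * t) has_real_derivative - slope h t + B) (at t)"
        using t s a by (auto intro!: derivative_eq_intros w)
      then show "\<exists>y. ((\<lambda>t. w t + B * t) has_real_derivative y) (at t) \<and> 0 \<le> y"
        using slB[of t] t s by (intro exI[of _ "- slope h t + B"]) auto
    qed
    moreover have "0 \<le> B" using slB[OF s] slope_nonneg[of s] s by linarith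
    ultimately show ?thesis using s mult_nonneg_nonneg[of B s] by linarith
  qed
  have "AE x in lborel. x \<noteq> 0 \<and> norm x \<le> a \<longrightarrow> h x \<le> M * exp (\<beta> * (w a + B * a))"
    using exp_bd
  proof eventually_elim
    fix x :: 'a assume hx: "x \<noteq> 0 \<and> norm x < r \<longrightarrow> h x \<le> M * exp (\<beta> * w (norm x))"
    show "x \<noteq> 0 \<and> norm x \<le> a \<longrightarrow> h x \<le> M * exp (\<beta> * (w a + B * a))"
    proof
      assume x: "x \<noteq> 0 \<and> norm x \<le> a"
      then have "M * exp (\<beta> * w (norm x)) \<le> M * exp (\<beta> * (w a + B * a))"
        using w_bd[of "norm x"] \<open>0 < \<beta>\<close> \<open>0 \<le> M\<close> by (intro mult_left_mono) auto
      then show "h x \<le> M * exp (\<beta> * (w a + B * a))" using hx x a by simp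
    qed
  qed
  then show ?thesis using that a by blast
qed

end

subsection \<open>Hoelder regularity of the radial profile\<close>

lemma AE_norm_neq: "AE x in lborel. norm (x::'a::euclidean_space) \<noteq> r"
proof -
  have "AE \<tau> in lborel. 0 < \<tau> \<longrightarrow> \<tau> \<noteq> r\<^sup>2"
    using AE_lborel_singleton[of "r\<^sup>2"] by eventually_elim simp
  from AE_norm_square[OF this, where 'a='a] show ?thesis by eventually_elim auto
qed

lemma isCont_ball_mass:
  fixes h :: "'a::euclidean_space \<Rightarrow> real"
  assumes h: "integrable lborel h"
  shows "isCont (ball_mass h) r"
  unfolding isCont_def tendsto_at_iff_sequentially comp_def
proof (intro allI impI)
  have meas: "(\<lambda>x. indicator (cball 0 s) x * h x) \<in> borel_measurable borel" for s
    using borel_measurable_integrable[OF h] by (intro borel_measurable_times borel_measurable_indicator) auto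
  fix X :: "nat \<Rightarrow> real" assume X: "X \<longlonglongrightarrow> r"
  show "(\<lambda>n. ball_mass h (X n)) \<longlonglongrightarrow> ball_mass h r"
    unfolding ball_mass_def
  proof (rule integral_dominated_convergence[where w = "\<lambda>x. \<bar>h x\<bar>"])
    show "AE x in lborel. (\<lambda>n. indicator (cball 0 (X n)) x * h x) \<longlonglongrightarrow> indicator (cball 0 r) x * h x"
      using AE_norm_neq[of r]
    proof eventually_elim
      fix x :: 'a assume "norm x \<noteq> r"
      then have "norm x < r \<or> r < norm x" by linarith
      then have "eventually (\<lambda>n. norm x \<le> X n \<longleftrightarrow> norm x \<le> r) sequentially"
      proof
        assume x: "norm x < r"
        from order_tendstoD(1)[OF X x] show ?thesis by eventually_elim (use x in auto)
      next
        assume x: "r < norm x"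
        from order_tendstoD(2)[OF X x] show ?thesis by eventually_elim (use x in auto)
      qed
      then have "eventually (\<lambda>n. indicator (cball 0 (X n)) x * h x = indicator (cball 0 r) x * h x) sequentially"
        by eventually_elim (simp add: indicator_def)
      then show "(\<lambda>n. indicator (cball 0 (X n)) x * h x) \<longlonglongrightarrow> indicator (cball 0 r) x * h x"
        by (rule tendsto_eventually)
    qed
    show "AE x in lborel. norm (indicator (cball 0 (X n)) x * h x) \<le> \<bar>h x\<bar>" for n
      by (intro AE_I2) (auto simp: indicator_def)
  qed (use h meas in simp_all)
qed

lemma continuous_on_slope:
  fixes h :: "'a::euclidean_space \<Rightarrow> real"
  assumes "integrable lborel h"
  shows "continuous_on {0<..} (slope h)"
proof -
  have "continuous_on {0<..} (ball_mass h)"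
    using isCont_ball_mass[OF assms] by (intro continuous_at_imp_continuous_on) auto
  then show ?thesis
    unfolding slope_def flux_density_def
    using unit_ball_vol_neq_0[where 'a='a] by (intro continuous_intros) auto
qed

lemma power_diff_le:
  fixes s t :: real
  assumes "0 \<le> s" "s \<le> t"
  shows "t ^ n - s ^ n \<le> n * t ^ (n - 1) * (t - s)"
proof (induction n)
  case (Suc n)
  have "t ^ Suc n - s ^ Suc n = t * (t ^ n - s ^ n) + s ^ n * (t - s)"
    by (simp add: algebra_simps)
  also have "\<dots> \<le> t * (n * t ^ (n - 1) * (t - s)) + t ^ n * (t - s)"
    using assms Suc by (intro add_mono mult_left_mono mult_right_mono power_mono) auto
  also have "\<dots> = Suc n * t ^ (Suc n - 1) * (t - s)"
    by (cases n) (simp_all add: algebra_simps)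
  finally show ?case .
qed simp

lemma root_diff_le:
  assumes "0 < n" "0 \<le> b" "b \<le> a"
  shows "root n a - root n b \<le> root n (a - b)"
proof -
  have super: "x ^ k + y ^ k \<le> (x + y) ^ k" if "0 < k" "0 \<le> x" "0 \<le> y" for x y :: real and k
    using that(1)
  proof (induction k rule: nat_induct_non_zero)
    case (Suc k)
    have "x ^ Suc k + y ^ Suc k \<le> (x + y) * (x ^ k + y ^ k)"
      using that by (simp add: algebra_simps)
    also have "\<dots> \<le> (x + y) * (x + y) ^ k" using Suc that by (intro mult_left_mono) auto
    finally show ?case by simp
  qed simp
  have "a \<le> (root n b + root n (a - b)) ^ n"
    using super[of n "root n b" "root n (a - b)"] assms by (simp add: real_root_pow_pos2)
  then have "root n a \<le> root n ((root n b + root n (a - b)) ^ n)" using assms by simp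
  also have "\<dots> = root n b + root n (a - b)" using assms by (intro real_root_power_cancel) auto
  finally show ?thesis by simp
qed

lemma abs_root_diff_le:
  assumes "0 < n" "0 \<le> a" "0 \<le> b" "\<bar>a - b\<bar> \<le> d"
  shows "\<bar>root n a - root n b\<bar> \<le> root n d"
proof -
  have "\<bar>root n a - root n b\<bar> \<le> root n \<bar>a - b\<bar>"
    using root_diff_le[OF assms(1), of a b] root_diff_le[OF assms(1), of b a] assms
    by (cases "a \<le> b") (auto simp: abs_real_def)
  also have "\<dots> \<le> root n d" using assms by simp
  finally show ?thesis .
qed

context
  fixes h :: "'a::euclidean_space \<Rightarrow> real" and C :: real
  assumes h: "integrable lborel h" and h_nonneg: "\<And>x. 0 \<le> h x"
    and D: "2 \<le> DIM('a)" and h_le: "AE x in lborel. h x \<le> C"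
begin

lemma bound_nonneg: "0 \<le> C"
proof (rule ccontr)
  assume "\<not> 0 \<le> C"
  from h_le have "AE x::'a in lborel. False"
  proof eventually_elim
    case (elim x)
    then show ?case using h_nonneg[of x] \<open>\<not> 0 \<le> C\<close> by linarith
  qed
  then show False by (simp add: AE_iff_null emeasure_lborel_UNIV null_sets_def)
qed

lemma ball_mass_diff_le:
  assumes "0 \<le> s" "s \<le> t"
  shows "ball_mass h t - ball_mass h s \<le> C * (unit_ball_vol DIM('a) * (t ^ DIM('a) - s ^ DIM('a)))"
proof -
  have int: "integrable lborel (\<lambda>x::'a. indicator (cball 0 r) x :: real)" for r
    using emeasure_lborel_cball_finite[of "0::'a" r] by (simp add: integrable_indicator_iff)
  have "ball_mass h t - ball_mass h s = (LBINT x. indicator (cball 0 t) x * h x - indicator (cball 0 s) x * h x)"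
    unfolding ball_mass_def by (rule Bochner_Integration.integral_diff[symmetric]; rule integrable_ball_mass[OF h h_nonneg])
  also have "\<dots> \<le> (LBINT x. C * (indicator (cball 0 t) (x::'a) - indicator (cball 0 s) x))"
  proof (rule integral_mono_AE)
    show "AE x in lborel. indicator (cball 0 t) x * h x - indicator (cball 0 s) x * h x
        \<le> C * (indicator (cball 0 t) (x::'a) - indicator (cball 0 s) x)"
      using h_le by eventually_elim (use assms in \<open>auto simp: indicator_def\<close>)
  qed (auto intro!: Bochner_Integration.integrable_diff integrable_ball_mass h h_nonneg integrable_mult_right int)
  also have "\<dots> = C * (unit_ball_vol DIM('a) * (t ^ DIM('a) - s ^ DIM('a)))"
    using assms int by (simp add: content_cball right_diff_distrib)
  finally show ?thesis .
qed

lemma ball_mass_le: "0 \<le> t \<Longrightarrow> ball_mass h t \<le> C * (unit_ball_vol DIM('a) * t ^ DIM('a))"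
proof -
  assume "0 \<le> t"
  have "ball_mass h 0 = (\<integral>x. 0 \<partial>(lborel::'a measure))"
    unfolding ball_mass_def
  proof (rule integral_cong_AE)
    show "AE x::'a in lborel. indicator (cball 0 0) x * h x = 0"
      using AE_lborel_singleton[of 0] by eventually_elim simp
  qed (use borel_measurable_integrable[OF h] in auto)
  then show ?thesis using ball_mass_diff_le[of 0 t] \<open>0 \<le> t\<close> D by (simp add: power_0_left)
qed

lemma flux_density_0: "flux_density h 0 = 0"
  using D by (simp add: flux_density_def)

lemma flux_density_le: "0 \<le> s \<Longrightarrow> flux_density h s \<le> C * s"
proof (cases "s = 0")
  case False
  assume "0 \<le> s"
  with False have s: "0 < s" by simp
  let ?n = "DIM('a)" and ?V = "unit_ball_vol DIM('a)"
  have V: "0 < ?V" by simp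
  have "flux_density h s \<le> C * (?V * s ^ ?n) / (?n * ?V * s ^ (?n - 1))"
    unfolding flux_density_def using ball_mass_le[of s] s V
    by (intro divide_right_mono) auto
  also have "\<dots> = C * s / ?n"
  proof -
    have "s ^ ?n = s * s ^ (?n - 1)" using D by (simp flip: power_Suc)
    moreover have "?V \<noteq> 0" using V by linarith
    ultimately show ?thesis using s by simp
  qed
  also have "\<dots> \<le> C * s / 1"
    using bound_nonneg s D by (intro divide_left_mono) auto
  finally show ?thesis by simp
qed (simp add: flux_density_0)

lemma flux_density_lipschitz:
  assumes "0 \<le> s" "s \<le> t"
  shows "\<bar>flux_density h t - flux_density h s\<bar> \<le> C * (t - s)"
proof (cases "s = 0")
  case True
  then show ?thesis
    using flux_density_le[of t] flux_density_nonneg[OF h h_nonneg, of t] assms by (simp add: flux_density_0)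
next
  case False
  with assms have s: "0 < s" "0 < t" by auto
  let ?n = "DIM('a)" and ?V = "unit_ball_vol DIM('a)"
  define m where "m = ?n - 1"
  have n: "?n = Suc m" "0 < m" using D by (auto simp: m_def)
  have V: "0 < ?V" by simp
  have V0: "?V \<noteq> 0" using V by linarith
  define k where "k = ?n * ?V"
  have k: "0 < k" using sphere_const_pos[where 'a='a] by (simp add: k_def)
  note bm = ball_mass_nonneg[OF h h_nonneg]
  have q: "flux_density h r = ball_mass h r / (k * r ^ m)" for r by (simp add: flux_density_def k_def m_def)
  have "flux_density h t - flux_density h s \<le> ball_mass h t / (k * t ^ m) - ball_mass h s / (k * t ^ m)"
    unfolding q using assms s k bm by (intro diff_mono divide_left_mono mult_left_mono power_mono mult_pos_pos) auto
  also have "\<dots> \<le> C * (?V * (t ^ ?n - s ^ ?n)) / (k * t ^ m)"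
    unfolding diff_divide_distrib[symmetric] using ball_mass_diff_le[OF assms] k s
    by (intro divide_right_mono) auto
  also have "\<dots> \<le> C * (?V * (?n * t ^ (?n - 1) * (t - s))) / (k * t ^ m)"
    using power_diff_le[OF assms, of ?n] V bound_nonneg k s
    by (intro divide_right_mono mult_left_mono) auto
  also have "\<dots> = C * (t - s)"
    using s V0 n by (simp add: k_def)
  finally have up: "flux_density h t - flux_density h s \<le> C * (t - s)" .
  have "flux_density h s - flux_density h t \<le> ball_mass h s / (k * s ^ m) - ball_mass h s / (k * t ^ m)"
    unfolding q using ball_mass_mono[OF h h_nonneg assms(2)] k s by (intro diff_mono divide_right_mono) auto
  also have "\<dots> = ball_mass h s * ((t ^ m - s ^ m) / (k * s ^ m * t ^ m))"
    using s k by (simp add: field_simps)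
  also have "\<dots> \<le> (C * (?V * s ^ ?n)) * ((t ^ m - s ^ m) / (k * s ^ m * t ^ m))"
    using ball_mass_le[of s] s k assms by (intro mult_right_mono divide_nonneg_nonneg) (auto intro: power_mono)
  also have "\<dots> = C / ?n * (s / t * ((t ^ m - s ^ m) / t ^ (m - 1)))"
  proof -
    have "t ^ m = t * t ^ (m - 1)" using n by (simp flip: power_Suc)
    then show ?thesis using s V0 by (simp add: k_def n(1))
  qed
  also have "\<dots> \<le> C / ?n * (1 * (m * (t - s)))"
  proof (intro mult_left_mono mult_mono)
    show "(t ^ m - s ^ m) / t ^ (m - 1) \<le> m * (t - s)"
      using power_diff_le[OF assms, of m] s by (simp add: pos_divide_le_eq mult_ac)
    show "0 \<le> (t ^ m - s ^ m) / t ^ (m - 1)" using s assms by (auto intro!: divide_nonneg_nonneg power_mono)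
  qed (use assms s bound_nonneg in auto)
  also have "\<dots> = C * (t - s) * (m / ?n)" by simp
  also have "\<dots> \<le> C * (t - s) * 1"
    using bound_nonneg assms n by (intro mult_left_mono) auto
  finally show ?thesis using up by simp
qed

lemma slope_0: "slope h 0 = 0"
  by (simp add: slope_def flux_density_0)

lemma slope_hoelder:
  assumes "0 \<le> s" "0 \<le> t" "\<bar>s - t\<bar> \<le> d"
  shows "\<bar>slope h s - slope h t\<bar> \<le> root (DIM('a) - 1) (C * d)"
  unfolding slope_def
proof (rule abs_root_diff_le)
  have "\<bar>flux_density h s - flux_density h t\<bar> \<le> C * \<bar>s - t\<bar>"
    using flux_density_lipschitz[of s t] flux_density_lipschitz[of t s] assms
    by (cases "s \<le> t") (auto simp: abs_minus_commute)
  also have "\<dots> \<le> C * d" using assms bound_nonneg by (intro mult_left_mono)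
  finally show "\<bar>flux_density h s - flux_density h t\<bar> \<le> C * d" .
qed (use assms D flux_density_nonneg[OF h h_nonneg] in auto)

lemma slope_le: "0 \<le> s \<Longrightarrow> slope h s \<le> root (DIM('a) - 1) (C * s)"
  using slope_hoelder[of s 0 s] by (simp add: slope_0)

lemma root_C_tendsto_0: "((\<lambda>x. root (DIM('a) - 1) (C * norm x)) \<longlongrightarrow> 0) (at (0::'b::real_normed_vector))"
proof -
  have "((\<lambda>x::'b. root (DIM('a) - 1) (C * norm x)) \<longlongrightarrow> root (DIM('a) - 1) (C * norm (0::'b))) (at 0)"
    by (intro tendsto_intros)
  then show ?thesis by simp
qed

lemma continuous_on_slope_0: "continuous_on {0..} (slope h)"
  unfolding continuous_on_def
proof
  fix s :: real assume s: "s \<in> {0..}"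
  have "((\<lambda>t. slope h t - slope h s) \<longlongrightarrow> 0) (at s within {0..})"
  proof (rule Lim_null_comparison)
    show "\<forall>\<^sub>F t in at s within {0..}. norm (slope h t - slope h s) \<le> root (DIM('a) - 1) (C * \<bar>t - s\<bar>)"
      unfolding eventually_at_filter using s slope_hoelder by (intro always_eventually) auto
    have "((\<lambda>t. root (DIM('a) - 1) (C * \<bar>t - s\<bar>)) \<longlongrightarrow> root (DIM('a) - 1) (C * \<bar>s - s\<bar>)) (at s within {0..})"
      by (intro tendsto_intros)
    then show "((\<lambda>t. root (DIM('a) - 1) (C * \<bar>t - s\<bar>)) \<longlongrightarrow> 0) (at s within {0..})" by simp
  qed
  then show "(slope h \<longlongrightarrow> slope h s) (at s within {0..})" by (simp add: LIM_zero_iff)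
qed

definition profile :: "real \<Rightarrow> real" where
  "profile r = - integral {0..r} (slope h)"

lemma profile_has_derivative:
  assumes "0 < r" shows "(profile has_real_derivative - slope h r) (at r)"
proof -
  have "((\<lambda>r. integral {0..r} (slope h)) has_real_derivative slope h r) (at r within {0..r + 1})"
    by (intro integral_has_real_derivative continuous_on_subset[OF continuous_on_slope_0]) (use assms in auto)
  then show ?thesis
    unfolding profile_def using assms by (intro DERIV_minus) (simp add: at_within_Icc_at)
qed

lemma abs_profile_le:
  assumes "0 \<le> r" shows "\<bar>profile r\<bar> \<le> root (DIM('a) - 1) (C * r) * r"
proof -
  have "norm (integral {0..r} (slope h)) \<le> root (DIM('a) - 1) (C * r) * (r - 0)"
  proof (rule integral_bound[OF assms])
    show "continuous_on {0..r} (slope h)" by (rule continuous_on_subset[OF continuous_on_slope_0]) auto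
    fix t assume t: "t \<in> {0..r}"
    then have "slope h t \<le> root (DIM('a) - 1) (C * t)" by (intro slope_le) auto
    also have "\<dots> \<le> root (DIM('a) - 1) (C * r)" using t D bound_nonneg by (simp add: mult_left_mono)
    finally show "norm (slope h t) \<le> root (DIM('a) - 1) (C * r)"
      using slope_nonneg[OF h h_nonneg, of t] t by simp
  qed
  then show ?thesis by (simp add: profile_def)
qed

definition radial_gradient :: "'a \<Rightarrow> 'a" where
  "radial_gradient x = - (slope h (norm x) *\<^sub>R sgn x)"

lemma GDERIV_profile: "GDERIV (\<lambda>x. profile (norm x) + c) x :> radial_gradient x"
proof (cases "x = 0")
  case False
  then have "GDERIV (\<lambda>x. profile (norm x)) x :> - slope h (norm x) *\<^sub>R sgn x"
    by (intro GDERIV_DERIV_compose[OF GDERIV_norm profile_has_derivative]) auto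
  from GDERIV_add[OF this GDERIV_const[of c]] show ?thesis by (simp add: radial_gradient_def)
next
  case True
  have "((\<lambda>x::'a. profile (norm x) + c) has_derivative (\<lambda>h. 0)) (at 0)"
    unfolding has_derivative_iff_norm
  proof
    show "((\<lambda>y::'a. norm (profile (norm y) + c - (profile (norm (0::'a)) + c) - 0) / norm (y - 0)) \<longlongrightarrow> 0) (at 0)"
    proof (rule Lim_null_comparison[OF _ root_C_tendsto_0])
      show "\<forall>\<^sub>F y::'a in at 0. norm (norm (profile (norm y) + c - (profile (norm (0::'a)) + c) - 0) / norm (y - 0)) \<le> root (DIM('a) - 1) (C * norm y)"
        unfolding eventually_at_filter
      proof (intro always_eventually allI impI)
        fix y :: 'a assume "y \<noteq> 0"
        moreover have "profile 0 = 0" using abs_profile_le[of 0] by simp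
        ultimately show "norm (norm (profile (norm y) + c - (profile (norm (0::'a)) + c) - 0) / norm (y - 0)) \<le> root (DIM('a) - 1) (C * norm y)"
          using abs_profile_le[of "norm y"] by (simp add: pos_divide_le_eq)
      qed
    qed
  qed simp
  then show ?thesis using True by (simp add: gderiv_def radial_gradient_def)
qed

lemma norm_radial_gradient_diff_le:
  "norm (radial_gradient x - radial_gradient y) \<le> 3 * root (DIM('a) - 1) (C * norm (x - y))"
proof -
  let ?m = "DIM('a) - 1"
  have m: "0 < ?m" using D by simp
  have *: "norm (radial_gradient x - radial_gradient y) \<le> 3 * root ?m (C * norm (x - y))" if xy: "norm y \<le> norm x" for x y
  proof (cases "x = 0")
    case True
    then show ?thesis using xy bound_nonneg by simp
  next
    case False
    define d where "d = norm (x - y)"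
    have d: "0 \<le> d" by (simp add: d_def)
    have "radial_gradient x - radial_gradient y =
        - ((slope h (norm x) - slope h (norm y)) *\<^sub>R sgn x + slope h (norm y) *\<^sub>R (sgn x - sgn y))"
      by (simp add: radial_gradient_def algebra_simps)
    then have "norm (radial_gradient x - radial_gradient y) \<le>
        norm ((slope h (norm x) - slope h (norm y)) *\<^sub>R sgn x) + norm (slope h (norm y) *\<^sub>R (sgn x - sgn y))"
      by (metis norm_minus_cancel norm_triangle_ineq)
    also have "norm ((slope h (norm x) - slope h (norm y)) *\<^sub>R sgn x) = \<bar>slope h (norm x) - slope h (norm y)\<bar>"
      using False by (simp add: norm_sgn)
    also have "\<dots> \<le> root ?m (C * d)"
      using norm_triangle_ineq3[of x y] by (intro slope_hoelder) (auto simp: d_def)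
    also have "norm (slope h (norm y) *\<^sub>R (sgn x - sgn y)) = slope h (norm y) * norm (sgn x - sgn y)"
      using slope_nonneg[OF h h_nonneg, of "norm y"] by simp
    also have "\<dots> \<le> 2 * root ?m (C * d)"
    proof (cases "norm y \<le> d")
      case True
      have "slope h (norm y) \<le> root ?m (C * norm y)" by (intro slope_le) simp
      also have "\<dots> \<le> root ?m (C * d)" using True m bound_nonneg by (simp add: mult_left_mono)
      finally have "slope h (norm y) * norm (sgn x - sgn y) \<le> root ?m (C * d) * 2"
        using norm_triangle_ineq4[of "sgn x" "sgn y"] bound_nonneg d m
        by (intro mult_mono) (auto simp: norm_sgn split: if_splits)
      then show ?thesis by simp
    next
      case False
      then have y: "0 < norm y" "d < norm y" using d by auto
      have "sgn x - sgn y = (1 / norm y) *\<^sub>R (x - y) + (1 / norm x - 1 / norm y) *\<^sub>R x"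
        by (simp add: sgn_div_norm algebra_simps divide_inverse)
      then have "norm (sgn x - sgn y) \<le> norm ((1 / norm y) *\<^sub>R (x - y)) + norm ((1 / norm x - 1 / norm y) *\<^sub>R x)"
        by (metis norm_triangle_ineq)
      also have "norm ((1 / norm y) *\<^sub>R (x - y)) = d / norm y" by (simp add: d_def)
      also have "norm ((1 / norm x - 1 / norm y) *\<^sub>R x) = \<bar>1 / norm x - 1 / norm y\<bar> * norm x" by simp
      also have "\<bar>1 / norm x - 1 / norm y\<bar> = 1 / norm y - 1 / norm x"
        using xy y by (simp add: frac_le)
      also have "(1 / norm y - 1 / norm x) * norm x = (norm x - norm y) / norm y"
        using \<open>x \<noteq> 0\<close> y by (simp add: field_simps)
      also have "(norm x - norm y) / norm y \<le> d / norm y"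
        using norm_triangle_ineq2[of x y] y by (intro divide_right_mono) (auto simp: d_def)
      finally have sg: "norm (sgn x - sgn y) \<le> 2 * (d / norm y)" by simp
      have r01: "0 \<le> d / norm y" "d / norm y \<le> 1" using d y by auto
      have "d / norm y = root ?m (d / norm y) ^ ?m" using m r01 by simp
      also have "\<dots> \<le> root ?m (d / norm y) ^ 1"
        using m r01 by (intro power_decreasing) auto
      finally have "d / norm y \<le> root ?m (d / norm y)" by simp
      with sg have "norm (sgn x - sgn y) \<le> 2 * root ?m (d / norm y)" by linarith
      then have "slope h (norm y) * norm (sgn x - sgn y) \<le> root ?m (C * norm y) * (2 * root ?m (d / norm y))"
        using slope_le[of "norm y"] bound_nonneg m by (intro mult_mono) auto
      also have "\<dots> = 2 * root ?m ((C * norm y) * (d / norm y))" by (simp add: real_root_mult[symmetric])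
      also have "(C * norm y) * (d / norm y) = C * d" using y by simp
      finally show ?thesis .
    qed
    finally show ?thesis by (simp add: d_def)
  qed
  show ?thesis
    using *[of y x] *[of x y] by (cases "norm y \<le> norm x") (auto simp: norm_minus_commute)
qed

lemma profile_locally_C1_Hoelder:
  assumes "0 < R"
  shows "locally_C1_Hoelder (1 / DIM('a)) (ball 0 R) (\<lambda>x::'a. profile (norm x) + c)"
  unfolding locally_C1_Hoelder_def locally_Hoelder_def
proof (intro exI[of _ radial_gradient] conjI ballI allI impI)
  show "GDERIV (\<lambda>x. profile (norm x) + c) x :> radial_gradient x" for x by (rule GDERIV_profile)
  let ?m = "DIM('a) - 1" and ?\<theta> = "1 / real DIM('a)"
  define E where "E = 1 / real ?m - ?\<theta>"
  have m: "0 < ?m" using D by simp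
  have "?\<theta> \<le> 1 / real ?m" using m by (intro divide_left_mono) auto
  then have E: "0 \<le> E" by (simp add: E_def)
  define L where "L = 3 * (root ?m C * (2 * R) powr E)"
  fix K :: "'a set" assume K: "compact K \<and> K \<subseteq> ball 0 R"
  show "\<exists>L. \<forall>x\<in>K. \<forall>y\<in>K. dist (radial_gradient x) (radial_gradient y) \<le> L * dist x y powr ?\<theta>"
  proof (intro exI[of _ L] ballI)
    fix x y assume "x \<in> K" "y \<in> K"
    with K have "norm x < R" "norm y < R" by auto
    then have d: "norm (x - y) \<le> 2 * R" using norm_triangle_ineq4[of x y] by linarith
    have "root ?m (norm (x - y)) = norm (x - y) powr (?\<theta> + E)"
    proof (cases "x = y")
      case False
      then show ?thesis using m by (simp add: root_powr_inverse E_def)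
    qed simp
    also have "\<dots> = norm (x - y) powr ?\<theta> * norm (x - y) powr E" by (rule powr_add)
    also have "\<dots> \<le> norm (x - y) powr ?\<theta> * (2 * R) powr E"
      using d E by (intro mult_left_mono powr_mono2) auto
    finally have "root ?m C * root ?m (norm (x - y)) \<le> root ?m C * (norm (x - y) powr ?\<theta> * (2 * R) powr E)"
      using bound_nonneg m by (intro mult_left_mono) auto
    then have "3 * root ?m (C * norm (x - y)) \<le> L * norm (x - y) powr ?\<theta>"
      by (simp add: L_def real_root_mult mult_ac)
    then show "dist (radial_gradient x) (radial_gradient y) \<le> L * dist x y powr ?\<theta>"
      using norm_radial_gradient_diff_le[of x y] by (simp add: dist_norm)
  qed
qed

end

subsection \<open>Radial solutions\<close>

context
  fixes R :: real and u :: "real ^ 'n::finite \<Rightarrow> real" and g :: "real ^ 'n \<Rightarrow> real ^ 'n"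
    and h :: "real ^ 'n \<Rightarrow> real" and w :: "real \<Rightarrow> real"
  assumes R: "0 < R" and N: "2 \<le> CARD('n)"
    and g_meas [measurable]: "g \<in> borel_measurable borel"
    and h: "integrable lborel h" and h_nonneg: "\<And>x. 0 \<le> h x"
    and u_int: "\<And>r. r < R \<Longrightarrow> integrable lborel (\<lambda>x. indicator (ball 0 r) x *\<^sub>R u x)"
    and g_int: "\<And>r. r < R \<Longrightarrow> integrable lborel (\<lambda>x. indicator (ball 0 r) x *\<^sub>R g x)"
    and g_pow: "\<And>r. r < R \<Longrightarrow> integrable lborel (\<lambda>x. indicator (ball 0 r) x *\<^sub>R norm (g x) ^ (CARD('n) - 1))"
    and radial: "AE x in lborel. x \<noteq> 0 \<and> norm x < R \<longrightarrow> u x = w (norm x)"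
    and weak: "\<And>x \<epsilon> r. 0 < \<epsilon> \<Longrightarrow> norm x + \<epsilon> < r \<Longrightarrow> r < R \<Longrightarrow>
      (LBINT y. kern \<epsilon> (x - y) *\<^sub>R (indicator (ball 0 r) y *\<^sub>R g y)) =
      - (LBINT y. (indicator (ball 0 r) y *\<^sub>R u y) *\<^sub>R dkern \<epsilon> (x - y))"
    and flux: "\<And>a \<epsilon>. 0 < \<epsilon> \<Longrightarrow> \<epsilon> \<le> a \<Longrightarrow> a + \<epsilon> < R\<^sup>2 \<Longrightarrow>
      (LBINT x. (norm (g x) ^ (CARD('n) - 2) *\<^sub>R g x) \<bullet> ((- 2 * kern \<epsilon> ((norm x)\<^sup>2 - a)) *\<^sub>R x)) =
      (LBINT x. h x * tail_kern \<epsilon> a ((norm x)\<^sup>2))"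
begin

lemma radial_cutoff:
  "AE x in lborel. indicator (ball 0 r) x *\<^sub>R u x = (if norm x < r then w (norm x) else 0)" if "r < R"
  using radial AE_lborel_singleton[of 0] by eventually_elim (use that in auto)

lemma gradient_eq_slope:
  assumes r: "0 < r" "r < R"
  shows "AE x in lborel. x \<noteq> 0 \<and> norm x < r \<longrightarrow>
    indicator (ball 0 r) x *\<^sub>R g x = ((- slope h (norm x)) / norm x) *\<^sub>R x"
proof -
  let ?n = "CARD('n)"
  obtain \<gamma> where [measurable]: "\<gamma> \<in> borel_measurable borel"
    and \<gamma>: "AE x in lborel. norm x < r \<longrightarrow> indicator (ball 0 r) x *\<^sub>R g x = (\<gamma> (norm x) / norm x) *\<^sub>R x"
    by (rule radial_weak_gradient[OF radial_cutoff[OF r(2)] u_int[OF r(2)] g_int[OF r(2)]])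
      (use weak[OF _ _ r(2)] that in auto)
  define \<sigma> where "\<sigma> t = \<bar>\<gamma> t\<bar> ^ (?n - 2) * \<gamma> t" for t
  have [measurable]: "\<sigma> \<in> borel_measurable borel" unfolding \<sigma>_def by measurable
  have \<sigma>_meas: "(\<lambda>x::real^'n. \<sigma> (norm x) * norm x) \<in> borel_measurable lborel"
    by measurable
  have abs_\<sigma>: "\<bar>\<sigma> t\<bar> = \<bar>\<gamma> t\<bar> ^ (?n - 1)" for t
  proof -
    have "?n - 1 = Suc (?n - 2)" using N by simp
    then show ?thesis by (simp add: \<sigma>_def abs_mult power_abs)
  qed
  have g: "AE x in lborel. x \<noteq> 0 \<and> norm x < r \<longrightarrow> g x = (\<gamma> (norm x) / norm x) *\<^sub>R x \<and> norm (g x) = \<bar>\<gamma> (norm x)\<bar>"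
    using \<gamma>
  proof eventually_elim
    case (elim x)
    show ?case
    proof
      assume x: "x \<noteq> 0 \<and> norm x < r"
      then have "g x = (\<gamma> (norm x) / norm x) *\<^sub>R x" using elim by simp
      then show "g x = (\<gamma> (norm x) / norm x) *\<^sub>R x \<and> norm (g x) = \<bar>\<gamma> (norm x)\<bar>" using x by simp
    qed
  qed
  have "AE x::real^'n in lborel. x \<noteq> 0 \<and> norm x < r \<longrightarrow>
    DIM(real^'n) * unit_ball_vol DIM(real^'n) * norm x ^ (DIM(real^'n) - 1) * \<sigma> (norm x) = - ball_mass h (norm x)"
  proof (rule radial_flux[OF h])
    show "integrable lborel (\<lambda>x::real^'n. indicator (ball 0 r) x * (\<sigma> (norm x) * norm x))"
    proof (rule Bochner_Integration.integrable_bound)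
      show "integrable lborel (\<lambda>x::real^'n. r * (indicator (ball 0 r) x *\<^sub>R norm (g x) ^ (?n - 1)))"
        using g_pow[OF r(2)] by (rule integrable_mult_right)
      show "AE x::real^'n in lborel. norm (indicator (ball 0 r) x * (\<sigma> (norm x) * norm x)) \<le> norm (r * (indicator (ball 0 r) x *\<^sub>R norm (g x) ^ (?n - 1)))"
        using g AE_lborel_singleton[of 0]
      proof eventually_elim
        case (elim x)
        show ?case
        proof (cases "norm x < r")
          case True
          then have "\<bar>\<sigma> (norm x)\<bar> * norm x \<le> \<bar>\<sigma> (norm x)\<bar> * r" by (intro mult_left_mono) auto
          then show ?thesis using True elim r by (simp add: abs_mult abs_\<sigma> mult.commute)
        qed simp
      qed
    qed (intro borel_measurable_times[OF borel_measurable_indicator \<sigma>_meas], simp)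
    fix a \<epsilon> :: real assume e: "0 < \<epsilon>" "\<epsilon> \<le> a" "a + \<epsilon> < r\<^sup>2"
    have "r\<^sup>2 < R\<^sup>2" using r by (intro power_strict_mono) auto
    then have "a + \<epsilon> < R\<^sup>2" using e by linarith
    have "(LBINT x. indicator (ball 0 r) (x::real^'n) * (\<sigma> (norm x) * norm x) * (2 * kern \<epsilon> ((norm x)\<^sup>2 - a))) =
       (LBINT x. - ((norm (g x) ^ (?n - 2) *\<^sub>R g x) \<bullet> ((- 2 * kern \<epsilon> ((norm x)\<^sup>2 - a)) *\<^sub>R x)))"
    proof (rule integral_cong_AE)
      show "AE x::real^'n in lborel. indicator (ball 0 r) x * (\<sigma> (norm x) * norm x) * (2 * kern \<epsilon> ((norm x)\<^sup>2 - a)) =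
        - ((norm (g x) ^ (?n - 2) *\<^sub>R g x) \<bullet> ((- 2 * kern \<epsilon> ((norm x)\<^sup>2 - a)) *\<^sub>R x))"
        using g AE_lborel_singleton[of 0]
      proof eventually_elim
        case (elim x)
        show ?case
        proof (cases "norm x < r")
          case True
          then have gx: "g x = (\<gamma> (norm x) / norm x) *\<^sub>R x" "norm (g x) = \<bar>\<gamma> (norm x)\<bar>" using elim by auto
          have "g x \<bullet> x = \<gamma> (norm x) * norm x"
            unfolding gx(1) using elim by (simp add: power2_norm_eq_inner[symmetric] power2_eq_square)
          then show ?thesis using True by (simp add: gx(2) \<sigma>_def mult_ac)
        next
          case False
          then have "r\<^sup>2 \<le> (norm x)\<^sup>2" using r by (intro power_mono) auto
          then have "\<epsilon> \<le> norm ((norm x)\<^sup>2 - a)" using e by simp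
          then have "kern \<epsilon> ((norm x)\<^sup>2 - a) = 0" by (rule kern_eq_0[OF e(1)])
          then show ?thesis by simp
        qed
      qed
    next
      have "(\<lambda>x::real^'n. indicat_real (ball 0 r) x) \<in> borel_measurable lborel"
        by (intro borel_measurable_indicator) simp
      moreover have "(\<lambda>x::real^'n. 2 * kern \<epsilon> ((norm x)\<^sup>2 - a)) \<in> borel_measurable lborel"
        by measurable
      ultimately show "(\<lambda>x::real^'n. indicator (ball 0 r) x * (\<sigma> (norm x) * norm x) * (2 * kern \<epsilon> ((norm x)\<^sup>2 - a)))
          \<in> borel_measurable lborel"
        by (rule borel_measurable_times[OF borel_measurable_times[OF _ \<sigma>_meas]])
    qed measurable
    then show "(LBINT x. indicator (ball 0 r) (x::real^'n) * (\<sigma> (norm x) * norm x) * (2 * kern \<epsilon> ((norm x)\<^sup>2 - a))) =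
       - (LBINT x. h x * tail_kern \<epsilon> a ((norm x)\<^sup>2))"
      using flux[OF e(1,2) \<open>a + \<epsilon> < R\<^sup>2\<close>] by simp
  qed (use r in simp_all)
  then show ?thesis
    using \<gamma>
  proof eventually_elim
    case (elim x)
    show ?case
    proof
      assume x: "x \<noteq> 0 \<and> norm x < r"
      define k where "k = real ?n * unit_ball_vol ?n * norm x ^ (?n - 1)"
      have k: "0 < k" using x sphere_const_pos[where 'a="real^'n"] by (simp add: k_def)
      have n: "0 < ?n - 1" using N by simp
      have q: "flux_density h (norm x) = ball_mass h (norm x) / k" by (simp add: flux_density_def k_def)
      have "k * \<sigma> (norm x) = - ball_mass h (norm x)" using elim x by (simp add: k_def)
      then have \<sigma>q: "\<sigma> (norm x) = - flux_density h (norm x)" using k by (simp add: q field_simps)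
      have q0: "0 \<le> flux_density h (norm x)" by (rule flux_density_nonneg[OF h h_nonneg]) simp
      have "\<gamma> (norm x) \<le> 0"
      proof (rule ccontr)
        assume "\<not> \<gamma> (norm x) \<le> 0"
        then have "0 < \<sigma> (norm x)" by (simp add: \<sigma>_def)
        with \<sigma>q q0 show False by linarith
      qed
      moreover have "\<bar>\<gamma> (norm x)\<bar> = slope h (norm x)"
        using abs_\<sigma>[of "norm x"] q0 n unfolding \<sigma>q slope_def
        by (simp add: real_root_pos_unique[symmetric])
      ultimately have "\<gamma> (norm x) = - slope h (norm x)" by linarith
      then show "indicator (ball 0 r) x *\<^sub>R g x = ((- slope h (norm x)) / norm x) *\<^sub>R x"
        using elim x by simp
    qed
  qed
qed

lemma u_eq_primitive:
  assumes r: "0 < r" "r < R"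
    and W: "\<And>s. 0 < s \<Longrightarrow> s < r \<Longrightarrow> (W has_real_derivative - slope h s) (at s)"
  shows "\<exists>c. AE x in lborel. x \<noteq> 0 \<and> norm x < r \<longrightarrow> u x = W (norm x) + c"
proof -
  have "\<exists>c. AE x in lborel. x \<noteq> 0 \<and> norm x < r \<longrightarrow> indicator (ball 0 r) x *\<^sub>R u x = W (norm x) + c"
  proof (rule radial_primitive[OF radial_cutoff[OF r(2)] u_int[OF r(2)] g_int[OF r(2)] _ gradient_eq_slope[OF r] _ W r(1)])
    show "continuous_on {0<..<r} (\<lambda>s. - slope h s)"
      by (intro continuous_on_minus continuous_on_subset[OF continuous_on_slope[OF h]]) auto
  qed (use weak[OF _ _ r(2)] in auto)
  then obtain c where "AE x in lborel. x \<noteq> 0 \<and> norm x < r \<longrightarrow> indicator (ball 0 r) x *\<^sub>R u x = W (norm x) + c" ..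
  then have "AE x in lborel. x \<noteq> 0 \<and> norm x < r \<longrightarrow> u x = W (norm x) + c"
    by eventually_elim auto
  then show ?thesis ..
qed

lemma rhs_bounded:
  assumes "0 < \<beta>" "0 \<le> M" and growth: "AE x in lborel. norm x < R \<longrightarrow> h x \<le> M * exp (\<beta> * u x)"
    and away: "\<And>a. 0 < a \<Longrightarrow> \<exists>C. AE x in lborel. a \<le> norm x \<longrightarrow> h x \<le> C"
  shows "\<exists>C. AE x in lborel. h x \<le> C"
proof -
  define r where "r = R / 2"
  have r: "0 < r" "r < R" using R by (auto simp: r_def)
  define W where "W s = integral {s..r} (slope h)" for s
  have W: "(W has_real_derivative - slope h s) (at s)" if s: "0 < s" "s < r" for s
  proof -
    have "(W has_real_derivative - slope h s) (at s within {s / 2..r})"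
      unfolding W_def
      by (rule integral_has_real_derivative'[OF continuous_on_subset[OF continuous_on_slope[OF h]]]) (use s in auto)
    then show ?thesis using s by (simp add: at_within_Icc_at)
  qed
  from u_eq_primitive[OF r W] obtain c where c: "AE x in lborel. x \<noteq> 0 \<and> norm x < r \<longrightarrow> u x = W (norm x) + c" by blast
  have "AE x in lborel. x \<noteq> 0 \<and> norm x < r \<longrightarrow> h x \<le> M * exp (\<beta> * c) * exp (\<beta> * W (norm x))"
    using c growth
  proof eventually_elim
    case (elim x)
    show ?case
    proof
      assume x: "x \<noteq> 0 \<and> norm x < r"
      then have "h x \<le> M * exp (\<beta> * (W (norm x) + c))" using elim r by simp
      then show "h x \<le> M * exp (\<beta> * c) * exp (\<beta> * W (norm x))" by (simp add: exp_add algebra_simps)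
    qed
  qed
  moreover have "0 \<le> M * exp (\<beta> * c)" using \<open>0 \<le> M\<close> by simp
  moreover have "2 \<le> DIM(real^'n)" using N by simp
  ultimately obtain a C1 where a: "0 < a" and C1: "AE x in lborel. x \<noteq> 0 \<and> norm x \<le> a \<longrightarrow> h x \<le> C1"
    using bounded_near_0[OF h h_nonneg _ r(1) \<open>0 < \<beta>\<close> _ W] by blast
  obtain C2 where C2: "AE x in lborel. a \<le> norm x \<longrightarrow> h x \<le> C2" using away[OF a] by blast
  have "AE x in lborel. h x \<le> max C1 C2"
    using C1 C2 AE_lborel_singleton[of 0]
  proof eventually_elim
    case (elim x)
    then show ?case by (cases "norm x \<le> a") auto
  qed
  then show ?thesis ..
qed

lemma u_eq_profile:
  assumes C: "AE x in lborel. h x \<le> C"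
  shows "\<exists>c. AE x in lborel. norm x < R \<longrightarrow> u x = profile h (norm x) + c"
proof -
  have D: "2 \<le> DIM(real^'n)" using N by simp
  have der: "(profile h has_real_derivative - slope h s) (at s)" if "0 < s" for s
    by (rule profile_has_derivative[OF h h_nonneg D C that])
  have "\<exists>c. 0 < r \<and> r < R \<longrightarrow> (AE x in lborel. x \<noteq> 0 \<and> norm x < r \<longrightarrow> u x = profile h (norm x) + c)" for r
  proof (cases "0 < r \<and> r < R")
    case True
    then show ?thesis using u_eq_primitive[of r "profile h"] der by simp
  qed blast
  then have "\<exists>c. \<forall>r. 0 < r \<and> r < R \<longrightarrow> (AE x in lborel. x \<noteq> 0 \<and> norm x < r \<longrightarrow> u x = profile h (norm x) + c r)"
    by (intro choice allI)
  then obtain c where "\<forall>r. 0 < r \<and> r < R \<longrightarrow> (AE x in lborel. x \<noteq> 0 \<and> norm x < r \<longrightarrow> u x = profile h (norm x) + c r)" ..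
  then have c: "AE x in lborel. x \<noteq> 0 \<and> norm x < r \<longrightarrow> u x = profile h (norm x) + c r" if "0 < r" "r < R" for r
    using that by blast
  define rr where "rr n = R - R / 2 * eps n" for n
  have rr: "R / 2 \<le> rr n" "rr n < R" for n
    using eps_le_1[of n] R by (auto simp: rr_def intro: mult_left_le)
  have rr0: "0 < rr n" for n using rr(1)[of n] R by linarith
  have half: "0 < R / 2" "R / 2 < R" using R by auto
  have cc: "c (rr n) = c (R / 2)" for n
  proof (rule ccontr)
    assume neq: "c (rr n) \<noteq> c (R / 2)"
    have "AE x in lborel. x \<notin> ball (0::real^'n) (R / 2)"
      using c[OF rr0 rr(2), of n] c[OF half] AE_lborel_singleton[of 0]
    proof eventually_elim
      case (elim x)
      then show ?case using neq rr(1)[of n] by force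
    qed
    then have "emeasure lborel (ball (0::real^'n) (R / 2)) = 0"
      by (subst (asm) AE_iff_measurable[of "ball 0 (R / 2)"]) auto
    then show False using R unit_ball_vol_neq_0[where 'a="real^'n"] by (simp add: emeasure_ball)
  qed
  have "AE x in lborel. \<forall>n. x \<noteq> 0 \<and> norm x < rr n \<longrightarrow> u x = profile h (norm x) + c (R / 2)"
    unfolding AE_all_countable using c[OF rr0 rr(2)] cc by simp
  then have "AE x in lborel. norm x < R \<longrightarrow> u x = profile h (norm x) + c (R / 2)"
    using AE_lborel_singleton[of 0]
  proof eventually_elim
    case (elim x)
    show ?case
    proof
      assume "norm x < R"
      have "(\<lambda>n. R - R / 2 * eps n) \<longlonglongrightarrow> R - R / 2 * 0" by (intro tendsto_intros eps_tendsto)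
      then have "rr \<longlonglongrightarrow> R" unfolding rr_def by simp
      from eventually_happens'[OF sequentially_bot order_tendstoD(1)[OF this \<open>norm x < R\<close>]]
      obtain n where "norm x < rr n" ..
      then show "u x = profile h (norm x) + c (R / 2)" using elim by blast
    qed
  qed
  then show ?thesis ..
qed

end

subsection \<open>Borel representatives and the regularity theorem\<close>

lemma ex_borel_AE_eq:
  fixes F :: "'a::euclidean_space \<Rightarrow> 'b::euclidean_space"
  assumes "F \<in> borel_measurable lebesgue"
  obtains F0 where "F0 \<in> borel_measurable borel" "AE x in lborel. F x = F0 x"
proof -
  have "\<exists>f. f \<in> borel_measurable borel \<and> (AE x in lborel. F x \<bullet> b = f x)" for b
  proof -
    have "(\<lambda>x. F x \<bullet> b) \<in> borel_measurable lebesgue" using assms by measurable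
    from completion_ex_borel_measurable_real[OF this] show ?thesis by auto
  qed
  then obtain f where f: "\<And>b. f b \<in> borel_measurable borel" "\<And>b. AE x in lborel. F x \<bullet> b = f b x"
    by metis
  note [measurable] = f(1)
  have "(\<lambda>x. \<Sum>b\<in>Basis. f b x *\<^sub>R b) \<in> borel_measurable borel" by measurable
  moreover have "AE x in lborel. \<forall>b\<in>Basis. F x \<bullet> b = f b x"
    using f(2) by (intro AE_finite_allI) auto
  then have "AE x in lborel. F x = (\<Sum>b\<in>Basis. f b x *\<^sub>R b)"
  proof eventually_elim
    case (elim x)
    have "F x = (\<Sum>b\<in>Basis. (F x \<bullet> b) *\<^sub>R b)" by (simp add: euclidean_representation)
    then show ?case using elim by simp
  qed
  ultimately show ?thesis by (rule that)
qed

lemma lebesgue_measurable_AE: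
  fixes F :: "'a::euclidean_space \<Rightarrow> 'b::euclidean_space"
  assumes "F0 \<in> borel_measurable borel" "AE x in lborel. F x = F0 x"
  shows "F \<in> borel_measurable lebesgue"
proof (rule borel_measurable_AE)
  show "F0 \<in> borel_measurable lebesgue" using assms(1) by (intro measurable_completion) simp
  show "AE x in lebesgue. F0 x = F x" using assms(2) by (intro AE_completion) auto
qed

lemma integrable_lebesgue_AE:
  fixes F :: "'a::euclidean_space \<Rightarrow> 'b::euclidean_space"
  assumes F0: "F0 \<in> borel_measurable borel" and eq: "AE x in lborel. F x = F0 x"
  shows "integrable lebesgue F \<longleftrightarrow> integrable lborel F0"
proof -
  have "integrable lebesgue F \<longleftrightarrow> integrable lebesgue F0"
    using lebesgue_measurable_AE[OF F0 eq] lebesgue_measurable_AE[OF F0, of F0] AE_completion[OF eq]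
    by (intro integrable_cong_AE) auto
  then show ?thesis using F0 by (simp add: integrable_completion)
qed

lemma integral_lebesgue_AE:
  fixes F :: "'a::euclidean_space \<Rightarrow> 'b::euclidean_space"
  assumes F0: "F0 \<in> borel_measurable borel" and eq: "AE x in lborel. F x = F0 x"
  shows "integral\<^sup>L lebesgue F = integral\<^sup>L lborel F0"
proof -
  have "integral\<^sup>L lebesgue F = integral\<^sup>L lebesgue F0"
    using lebesgue_measurable_AE[OF F0 eq] lebesgue_measurable_AE[OF F0, of F0] AE_completion[OF eq]
    by (intro integral_cong_AE) auto
  then show ?thesis using F0 by (simp add: integral_completion)
qed

lemma locally_Lp_cutoff:
  fixes F :: "'a::euclidean_space \<Rightarrow> 'b::euclidean_space"
  assumes F: "locally_Lp p (ball 0 R) F" and [measurable]: "F0 \<in> borel_measurable borel"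
    and eq: "AE x in lborel. x \<in> ball 0 R \<longrightarrow> F x = F0 x" and r: "r < R"
  shows "integrable lborel (\<lambda>x. indicator (ball 0 r) x *\<^sub>R norm (F0 x) ^ p)"
proof -
  have "set_integrable lebesgue (cball 0 r) (\<lambda>x. norm (F x) ^ p)"
    using F r unfolding locally_Lp_def by (metis cball_subset_ball_iff compact_cball dist_self add_0)
  then have 1: "integrable lebesgue (\<lambda>x. indicator (cball 0 r) x *\<^sub>R norm (F x) ^ p)"
    by (simp add: set_integrable_def)
  have F0: "(\<lambda>x. norm (F0 x) ^ p) \<in> borel_measurable borel" by measurable
  have 2: "(\<lambda>x. indicator (cball 0 r) x *\<^sub>R norm (F0 x) ^ p) \<in> borel_measurable borel"
    by (rule borel_measurable_scaleR[OF borel_measurable_indicator F0]) simp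
  have 3: "AE x in lborel. indicator (cball 0 r) x *\<^sub>R norm (F x) ^ p = indicator (cball 0 r) x *\<^sub>R norm (F0 x) ^ p"
    using eq by eventually_elim (use r in \<open>auto simp: indicator_def\<close>)
  have I: "integrable lborel (\<lambda>x. indicator (cball 0 r) x *\<^sub>R norm (F0 x) ^ p)"
    using 1 unfolding integrable_lebesgue_AE[OF 2 3] .
  show ?thesis
  proof (rule Bochner_Integration.integrable_bound[OF I])
    show "AE x in lborel. norm (indicator (ball 0 r) x *\<^sub>R norm (F0 x) ^ p) \<le> norm (indicator (cball 0 r) x *\<^sub>R norm (F0 x) ^ p)"
      by (intro AE_I2) (auto simp: indicator_def)
    show "(\<lambda>x. indicator (ball 0 r) x *\<^sub>R norm (F0 x) ^ p) \<in> borel_measurable lborel"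
      using F0 by (intro borel_measurable_scaleR borel_measurable_indicator) auto
  qed
qed

lemma locally_L1_cutoff:
  fixes F :: "'a::euclidean_space \<Rightarrow> 'b::euclidean_space"
  assumes F: "locally_Lp 1 (ball 0 R) F" and F0: "F0 \<in> borel_measurable borel"
    and eq: "AE x in lborel. x \<in> ball 0 R \<longrightarrow> F x = F0 x" and r: "r < R"
  shows "integrable lborel (\<lambda>x. indicator (ball 0 r) x *\<^sub>R F0 x)"
proof (rule Bochner_Integration.integrable_bound[OF locally_Lp_cutoff[OF assms]])
  show "(\<lambda>x. indicator (ball 0 r) x *\<^sub>R F0 x) \<in> borel_measurable lborel"
    using F0 by (intro borel_measurable_scaleR borel_measurable_indicator) auto
qed simp

lemma ex_borel_on_ball:
  fixes F :: "'a::euclidean_space \<Rightarrow> 'b::euclidean_space"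
  assumes "set_borel_measurable lebesgue (ball 0 R) F"
  obtains F0 where "F0 \<in> borel_measurable borel" "AE x in lborel. x \<in> ball 0 R \<longrightarrow> F x = F0 x"
proof -
  obtain F0 where F0: "F0 \<in> borel_measurable borel" "AE x in lborel. indicator (ball 0 R) x *\<^sub>R F x = F0 x"
    by (rule ex_borel_AE_eq[OF assms[unfolded set_borel_measurable_def]]) (rule that)
  from F0(2) have "AE x in lborel. x \<in> ball 0 R \<longrightarrow> F x = F0 x"
    by eventually_elim auto
  with F0(1) show ?thesis by (rule that)
qed

lemma weak_gradient_kern:
  fixes u u0 :: "real ^ 'n::finite \<Rightarrow> real" and g g0 :: "real ^ 'n \<Rightarrow> real ^ 'n"
  assumes wg: "has_weak_gradient u g (ball 0 R)"
    and u0: "u0 \<in> borel_measurable borel" "AE x in lborel. x \<in> ball 0 R \<longrightarrow> u x = u0 x"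
    and g0: "g0 \<in> borel_measurable borel" "AE x in lborel. x \<in> ball 0 R \<longrightarrow> g x = g0 x"
    and e: "0 < \<epsilon>" "norm x + \<epsilon> < r" "r < R"
  shows "(LBINT y. kern \<epsilon> (x - y) *\<^sub>R (indicator (ball 0 r) y *\<^sub>R g0 y)) =
      - (LBINT y. (indicator (ball 0 r) y *\<^sub>R u0 y) *\<^sub>R dkern \<epsilon> (x - y))"
proof -
  let ?u = "\<lambda>y. indicator (ball 0 r) y *\<^sub>R u0 y" and ?g = "\<lambda>y. indicator (ball 0 r) y *\<^sub>R g0 y"
    and ?k = "\<lambda>y. kern \<epsilon> (x - y)"
  note [measurable] = u0(1) g0(1)
  have u_int: "integrable lborel ?u"
    using wg u0 e(3) by (intro locally_L1_cutoff[where F = u]) (auto simp: has_weak_gradient_def)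
  have g_int: "integrable lborel ?g"
    using wg g0 e(3) by (intro locally_L1_cutoff[where F = g]) (auto simp: has_weak_gradient_def)
  have um: "?u \<in> borel_measurable borel"
    and gm: "?g \<in> borel_measurable borel"
    using borel_measurable_integrable[OF u_int] borel_measurable_integrable[OF g_int] by simp_all
  have far: "norm y < r" if "norm (x - y) < \<epsilon>" for y
    using that e norm_triangle_sub[of y x] by (simp add: norm_minus_commute)
  have k0: "kern \<epsilon> (x - y) = 0 \<and> dkern \<epsilon> (x - y) = 0" if "\<not> norm y < r" for y
  proof -
    have "\<epsilon> \<le> norm (x - y)" using far[of y] that by linarith
    moreover from this have "\<epsilon>\<^sup>2 \<le> (norm (x - y))\<^sup>2" using e by (intro power_mono) auto
    ultimately show ?thesis using kern_eq_0[OF e(1)] by (simp add: dkern_def flat_def)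
  qed
  have "cball x \<epsilon> \<subseteq> ball 0 R"
  proof
    fix y assume "y \<in> cball x \<epsilon>"
    then have "norm (x - y) \<le> \<epsilon>" by (simp add: dist_norm)
    then show "y \<in> ball 0 R" using e norm_triangle_sub[of y x] by (simp add: norm_minus_commute)
  qed
  then have test: "?k \<in> test_functions (ball 0 R)"
    using e by (intro kern_test_function)
  have km: "?k \<in> borel_measurable borel" "(\<lambda>y. dkern \<epsilon> (x - y)) \<in> borel_measurable borel"
    by measurable
  have kg: "integrable lborel (\<lambda>y. kern \<epsilon> (x - y) *\<^sub>R ?g y)"
  proof (rule Bochner_Integration.integrable_bound[OF g_int])
    show "AE y in lborel. norm (kern \<epsilon> (x - y) *\<^sub>R ?g y) \<le> norm (?g y)"
    proof (intro AE_I2)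
      fix y
      have "\<bar>kern \<epsilon> (x - y)\<bar> \<le> 1" using kern_nonneg[of \<epsilon> "x - y"] kern_le_1[of \<epsilon> "x - y"] by simp
      from mult_right_mono[OF this norm_ge_zero[of "?g y"]]
      show "norm (kern \<epsilon> (x - y) *\<^sub>R ?g y) \<le> norm (?g y)"
        unfolding norm_scaleR[of "kern \<epsilon> (x - y)"] by (simp only: mult_1_left)
    qed
    show "(\<lambda>y. kern \<epsilon> (x - y) *\<^sub>R ?g y) \<in> borel_measurable lborel"
      using borel_measurable_scaleR[OF km(1) gm] by simp
  qed
  show ?thesis
    unfolding vec_eq_iff
  proof
    fix i
    have "(LINT y:ball 0 R|lebesgue. u y * partial_deriv i ?k y) =
        (LBINT y. (?u y *\<^sub>R dkern \<epsilon> (x - y)) \<bullet> axis i 1)"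
      unfolding set_lebesgue_integral_def
    proof (rule integral_lebesgue_AE)
      show "(\<lambda>y. (?u y *\<^sub>R dkern \<epsilon> (x - y)) \<bullet> axis i 1) \<in> borel_measurable borel"
        by (intro borel_measurable_inner borel_measurable_scaleR um km) simp
      show "AE y in lborel. indicator (ball 0 R) y *\<^sub>R (u y * partial_deriv i ?k y) =
          (?u y *\<^sub>R dkern \<epsilon> (x - y)) \<bullet> axis i 1"
        using u0(2)
      proof eventually_elim
        case (elim y)
        have p: "partial_deriv i ?k y = dkern \<epsilon> (x - y) $ i"
          by (simp add: partial_deriv_kern dkern_def)
        show ?case
        proof (cases "norm y < r")
          case True
          then show ?thesis using elim e by (simp add: p inner_axis)
        next
          case False
          then show ?thesis using k0[OF False] by (simp add: p)
        qed
      qed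
    qed
    also have "\<dots> = (LBINT y. ?u y *\<^sub>R dkern \<epsilon> (x - y)) \<bullet> axis i 1"
      using integrable_dkern[OF e(1) u_int] by (rule integral_inner_left)
    finally have L: "(LINT y:ball 0 R|lebesgue. u y * partial_deriv i ?k y) =
      (LBINT y. ?u y *\<^sub>R dkern \<epsilon> (x - y)) $ i" by (simp add: inner_axis)
    have "(LINT y:ball 0 R|lebesgue. g y $ i * kern \<epsilon> (x - y)) =
        (LBINT y. (kern \<epsilon> (x - y) *\<^sub>R ?g y) \<bullet> axis i 1)"
      unfolding set_lebesgue_integral_def
    proof (rule integral_lebesgue_AE)
      show "(\<lambda>y. (kern \<epsilon> (x - y) *\<^sub>R ?g y) \<bullet> axis i 1) \<in> borel_measurable borel"
        by (intro borel_measurable_inner borel_measurable_scaleR[OF km(1) gm]) simp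
      show "AE y in lborel. indicator (ball 0 R) y *\<^sub>R (g y $ i * kern \<epsilon> (x - y)) =
          (kern \<epsilon> (x - y) *\<^sub>R ?g y) \<bullet> axis i 1"
        using g0(2)
      proof eventually_elim
        case (elim y)
        show ?case
        proof (cases "norm y < r")
          case True
          then show ?thesis using elim e by (simp add: inner_axis)
        next
          case False
          then show ?thesis using k0[OF False] by simp
        qed
      qed
    qed
    also have "\<dots> = (LBINT y. kern \<epsilon> (x - y) *\<^sub>R ?g y) \<bullet> axis i 1"
      using kg by (rule integral_inner_left)
    finally have G: "(LINT y:ball 0 R|lebesgue. g y $ i * kern \<epsilon> (x - y)) =
      (LBINT y. kern \<epsilon> (x - y) *\<^sub>R ?g y) $ i" by (simp add: inner_axis)
    have "(LINT y:ball 0 R|lebesgue. u y * partial_deriv i ?k y) =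
      - (LINT y:ball 0 R|lebesgue. g y $ i * kern \<epsilon> (x - y))"
      using wg test unfolding has_weak_gradient_def by blast
    then show "(LBINT y. kern \<epsilon> (x - y) *\<^sub>R ?g y) $ i =
      (- (LBINT y. ?u y *\<^sub>R dkern \<epsilon> (x - y))) $ i"
      unfolding L G by simp
  qed
qed

lemma N_Laplace_eq_tail_kern:
  fixes g g0 :: "real ^ 'n::finite \<Rightarrow> real ^ 'n"
  assumes eq: "N_Laplace_eq (ball 0 R) g h"
    and g0: "g0 \<in> borel_measurable borel" "AE x in lborel. x \<in> ball 0 R \<longrightarrow> g x = g0 x"
    and h0: "h0 \<in> borel_measurable borel" "AE x in lborel. indicator (ball 0 R) x *\<^sub>R h x = h0 x"
    and e: "0 < R" "0 < \<epsilon>" "\<epsilon> \<le> a" "a + \<epsilon> < R\<^sup>2"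
  shows "(LBINT x. (norm (g0 x) ^ (CARD('n) - 2) *\<^sub>R g0 x) \<bullet> ((- 2 * kern \<epsilon> ((norm x)\<^sup>2 - a)) *\<^sub>R x)) =
      (LBINT x. h0 x * tail_kern \<epsilon> a ((norm x)\<^sup>2))"
proof -
  note [measurable] = g0(1) h0(1)
  let ?\<phi> = "\<lambda>x::real^'n. tail_kern \<epsilon> a ((norm x)\<^sup>2)"
  have "0 \<le> a" using e by linarith
  note test = tail_kern_test_function[OF e(2) this e(4,1)]
  have grad: "gradient ?\<phi> x = (- 2 * kern \<epsilon> ((norm x)\<^sup>2 - a)) *\<^sub>R x" for x
    by (simp add: gradient_def vec_eq_iff test(2))
  have \<phi>m: "?\<phi> \<in> borel_measurable borel"
  proof -
    have "tail_kern \<epsilon> a \<in> borel_measurable borel"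
      using C_real_tail_kern[OF e(2), of 0] by (intro borel_measurable_continuous_onI) simp
    then show ?thesis by measurable
  qed
  have lhs: "(LINT x:ball 0 R|lebesgue. (norm (g x) ^ (CARD('n) - 2) *\<^sub>R g x) \<bullet> gradient ?\<phi> x) =
      (LBINT x. (norm (g0 x) ^ (CARD('n) - 2) *\<^sub>R g0 x) \<bullet> ((- 2 * kern \<epsilon> ((norm x)\<^sup>2 - a)) *\<^sub>R x))"
    unfolding set_lebesgue_integral_def grad
  proof (rule integral_lebesgue_AE)
    show "AE x in lborel. indicator (ball 0 R) x *\<^sub>R ((norm (g x) ^ (CARD('n) - 2) *\<^sub>R g x) \<bullet> ((- 2 * kern \<epsilon> ((norm x)\<^sup>2 - a)) *\<^sub>R x)) =
      (norm (g0 x) ^ (CARD('n) - 2) *\<^sub>R g0 x) \<bullet> ((- 2 * kern \<epsilon> ((norm x)\<^sup>2 - a)) *\<^sub>R x)"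
      using g0(2)
    proof eventually_elim
      case (elim x)
      show ?case
      proof (cases "norm x < R")
        case False
        then have "R\<^sup>2 \<le> (norm x)\<^sup>2" using e by (intro power_mono) auto
        then have "\<epsilon> \<le> (norm x)\<^sup>2 - a" using e by linarith
        then have "\<epsilon> \<le> norm ((norm x)\<^sup>2 - a)" unfolding real_norm_def by linarith
        then have "kern \<epsilon> ((norm x)\<^sup>2 - a) = 0" by (rule kern_eq_0[OF e(2)])
        then show ?thesis by simp
      qed (use elim in simp)
    qed
  qed measurable
  have rhs: "(LINT x:ball 0 R|lebesgue. h x * ?\<phi> x) = (LBINT x. h0 x * ?\<phi> x)"
    unfolding set_lebesgue_integral_def
  proof (rule integral_lebesgue_AE)
    show "(\<lambda>x. h0 x * ?\<phi> x) \<in> borel_measurable borel" using h0(1) \<phi>m by (rule borel_measurable_times)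
    show "AE x in lborel. indicator (ball 0 R) x *\<^sub>R (h x * ?\<phi> x) = h0 x * ?\<phi> x"
      using h0(2)
    proof eventually_elim
      case (elim x)
      show ?case unfolding elim[symmetric] by simp
    qed
  qed
  have "(LINT x:ball 0 R|lebesgue. (norm (g x) ^ (CARD('n) - 2) *\<^sub>R g x) \<bullet> gradient ?\<phi> x) =
      (LINT x:ball 0 R|lebesgue. h x * ?\<phi> x)"
    using eq test(1) unfolding N_Laplace_eq_def by (rule bspec)
  then show ?thesis by (rule trans[OF lhs[symmetric] trans[OF _ rhs]])
qed

theorem theorem5p1:
  fixes R :: real and f :: "real \<Rightarrow> real" and u :: "real ^ 'n::finite \<Rightarrow> real"
  assumes N: "CARD('n) \<ge> 2"
    and R: "R > 0"
    and f_nonneg: "\<forall>t\<ge>0. f t \<ge> 0"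
    and f1: "\<exists>\<theta>. 0 < \<theta> \<and> \<theta> < 1 \<and> locally_Hoelder \<theta> {0..} f"
    and f2: "Liminf at_top (\<lambda>t. ereal (f t * t powr (1 - real CARD('n)))) > 0"
    and f3: "\<exists>\<kappa>>0. mono_on {0..} (\<lambda>t. f t + \<kappa> * t ^ (CARD('n) - 1))"
    and subexp: "\<exists>\<beta>>0. bdd_above ((\<lambda>t. f t * exp (- \<beta> * t)) ` {0..})"
    and u_punctured: "solution_punctured R f u"
    and u_ball: "solution_ball R f u"
  shows "\<exists>\<theta>. 0 < \<theta> \<and> \<theta> < 1 \<and>
           (\<exists>v. (AE x in lebesgue. x \<in> ball 0 R \<longrightarrow> u x = v x) \<and>
                locally_C1_Hoelder \<theta> (ball 0 R) v)"
proof -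
  obtain w where w: "AE x in lborel. x \<in> ball 0 R - {0} \<longrightarrow> u x = w (norm x)"
    using u_punctured by (auto simp: solution_punctured_def AE_completion_iff)
  obtain g where wg: "has_weak_gradient u g (ball 0 R)"
    and g_Lp: "locally_Lp (CARD('n) - 1) (ball 0 R) g"
    and Laplace: "N_Laplace_eq (ball 0 R) g (\<lambda>x. f (u x))"
    using u_ball unfolding solution_ball_def by blast
  have u_nonneg: "AE x in lborel. x \<in> ball 0 R \<longrightarrow> 0 \<le> u x"
    and f_int: "integrable lebesgue (\<lambda>x. indicator (ball 0 R) x *\<^sub>R f (u x))"
    and f_bd: "locally_bounded_ae (cball 0 R - {0}) (\<lambda>x. f (u x))"
    using u_ball by (auto simp: solution_ball_def AE_completion_iff set_integrable_def)
  have u_L1: "locally_Lp 1 (ball 0 R) u" and g_L1: "locally_Lp 1 (ball 0 R) g"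
    using wg by (auto simp: has_weak_gradient_def)
  obtain u0 where u0: "u0 \<in> borel_measurable borel" "AE x in lborel. x \<in> ball 0 R \<longrightarrow> u x = u0 x"
    by (rule ex_borel_on_ball[of R u]) (use u_L1 that in \<open>auto simp: locally_Lp_def\<close>)
  obtain g0 where g0: "g0 \<in> borel_measurable borel" "AE x in lborel. x \<in> ball 0 R \<longrightarrow> g x = g0 x"
    by (rule ex_borel_on_ball[of R g]) (use g_L1 that in \<open>auto simp: locally_Lp_def\<close>)
  obtain h1 where h1: "h1 \<in> borel_measurable borel" "AE x in lborel. indicator (ball 0 R) x *\<^sub>R f (u x) = h1 x"
    by (rule ex_borel_AE_eq[OF borel_measurable_integrable[OF f_int]]) (rule that)
  define h where "h x = max 0 (h1 x)" for x
  have h_meas: "h \<in> borel_measurable borel" using h1(1) unfolding h_def by measurable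
  have h_nonneg: "0 \<le> h x" for x by (simp add: h_def)
  have h_eq: "AE x in lborel. indicator (ball 0 R) x *\<^sub>R f (u x) = h x"
    using h1(2) u_nonneg
  proof eventually_elim
    case (elim x)
    have "0 \<le> h1 x"
    proof (cases "x \<in> ball 0 R")
      case True
      then have "h1 x = f (u x)" "0 \<le> u x" using elim by simp_all
      then show ?thesis using f_nonneg by metis
    next
      case False
      then show ?thesis using elim(1) by simp
    qed
    then show ?case unfolding h_def elim(1) by (simp only: max_absorb2)
  qed
  have h: "integrable lborel h"
    using f_int integrable_lebesgue_AE[OF h_meas h_eq] by simp
  have radial: "AE x in lborel. x \<noteq> 0 \<and> norm x < R \<longrightarrow> u0 x = w (norm x)"
    using w u0(2) by eventually_elim auto
  note setting = R N g0(1) h h_nonneg locally_L1_cutoff[OF u_L1 u0] locally_L1_cutoff[OF g_L1 g0]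
    locally_Lp_cutoff[OF g_Lp g0] radial weak_gradient_kern[OF wg u0 g0]
    N_Laplace_eq_tail_kern[OF Laplace g0 h_meas h_eq R]
  obtain \<beta> where \<beta>: "0 < \<beta>" and "bdd_above ((\<lambda>t. f t * exp (- \<beta> * t)) ` {0..})"
    using subexp by blast
  then obtain M0 where M0: "\<And>t. 0 \<le> t \<Longrightarrow> f t * exp (- \<beta> * t) \<le> M0"
    unfolding bdd_above_def by auto
  have f_exp: "f t \<le> max 0 M0 * exp (\<beta> * t)" if "0 \<le> t" for t
  proof -
    have "f t = f t * exp (- \<beta> * t) * exp (\<beta> * t)" by (simp add: exp_minus)
    also have "\<dots> \<le> max 0 M0 * exp (\<beta> * t)" using M0[OF that] by (intro mult_right_mono) auto
    finally show ?thesis .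
  qed
  have growth: "AE x in lborel. norm x < R \<longrightarrow> h x \<le> max 0 M0 * exp (\<beta> * u0 x)"
    using h_eq u0(2) u_nonneg
  proof eventually_elim
    case (elim x)
    show ?case
    proof
      assume "norm x < R"
      then have "h x = f (u0 x)" "0 \<le> u0 x" using elim by auto
      then show "h x \<le> max 0 M0 * exp (\<beta> * u0 x)" using f_exp by simp
    qed
  qed
  have away: "\<exists>C. AE x in lborel. a \<le> norm x \<longrightarrow> h x \<le> C" if "0 < a" for a
  proof -
    have "compact (cball (0::real^'n) R - ball 0 a)" by (intro compact_diff compact_cball open_ball)
    moreover have "cball (0::real^'n) R - ball 0 a \<subseteq> cball 0 R - {0}" using that by auto
    ultimately obtain C where C: "AE x in lborel. x \<in> cball 0 R - ball 0 a \<longrightarrow> \<bar>f (u x)\<bar> \<le> C"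
      using f_bd unfolding locally_bounded_ae_def AE_completion_iff by meson
    have "AE x in lborel. a \<le> norm x \<longrightarrow> h x \<le> max 0 C"
      using C h_eq
    proof eventually_elim
      case (elim x)
      then show ?case by (cases "norm x < R") (auto simp: indicator_def)
    qed
    then show ?thesis ..
  qed
  obtain C where C: "AE x in lborel. h x \<le> C"
    using rhs_bounded[OF setting \<beta> _ growth away] by auto
  obtain c where c: "AE x in lborel. norm x < R \<longrightarrow> u0 x = profile h (norm x) + c"
    using u_eq_profile[OF setting C] by auto
  let ?v = "\<lambda>x::real^'n. profile h (norm x) + c"
  have "AE x in lborel. x \<in> ball 0 R \<longrightarrow> u x = ?v x"
    using c u0(2) by eventually_elim auto
  then have "AE x in lebesgue. x \<in> ball 0 R \<longrightarrow> u x = ?v x"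
    by (rule AE_completion)
  moreover have "locally_C1_Hoelder (1 / real CARD('n)) (ball 0 R) ?v"
    using profile_locally_C1_Hoelder[OF h h_nonneg _ C R, of c] N by simp
  moreover have "0 < 1 / real CARD('n)" "1 / real CARD('n) < 1" using N by auto
  ultimately show ?thesis by (intro exI[of _ "1 / real CARD('n)"] exI[of _ ?v] conjI)
qed

end
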